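(* Let $\mathcal{H}$ be a complex Hilbert space of dimension $k$ with $1<k<\infty$, let $\Gamma$ be an anti-unitary involution on $\mathcal{H}$, and let $S$ and $S'$ be mutually commuting covariance operators on $\mathcal{H}$ (with respect to $\Gamma$). Suppose $k=2n$ or $k=2n+1$ for some $n\in\mathbb{N}$, and let $\alpha_1,\dots,\alpha_n$ and $\alpha_1',\dots,\alpha_n'$ be the coefficients associated to $S$ and $S'$, respectively (with respect to a common diagonalizing basis). Then $(S,S')$ has the affine property if and only if $\alpha_i=\alpha_i'$ for all $i=1,\dots,n$ except for at most one index $i_0\in\{1,\dots,n\}$. Moreover, if $\lambda\phi_S+(1-\lambda)\phi_{S'}=\phi_{\lambda S+(1-\lambda)S'}$ holds for some $0<\lambda<1$, then the couple $(S,S')$ has the affine property.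
   Context: Let $\mathcal{H}$ be a complex Hilbert space with scalar product $(\cdot,\cdot)$, linear in the first variable, and $\Gamma:\mathcal{H}\to\mathcal{H}$ an anti-unitary involution (conjugate-linear, $\Gamma^2=\mathbf{1}$, $(\Gamma\xi,\Gamma\eta)=(\eta,\xi)$). The self-dual CAR algebra $A(\mathcal{H},\Gamma)$ is the universal $C^*$-algebra generated by $\{b(\xi)\mid\xi\in\mathcal{H}\}$ with relations: $b(\alpha\xi+\beta\eta)=\alpha b(\xi)+\beta b(\eta)$, $b(\Gamma\xi)=b(\xi)^*$, and $b(\xi)b(\eta)^*+b(\eta)^*b(\xi)=(\xi,\eta)\mathbf{1}$, for all $\alpha,\beta\in\mathbb{C}$, $\xi,\eta\in\mathcal{H}$. A state $\phi$ on $A(\mathcal{H},\Gamma)$ is called quasi-free if for all $\xi_1,\dots,\xi_m\in\mathcal{H}$ one has $\phi(b(\xi_1)\cdots b(\xi_m))=0$ when $m$ is odd, and, when $m=2p$, $$\phi(b(\xi_1)\cdots b(\xi_{2p}))=(-1)^{\frac{(p-1)p}{2}}\sum_{\sigma\in T_{2p}}\mathrm{sgn}(\sigma)\prod_{i=1}^p\phi(b(\xi_{\sigma(i)})b(\xi_{\sigma(i+p)})),$$ where $T_{2p}=\{\sigma\in S_{2p}\mid\sigma(1)<\cdots<\sigma(p),\ \sigma(i)<\sigma(i+p)\ \text{for } i=1,\dots,p\}$ and $S_{2p}$ is the symmetric group. A covariance operator on $\mathcal{H}$ (with respect to $\Gamma$) is a bounded linear operator $S$ on $\mathcal{H}$ with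 $0\leq S\leq\mathbf{1}$ and $\Gamma S\Gamma=\mathbf{1}-S$. For every covariance operator $S$ there exists a unique quasi-free state, denoted $\phi_S$, on $A(\mathcal{H},\Gamma)$ satisfying $(S\xi,\eta)=\phi_S(b(\eta)^*b(\xi))$ for all $\xi,\eta\in\mathcal{H}$; this is a one-to-one correspondence between covariance operators and quasi-free states. For covariance operators $S,S'$ and $0\leq\lambda\leq1$, the operator $\lambda S+(1-\lambda)S'$ is again a covariance operator. The couple $(S,S')$ is said to have the affine property if $\phi_{\lambda S+(1-\lambda)S'}=\lambda\phi_S+(1-\lambda)\phi_{S'}$ for all $0\leq\lambda\leq1$. Coefficients associated to commuting covariance operators $S,S'$: by simultaneous diagonalization, if $\dim\mathcal{H}=2n$ one can choose an orthonormal basis $\{\varepsilon_1,\dots,\varepsilon_n,\Gamma\varepsilon_1,\dots,\Gamma\varepsilon_n\}$ of $\mathcal{H}$ and numbers $\alpha_i,\alpha_i'\in[0,1]$ such that, for $i=1,\dots,n$, $$S\varepsilon_i=\alpha_i\varepsilon_i,\quad S\Gamma\varepsilon_i=(1-\alpha_i)\Gamma\varepsilon_i,\quad S'\varepsilon_i=\alpha_i'\varepsilon_i,\quad S'\Gamma\varepsilon_i=(1-\alpha_i')\Gamma\varepsilon_i.$$ If $\dim\mathcal{H}=2n+1$, one can choose an orthonormal basis $\{\varepsilon_0,\varepsilon_1,\dots,\varepsilon_n,\Gamma\varepsilon_1,\dots,\Gamma\varepsilon_n\}$ and $\alpha_i,\alpha_i'\in[0,1]$ ($i=1,\dots,n$)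 satisfying the same equations for $i=1,\dots,n$ and, in addition, $\Gamma\varepsilon_0=\varepsilon_0$ and $S\varepsilon_0=S'\varepsilon_0=\frac12\varepsilon_0$. Fix any such choice; the $\alpha_i$ and $\alpha_i'$ are called the coefficients associated to $S$ and $S'$, respectively. *)

theory Defs
  imports
    "HOL-Analysis.Analysis"
    "HOL-Combinatorics.Permutations"
    "HOL-Library.Poly_Mapping"
begin

section \<open>Complex Hilbert spaces and C*-algebras\<close>

class complex_vector = real_vector +
  fixes scaleC :: "complex \<Rightarrow> 'a \<Rightarrow> 'a"  (infixr \<open>*\<^sub>C\<close> 75)
  assumes scaleC_add_right: "c *\<^sub>C (x + y) = c *\<^sub>C x + c *\<^sub>C y"
    and scaleC_add_left: "(c + d) *\<^sub>C x = c *\<^sub>C x + d *\<^sub>C x"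
    and scaleC_scaleC: "c *\<^sub>C d *\<^sub>C x = (c * d) *\<^sub>C x"
    and scaleC_of_real: "complex_of_real r *\<^sub>C x = r *\<^sub>R x"

global_interpretation cvec: vector_space "scaleC :: complex \<Rightarrow> 'a \<Rightarrow> 'a::complex_vector"
proof unfold_locales
  show "1 *\<^sub>C x = x" for x :: 'a
    using scaleC_of_real[of 1 x] by simp
qed (simp_all add: scaleC_add_right scaleC_add_left scaleC_scaleC)

text \<open>The scalar product is linear in its first variable.  Definiteness and the formula for the
  norm are inherited from \<^class>\<open>real_inner\<close>, whose inner product is its real part.\<close>

class chilbert_space = complex_vector + real_inner + complete_space +
  fixes cinner :: "'a \<Rightarrow> 'a \<Rightarrow> complex"
  assumes cinner_add_left: "cinner (x + y) z = cinner x z + cinner y z"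
    and cinner_scaleC_left: "cinner (c *\<^sub>C x) y = c * cinner x y"
    and cinner_commute: "cinner y x = cnj (cinner x y)"
    and Re_cinner: "Re (cinner x y) = inner x y"

text \<open>Unital C*-algebras (nonzero ones, since \<^class>\<open>real_normed_algebra_1\<close> has \<open>norm 1 = 1\<close>).\<close>

class cstar_algebra = complex_vector + real_normed_algebra_1 + banach +
  fixes star :: "'a \<Rightarrow> 'a"
  assumes mult_scaleC_left: "(c *\<^sub>C x) * y = c *\<^sub>C (x * y)"
    and mult_scaleC_right: "x * (c *\<^sub>C y) = c *\<^sub>C (x * y)"
    and norm_scaleC: "norm (c *\<^sub>C x) = cmod c * norm x"
    and star_add: "star (x + y) = star x + star y"
    and star_scaleC: "star (c *\<^sub>C x) = cnj c *\<^sub>C star x"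
    and star_mult: "star (x * y) = star y * star x"
    and star_star: "star (star x) = x"
    and cstar_identity: "norm (star x * x) = (norm x)\<^sup>2"


section \<open>Universal C*-algebras on generators and relations\<close>

text \<open>The free unital *-algebra over \<open>'g\<close> is the monoid algebra, over the complex numbers, of the
  free monoid on the letters \<open>g\<close> and \<open>g\<^sup>*\<close>; the product is that of \<^theory>\<open>HOL-Library.Poly_Mapping\<close>.\<close>

datatype 'g letter = Gen 'g | Adj 'g

datatype 'g word = Word (letters: "'g letter list")

instantiation word :: (type) monoid_add
begin

definition zero_word :: "'a word" where "0 = Word []"

definition plus_word :: "'a word \<Rightarrow> 'a word \<Rightarrow> 'a word"
  where "u + v = Word (letters u @ letters v)"

instance
  by standard (simp_all add: zero_word_def plus_word_def)

end

type_synonym 'g free_algebra = "'g word \<Rightarrow>\<^sub>0 complex"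

definition fgen :: "'g \<Rightarrow> 'g free_algebra"
  where "fgen g = Poly_Mapping.single (Word [Gen g]) 1"

definition fscalar :: "complex \<Rightarrow> 'g free_algebra"
  where "fscalar c = Poly_Mapping.single 0 c"

fun star_letter :: "'g letter \<Rightarrow> 'g letter" where
  "star_letter (Gen g) = Adj g"
| "star_letter (Adj g) = Gen g"

definition star_word :: "'g word \<Rightarrow> 'g word"
  where "star_word w = Word (rev (map star_letter (letters w)))"

definition fstar :: "'g free_algebra \<Rightarrow> 'g free_algebra"
  where "fstar x = (\<Sum>w\<in>Poly_Mapping.keys x.
    Poly_Mapping.single (star_word w) (cnj (Poly_Mapping.lookup x w)))"

fun eval_letter :: "('g \<Rightarrow> 'a::cstar_algebra) \<Rightarrow> 'g letter \<Rightarrow> 'a" where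
  "eval_letter b (Gen g) = b g"
| "eval_letter b (Adj g) = star (b g)"

definition eval_word :: "('g \<Rightarrow> 'a::cstar_algebra) \<Rightarrow> 'g word \<Rightarrow> 'a"
  where "eval_word b w = prod_list (map (eval_letter b) (letters w))"

text \<open>The canonical unital *-homomorphism from the free *-algebra extending \<open>b\<close>.\<close>

definition feval :: "('g \<Rightarrow> 'a::cstar_algebra) \<Rightarrow> 'g free_algebra \<Rightarrow> 'a"
  where "feval b x = (\<Sum>w\<in>Poly_Mapping.keys x. Poly_Mapping.lookup x w *\<^sub>C eval_word b w)"

definition cstar_seminorm :: "('g free_algebra \<Rightarrow> real) \<Rightarrow> bool"
  where "cstar_seminorm p \<longleftrightarrow>
    (\<forall>x y. p (x + y) \<le> p x + p y) \<and>
    (\<forall>c x. p (fscalar c * x) = cmod c * p x) \<and>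
    (\<forall>x y. p (x * y) \<le> p x * p y) \<and>
    (\<forall>x. p (fstar x * x) = (p x)\<^sup>2)"

text \<open>\<open>'a\<close> together with \<open>b\<close> is the universal C*-algebra generated by \<open>{b g | g}\<close> subject to the
  relations \<open>R\<close>, i.e. the Hausdorff completion of the free *-algebra for the largest C*-seminorm
  that vanishes on \<open>R\<close>.  The last clause is the universal property: C*-seminorms vanishing on \<open>R\<close>
  are exactly the functions \<open>x \<mapsto> norm (feval c x)\<close> for \<open>c\<close> a family satisfying \<open>R\<close> in some unital
  C*-algebra \<open>B\<close> (of any type, possibly zero), and being bounded by \<open>norm (feval b x)\<close> means that
  \<open>b g \<mapsto> c g\<close> extends to a unital *-homomorphism into \<open>B\<close>.  Quantifying over seminorms avoids
  quantifying over the type of \<open>B\<close>, which HOL does not allow.\<close>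

definition universal_cstar_algebra :: "'g free_algebra set \<Rightarrow> ('g \<Rightarrow> 'a::cstar_algebra) \<Rightarrow> bool"
  where "universal_cstar_algebra R b \<longleftrightarrow>
    (\<forall>r\<in>R. feval b r = 0) \<and>
    closure (range (feval b)) = UNIV \<and>
    (\<forall>p. cstar_seminorm p \<and> (\<forall>r\<in>R. p r = 0) \<longrightarrow> (\<forall>x. p x \<le> norm (feval b x)))"


section \<open>The self-dual CAR algebra\<close>

definition antiunitary_involution :: "('h::chilbert_space \<Rightarrow> 'h) \<Rightarrow> bool"
  where "antiunitary_involution \<Gamma> \<longleftrightarrow>
    (\<forall>\<xi> \<eta>. \<Gamma> (\<xi> + \<eta>) = \<Gamma> \<xi> + \<Gamma> \<eta>) \<and>
    (\<forall>c \<xi>. \<Gamma> (c *\<^sub>C \<xi>) = cnj c *\<^sub>C \<Gamma> \<xi>) \<and>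
    (\<forall>\<xi>. \<Gamma> (\<Gamma> \<xi>) = \<xi>) \<and>
    (\<forall>\<xi> \<eta>. cinner (\<Gamma> \<xi>) (\<Gamma> \<eta>) = cinner \<eta> \<xi>)"

definition CAR_relations :: "('h::chilbert_space \<Rightarrow> 'h) \<Rightarrow> 'h free_algebra set"
  where "CAR_relations \<Gamma> =
    {fgen (\<alpha> *\<^sub>C \<xi> + \<beta> *\<^sub>C \<eta>) - (fscalar \<alpha> * fgen \<xi> + fscalar \<beta> * fgen \<eta>) | \<alpha> \<beta> \<xi> \<eta>. True} \<union>
    {fgen (\<Gamma> \<xi>) - fstar (fgen \<xi>) | \<xi>. True} \<union>
    {fgen \<xi> * fstar (fgen \<eta>) + fstar (fgen \<eta>) * fgen \<xi> - fscalar (cinner \<xi> \<eta>) | \<xi> \<eta>. True}"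

definition self_dual_CAR_algebra ::
  "('h::chilbert_space \<Rightarrow> 'h) \<Rightarrow> ('h \<Rightarrow> 'a::cstar_algebra) \<Rightarrow> bool"
  where "self_dual_CAR_algebra \<Gamma> b \<longleftrightarrow> universal_cstar_algebra (CAR_relations \<Gamma>) b"


section \<open>Quasi-free states and covariance operators\<close>

definition state :: "('a::cstar_algebra \<Rightarrow> complex) \<Rightarrow> bool"
  where "state \<phi> \<longleftrightarrow>
    (\<forall>x y. \<phi> (x + y) = \<phi> x + \<phi> y) \<and>
    (\<forall>c x. \<phi> (c *\<^sub>C x) = c * \<phi> x) \<and>
    (\<forall>x. \<phi> (star x * x) \<in> \<real>\<^sub>\<ge>\<^sub>0) \<and>
    \<phi> 1 = 1"

definition pairings :: "nat \<Rightarrow> (nat \<Rightarrow> nat) set"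
  where "pairings p = {\<sigma>. \<sigma> permutes {1..2 * p} \<and> strict_mono_on {1..p} \<sigma> \<and>
    (\<forall>i\<in>{1..p}. \<sigma> i < \<sigma> (i + p))}"

definition quasi_free :: "('h \<Rightarrow> 'a::cstar_algebra) \<Rightarrow> ('a \<Rightarrow> complex) \<Rightarrow> bool"
  where "quasi_free b \<phi> \<longleftrightarrow> state \<phi> \<and>
    (\<forall>m \<xi>. odd m \<longrightarrow> \<phi> (\<Prod>i\<leftarrow>[1..<m + 1]. b (\<xi> i)) = 0) \<and>
    (\<forall>p \<xi>. \<phi> (\<Prod>i\<leftarrow>[1..<2 * p + 1]. b (\<xi> i)) =
      (-1) ^ ((p - 1) * p div 2) *
      (\<Sum>\<sigma>\<in>pairings p. of_int (sign \<sigma>) *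
        (\<Prod>i = 1..p. \<phi> (b (\<xi> (\<sigma> i)) * b (\<xi> (\<sigma> (i + p)))))))"

definition positive_op :: "('h::chilbert_space \<Rightarrow> 'h) \<Rightarrow> bool"
  where "positive_op T \<longleftrightarrow> (\<forall>\<xi>. cinner (T \<xi>) \<xi> \<in> \<real>\<^sub>\<ge>\<^sub>0)"

definition covariance_operator :: "('h::chilbert_space \<Rightarrow> 'h) \<Rightarrow> ('h \<Rightarrow> 'h) \<Rightarrow> bool"
  where "covariance_operator \<Gamma> S \<longleftrightarrow>
    bounded_linear S \<and> (\<forall>c \<xi>. S (c *\<^sub>C \<xi>) = c *\<^sub>C S \<xi>) \<and>
    positive_op S \<and> positive_op (\<lambda>\<xi>. \<xi> - S \<xi>) \<and>
    (\<forall>\<xi>. \<Gamma> (S (\<Gamma> \<xi>)) = \<xi> - S \<xi>)"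

text \<open>The state \<open>\<phi>\<^sub>S\<close>.\<close>

definition qf_state ::
  "('h::chilbert_space \<Rightarrow> 'a::cstar_algebra) \<Rightarrow> ('h \<Rightarrow> 'h) \<Rightarrow> 'a \<Rightarrow> complex"
  where "qf_state b S = (THE \<phi>. quasi_free b \<phi> \<and>
    (\<forall>\<xi> \<eta>. cinner (S \<xi>) \<eta> = \<phi> (star (b \<eta>) * b \<xi>)))"


section \<open>The affine property\<close>

definition affine_at ::
  "('h::chilbert_space \<Rightarrow> 'a::cstar_algebra) \<Rightarrow> ('h \<Rightarrow> 'h) \<Rightarrow> ('h \<Rightarrow> 'h) \<Rightarrow> real \<Rightarrow> bool"
  where "affine_at b S S' l \<longleftrightarrow>
    qf_state b (\<lambda>\<xi>. l *\<^sub>R S \<xi> + (1 - l) *\<^sub>R S' \<xi>) =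
    (\<lambda>x. of_real l * qf_state b S x + of_real (1 - l) * qf_state b S' x)"

definition affine_property ::
  "('h::chilbert_space \<Rightarrow> 'a::cstar_algebra) \<Rightarrow> ('h \<Rightarrow> 'h) \<Rightarrow> ('h \<Rightarrow> 'h) \<Rightarrow> bool"
  where "affine_property b S S' \<longleftrightarrow> (\<forall>l. 0 \<le> l \<and> l \<le> 1 \<longrightarrow> affine_at b S S' l)"

definition orthonormal_basis :: "'h::chilbert_space list \<Rightarrow> bool"
  where "orthonormal_basis xs \<longleftrightarrow>
    (\<forall>i<length xs. \<forall>j<length xs. cinner (xs ! i) (xs ! j) = (if i = j then 1 else 0)) \<and>
    cvec.span (set xs) = UNIV"

text \<open>\<open>\<alpha>\<close> and \<open>\<alpha>'\<close> are coefficients associated to \<open>S\<close> and \<open>S'\<close> with respect to the common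
  diagonalizing basis \<open>\<epsilon> 1, \<dots>, \<epsilon> n, \<Gamma> (\<epsilon> 1), \<dots>, \<Gamma> (\<epsilon> n)\<close>, preceded by \<open>\<epsilon> 0\<close> if
  \<open>k = 2 * n + 1\<close>.  Values at indices outside these ranges are irrelevant.\<close>

definition associated_coefficients ::
  "nat \<Rightarrow> nat \<Rightarrow> ('h::chilbert_space \<Rightarrow> 'h) \<Rightarrow> ('h \<Rightarrow> 'h) \<Rightarrow> ('h \<Rightarrow> 'h) \<Rightarrow>
    (nat \<Rightarrow> 'h) \<Rightarrow> (nat \<Rightarrow> real) \<Rightarrow> (nat \<Rightarrow> real) \<Rightarrow> bool"
  where "associated_coefficients k n \<Gamma> S S' \<epsilon> \<alpha> \<alpha>' \<longleftrightarrow>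
    (k = 2 * n \<and>
       orthonormal_basis (map \<epsilon> [1..<n + 1] @ map (\<lambda>i. \<Gamma> (\<epsilon> i)) [1..<n + 1]) \<or>
     k = 2 * n + 1 \<and>
       orthonormal_basis (\<epsilon> 0 # map \<epsilon> [1..<n + 1] @ map (\<lambda>i. \<Gamma> (\<epsilon> i)) [1..<n + 1]) \<and>
       \<Gamma> (\<epsilon> 0) = \<epsilon> 0 \<and> S (\<epsilon> 0) = (1 / 2) *\<^sub>C \<epsilon> 0 \<and> S' (\<epsilon> 0) = (1 / 2) *\<^sub>C \<epsilon> 0) \<and>
    (\<forall>i\<in>{1..n}.
       \<alpha> i \<in> {0..1} \<and> \<alpha>' i \<in> {0..1} \<and>
       S (\<epsilon> i) = of_real (\<alpha> i) *\<^sub>C \<epsilon> i \<and>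
       S (\<Gamma> (\<epsilon> i)) = of_real (1 - \<alpha> i) *\<^sub>C \<Gamma> (\<epsilon> i) \<and>
       S' (\<epsilon> i) = of_real (\<alpha>' i) *\<^sub>C \<epsilon> i \<and>
       S' (\<Gamma> (\<epsilon> i)) = of_real (1 - \<alpha>' i) *\<^sub>C \<Gamma> (\<epsilon> i))"

end

theory Submission
  imports Defs "HOL-Computational_Algebra.Fundamental_Theorem_Algebra"
begin

text \<open>A quasi-free state is determined by its covariance, so everything rests on an explicit
  construction of \<open>\<phi>\<^sub>S\<close> from a basis of modes \<open>x, \<Gamma> x\<close> (and real vectors \<open>g = \<Gamma> g\<close> with \<open>S g = g / 2\<close>) that
  diagonalizes \<open>S\<close>.  For \<open>S = 1/2\<close> the state is the trace, obtained by averaging over the Bogoliubov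
  automorphisms that negate one vector of a real orthonormal basis; these exist by the universal
  property of the CAR algebra.  Multiplying the trace by the commuting densities
  \<open>2 a b(\<Gamma> x) b(x) + 2 (1 - a) b(x) b(\<Gamma> x)\<close> with \<open>S x = a x\<close> gives a state with
  \<open>a \<phi>(b(x) y) = (1 - a) \<phi>(y b(x))\<close> for all \<open>y\<close>, and anticommuting \<open>b(x)\<close> through a product of
  generators turns this relation into Wick's formula.  Each density is affine in its occupation
  number \<open>a\<close>, so \<open>S \<mapsto> \<phi>\<^sub>S\<close> is affine along segments on which only one occupation number varies.
  Conversely, evaluating at the product of two number operators gives products \<open>a\<^sub>x a\<^sub>y\<close>, and these
  are affine at a single interior point only if \<open>a\<^sub>x\<close> or \<open>a\<^sub>y\<close> is constant.\<close>

section \<open>Linear maps and the free *-algebra\<close>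

text \<open>Two obstacles shape the argument. \<open>qf_state\<close> is a definite description, so
  nothing can be said about it before existence and uniqueness are proved. And the algebra is known
  only as a completion with a universal property, so not even the linear independence of products of
  generators is at hand. Finite dimension removes the topology: products of generators span a
  finite-dimensional, hence closed, subspace, so every element is the value of a noncommutative
  polynomial, and endomorphisms and functionals can be treated by algebra alone. Averaging over
  automorphisms yields the trace as a projection onto the multiples of 1, which is well defined
  without a basis. The relation between the two orders of a product is kept free of division because
  the occupation numbers 0 and 1 must be allowed, where the density has no inverse. The real vectors
  in \<open>G\<close> may be any number, so even and odd dimensions are treated alike, and
  eigenvectors with occupation 1/2 for both operators can be left unpaired; this matters for the
  last claim, where no coefficients are given and the modes have to be constructed.\<close>

text \<open>With this instance, linear functionals are linear maps.\<close>

instantiation complex :: complex_vector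
begin

definition scaleC_complex :: "complex \<Rightarrow> complex \<Rightarrow> complex"
  where "scaleC_complex = (*)"

instance
  by standard (simp_all add: scaleC_complex_def algebra_simps scaleR_conv_of_real)

end

global_interpretation cvec_pair: vector_space_pair
  "scaleC :: complex \<Rightarrow> 'a \<Rightarrow> 'a::complex_vector" "scaleC :: complex \<Rightarrow> 'b \<Rightarrow> 'b::complex_vector"
  by unfold_locales

abbreviation clinear :: "('a::complex_vector \<Rightarrow> 'b::complex_vector) \<Rightarrow> bool"
  where "clinear \<equiv> Vector_Spaces.linear scaleC scaleC"

lemma clinearI:
  assumes "\<And>x y. f (x + y) = f x + f y" "\<And>c x. f (c *\<^sub>C x) = c *\<^sub>C f x"
  shows "clinear f"
  using assms by (simp add: Vector_Spaces.linear_iff cvec.vector_space_axioms)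

lemmas clinear_add = cvec_pair.linear_add
lemmas clinear_scale = cvec_pair.linear_scale
lemmas clinear_0 = cvec_pair.linear_0
lemmas clinear_diff = cvec_pair.linear_diff
lemmas clinear_neg = cvec_pair.linear_neg
lemmas clinear_sum = cvec_pair.linear_sum

lemma clinear_compose: "clinear f \<Longrightarrow> clinear g \<Longrightarrow> clinear (\<lambda>x. g (f x))"
  by (rule clinearI) (simp_all add: clinear_add clinear_scale)

lemma clinear_mult_left: "clinear (\<lambda>x. y * (x::'a::cstar_algebra))"
  by (rule clinearI) (simp_all add: distrib_left mult_scaleC_right)

lemma clinear_mult_right: "clinear (\<lambda>x. (x::'a::cstar_algebra) * y)"
  by (rule clinearI) (simp_all add: distrib_right mult_scaleC_left)

lemma clinear_cspan_range_eq:
  assumes "clinear f" "clinear g" "cvec.span B = UNIV" "\<And>x. x \<in> B \<Longrightarrow> f x = g x"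
  shows "f x = g x"
  by (rule cvec_pair.linear_eq_on_span[OF assms(1,2), of B]) (simp_all add: assms(3,4))

lemma cspan_UNIV_expansion:
  assumes "finite B" "cvec.span B = (UNIV :: 'v::complex_vector set)"
  obtains u where "x = (\<Sum>v\<in>B. u v *\<^sub>C v)"
  using cvec.span_finite[OF assms(1)] assms(2) by auto

lemma star_0: "star (0::'a::cstar_algebra) = 0"
  using star_scaleC[of 0 "0::'a"] by simp

lemma star_sum: "star (sum f A) = (\<Sum>x\<in>A. star (f x :: 'a::cstar_algebra))"
  by (induction A rule: infinite_finite_induct) (simp_all add: star_0 star_add)

lemma star_1: "star 1 = (1::'a::cstar_algebra)"
  by (metis mult.left_neutral mult.right_neutral star_mult star_star)

text \<open>If \<open>a\<close> lies outside the closed span of \<open>V\<close>, its distance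
  \<open>d\<close> to that span is positive, and \<open>norm (v + c *\<^sub>C a)\<close> is at least
  \<open>d * cmod c\<close>. So the coefficients of \<open>a\<close> along a convergent sequence are
  Cauchy, and subtracting their limit reduces the question to the span of \<open>V\<close>.\<close>

lemma closed_cspan_insert:
  fixes V :: "'a::cstar_algebra set"
  assumes V: "closed (cvec.span V)"
  shows "closed (cvec.span (insert a V))"
proof (cases "a \<in> cvec.span V")
  case True
  then show ?thesis
    using V by (simp add: cvec.span_redundant)
next
  case False
  define d where "d = infdist a (cvec.span V)"
  have ne: "cvec.span V \<noteq> {}" using cvec.span_zero by auto
  have d: "d > 0"
    using False V ne by (simp add: d_def infdist_pos_not_in_closed)
  have bound: "d * cmod c \<le> norm (v + c *\<^sub>C a)" if v: "v \<in> cvec.span V" for v c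
  proof (cases "c = 0")
    case False
    have "(- inverse c) *\<^sub>C v \<in> cvec.span V"
      using v by (rule cvec.span_scale)
    then have "d \<le> dist a ((- inverse c) *\<^sub>C v)"
      unfolding d_def by (rule infdist_le)
    also have "\<dots> = norm (inverse c *\<^sub>C (v + c *\<^sub>C a))"
      using False by (simp add: dist_norm scaleC_add_right add.commute)
    also have "\<dots> = norm (v + c *\<^sub>C a) / cmod c"
      by (simp only: norm_scaleC norm_inverse divide_inverse mult.commute)
    finally show ?thesis
      using False by (simp add: field_simps)
  qed simp
  show ?thesis
    unfolding closed_sequential_limits
  proof (intro allI impI, elim conjE)
    fix f l assume f: "\<forall>n. f n \<in> cvec.span (insert a V)" and l: "f \<longlonglongrightarrow> l"
    have "\<forall>n. \<exists>k. f n - k *\<^sub>C a \<in> cvec.span V"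
      using f by (simp add: cvec.span_insert)
    then obtain k where k: "f n - k n *\<^sub>C a \<in> cvec.span V" for n by metis
    have diff: "d * cmod (k m - k n) \<le> norm (f m - f n)" for m n
      using bound[OF cvec.span_diff[OF k[of m] k[of n]], of "k m - k n"]
      by (simp add: cvec.scale_left_diff_distrib)
    have "Cauchy k"
    proof (rule metric_CauchyI)
      fix e :: real assume "e > 0"
      then obtain M where M: "\<And>m n. m \<ge> M \<Longrightarrow> n \<ge> M \<Longrightarrow> dist (f m) (f n) < d * e"
        using metric_CauchyD[OF LIMSEQ_imp_Cauchy[OF l], of "d * e"] d by auto
      have "dist (k m) (k n) < e" if "m \<ge> M" "n \<ge> M" for m n
      proof -
        have "d * dist (k m) (k n) < d * e"
          using diff[of m n] M[OF that] by (simp add: dist_norm)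
        then show ?thesis using d by simp
      qed
      then show "\<exists>M. \<forall>m\<ge>M. \<forall>n\<ge>M. dist (k m) (k n) < e" by blast
    qed
    then obtain c where c: "k \<longlonglongrightarrow> c"
      by (metis Cauchy_convergent_iff convergent_def)
    have "(\<lambda>n. (k n - c) *\<^sub>C a) \<longlonglongrightarrow> 0"
    proof (rule tendsto_norm_zero_cancel)
      have "(\<lambda>n. cmod (k n - c) * norm a) \<longlonglongrightarrow> 0 * norm a"
        using c by (intro tendsto_intros) (simp add: LIM_zero tendsto_norm_zero)
      then show "(\<lambda>n. norm ((k n - c) *\<^sub>C a)) \<longlonglongrightarrow> 0"
        by (simp add: norm_scaleC)
    qed
    then have "(\<lambda>n. f n - (k n - c) *\<^sub>C a - c *\<^sub>C a) \<longlonglongrightarrow> l - 0 - c *\<^sub>C a"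
      using l by (intro tendsto_intros)
    then have "(\<lambda>n. f n - k n *\<^sub>C a) \<longlonglongrightarrow> l - c *\<^sub>C a"
      by (simp add: cvec.scale_left_diff_distrib)
    then have "l - c *\<^sub>C a \<in> cvec.span V"
      by (rule Lim_in_closed_set[OF V, rotated -1]) (simp_all add: k)
    then show "l \<in> cvec.span (insert a V)"
      by (auto simp: cvec.span_insert)
  qed
qed

lemma closed_cspan_finite:
  "finite V \<Longrightarrow> closed (cvec.span V)" for V :: "'a::cstar_algebra set"
  by (induction V rule: finite_induct) (simp_all add: closed_cspan_insert)

section \<open>Evaluation of the free *-algebra as a *-homomorphism\<close>

lemma poly_mapping_sum_single: "x = (\<Sum>w\<in>Poly_Mapping.keys x. Poly_Mapping.single w (Poly_Mapping.lookup x w))"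
  by (rule poly_mapping_eqI)
    (simp add: lookup_sum lookup_single Poly_Mapping.when_def in_keys_iff)

lemma free_algebra_induct [case_names single add]:
  assumes "\<And>w c. P (Poly_Mapping.single w c)" "\<And>x y. P x \<Longrightarrow> P y \<Longrightarrow> P (x + y)"
  shows "P (x :: 'g free_algebra)"
proof -
  have "P (\<Sum>w\<in>A. Poly_Mapping.single w (Poly_Mapping.lookup x w))" if "finite A" for A
    using that
  proof induction
    case empty
    show ?case using assms(1)[of 0 0] by simp
  qed (simp add: assms)
  then show ?thesis
    by (subst poly_mapping_sum_single) simp
qed

text \<open>A sum may have fewer keys than its terms because coefficients cancel. Over a common
  finite superset of the keys, evaluation is additive term by term; \<open>fstar_superset\<close>
  does the same for \<open>fstar\<close>.\<close>

lemma feval_superset: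
  assumes "finite A" "Poly_Mapping.keys x \<subseteq> A"
  shows "feval b x = (\<Sum>w\<in>A. Poly_Mapping.lookup x w *\<^sub>C eval_word b w)"
  unfolding feval_def using assms
  by (intro sum.mono_neutral_left) (auto simp: in_keys_iff)

lemma feval_single: "feval b (Poly_Mapping.single w c) = c *\<^sub>C eval_word b w"
  by (simp add: feval_def)

lemma feval_add: "feval b (x + y) = feval b x + feval b y"
proof -
  let ?A = "Poly_Mapping.keys x \<union> Poly_Mapping.keys y"
  show ?thesis
    using keys_add[of x y]
    by (simp add: feval_superset[of ?A] lookup_add scaleC_add_left sum.distrib)
qed

lemma feval_0: "feval b 0 = 0"
  by (simp add: feval_def)

lemma feval_diff: "feval b (x - y) = feval b x - feval b y"
  using feval_add[of b "x - y" y] by simp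

lemma eval_word_plus: "eval_word b (v + w) = eval_word b v * eval_word b w"
  by (simp add: eval_word_def plus_word_def)

lemma feval_mult: "feval b (x * y) = feval b x * feval b y"
proof (induction x rule: free_algebra_induct)
  case (single v c)
  show ?case
    by (induction y rule: free_algebra_induct)
      (simp_all add: mult_single feval_single eval_word_plus mult_scaleC_left mult_scaleC_right
        distrib_left feval_add)
qed (simp add: distrib_right feval_add)

lemma fstar_superset:
  assumes "finite A" "Poly_Mapping.keys x \<subseteq> A"
  shows "fstar x = (\<Sum>w\<in>A. Poly_Mapping.single (star_word w) (cnj (Poly_Mapping.lookup x w)))"
  unfolding fstar_def using assms
  by (intro sum.mono_neutral_left) (auto simp: in_keys_iff)

lemma fstar_single: "fstar (Poly_Mapping.single w c) = Poly_Mapping.single (star_word w) (cnj c)"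
  by (simp add: fstar_def)

lemma fstar_add: "fstar (x + y) = fstar x + fstar y"
proof -
  let ?A = "Poly_Mapping.keys x \<union> Poly_Mapping.keys y"
  show ?thesis
    using keys_add[of x y]
    by (simp add: fstar_superset[of ?A] lookup_add single_add sum.distrib)
qed

lemma eval_star_word: "eval_word b (star_word w) = star (eval_word b w)"
proof -
  have "eval_letter b (star_letter l) = star (eval_letter b l)" for l
    by (cases l) (simp_all add: star_star)
  then have "prod_list (map (eval_letter b) (rev (map star_letter ls))) =
      star (prod_list (map (eval_letter b) ls))" for ls
    by (induction ls) (simp_all add: star_1 star_mult)
  then show ?thesis
    by (simp add: eval_word_def star_word_def)
qed

lemma feval_fstar: "feval b (fstar x) = star (feval b x)"
  by (induction x rule: free_algebra_induct)
    (simp_all add: fstar_single feval_single eval_star_word star_scaleC fstar_add feval_add star_add)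

lemma feval_fgen: "feval b (fgen g) = b g"
  by (simp add: fgen_def feval_single eval_word_def)

lemma feval_fscalar: "feval b (fscalar c) = c *\<^sub>C 1"
  by (simp add: fscalar_def feval_single eval_word_def zero_word_def)

lemma cstar_seminorm_feval: "cstar_seminorm (\<lambda>x. norm (feval b x))"
  unfolding cstar_seminorm_def
  by (simp add: feval_add feval_mult feval_fscalar feval_fstar norm_triangle_ineq norm_mult_ineq
      mult_scaleC_left norm_scaleC cstar_identity)

lemma antiunitary_involutionD:
  assumes "antiunitary_involution \<Gamma>"
  shows "\<Gamma> (\<xi> + \<eta>) = \<Gamma> \<xi> + \<Gamma> \<eta>" "\<Gamma> (c *\<^sub>C \<xi>) = cnj c *\<^sub>C \<Gamma> \<xi>" "\<Gamma> (\<Gamma> \<xi>) = \<xi>"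
    "cinner (\<Gamma> \<xi>) (\<Gamma> \<eta>) = cinner \<eta> \<xi>"
  using assms by (auto simp: antiunitary_involution_def)

text \<open>Replacing the second vector of the third relation by its image under \<Gamma> removes
  the adjoint and leaves an anticommutator of generators. One direction unpacks the relations for
  \<open>b\<close> itself, the other verifies them for a transformed family
  \<open>b (U x)\<close>.\<close>

lemma feval_CAR_relations_iff:
  assumes \<Gamma>: "antiunitary_involution \<Gamma>"
  shows "(\<forall>r\<in>CAR_relations \<Gamma>. feval b r = 0) \<longleftrightarrow>
    clinear b \<and> (\<forall>\<xi>. star (b \<xi>) = b (\<Gamma> \<xi>)) \<and>
    (\<forall>\<xi> \<eta>. b \<xi> * b \<eta> + b \<eta> * b \<xi> = cinner \<xi> (\<Gamma> \<eta>) *\<^sub>C 1)" (is "?L \<longleftrightarrow> ?R")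
proof
  assume L: ?L
  have "fgen (\<alpha> *\<^sub>C \<xi> + \<beta> *\<^sub>C \<eta>) - (fscalar \<alpha> * fgen \<xi> + fscalar \<beta> * fgen \<eta>) \<in> CAR_relations \<Gamma>" for \<alpha> \<beta> \<xi> \<eta>
    unfolding CAR_relations_def by blast
  note 1 = L[rule_format, OF this]
  have "fgen (\<Gamma> \<xi>) - fstar (fgen \<xi>) \<in> CAR_relations \<Gamma>" for \<xi>
    unfolding CAR_relations_def by blast
  note 2 = L[rule_format, OF this]
  have "fgen \<xi> * fstar (fgen \<eta>) + fstar (fgen \<eta>) * fgen \<xi> - fscalar (cinner \<xi> \<eta>) \<in> CAR_relations \<Gamma>" for \<xi> \<eta>
    unfolding CAR_relations_def by blast
  note 3 = L[rule_format, OF this]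
  note s = feval_diff feval_add feval_mult feval_fgen feval_fscalar feval_fstar mult_scaleC_left
  have 1: "b (\<alpha> *\<^sub>C \<xi> + \<beta> *\<^sub>C \<eta>) = \<alpha> *\<^sub>C b \<xi> + \<beta> *\<^sub>C b \<eta>" for \<alpha> \<beta> \<xi> \<eta>
    using 1[of \<alpha> \<xi> \<beta> \<eta>] by (simp add: s)
  have 2: "star (b \<xi>) = b (\<Gamma> \<xi>)" for \<xi>
    using 2[of \<xi>] by (simp add: s)
  have 3: "b \<xi> * b \<eta> + b \<eta> * b \<xi> = cinner \<xi> (\<Gamma> \<eta>) *\<^sub>C 1" for \<xi> \<eta>
    using 3[of \<xi> "\<Gamma> \<eta>"] by (simp add: s 2 antiunitary_involutionD(3)[OF \<Gamma>])
  have "clinear b"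
    using 1[of 1 _ 1] 1[of _ _ 0 0] by (intro clinearI) simp_all
  then show ?R using 2 3 by blast
next
  assume R: ?R
  then have l: "clinear b" by blast
  show ?L
    using R antiunitary_involutionD(3)[OF \<Gamma>]
    by (auto simp: CAR_relations_def feval_diff feval_add feval_mult feval_fgen feval_fscalar
        feval_fstar mult_scaleC_left clinear_add[OF l] clinear_scale[OF l])
qed

section \<open>The self-dual CAR algebra\<close>

lemma cinner_add_right: "cinner x (y + z) = cinner x y + cinner x (z::'h::chilbert_space)"
  by (metis cinner_add_left cinner_commute complex_cnj_add)

lemma cinner_scaleC_right: "cinner x (c *\<^sub>C y) = cnj c * cinner x (y::'h::chilbert_space)"
  by (metis cinner_commute cinner_scaleC_left complex_cnj_mult)

lemma clinear_cinner_left: "clinear (\<lambda>x::'h::chilbert_space. cinner x y)"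
  by (rule clinearI) (simp_all add: cinner_add_left cinner_scaleC_left scaleC_complex_def)

lemma cinner_0_left [simp]: "cinner 0 (y::'h::chilbert_space) = 0"
  using clinear_0[OF clinear_cinner_left] .

lemma cinner_0_right [simp]: "cinner (x::'h::chilbert_space) 0 = 0"
  by (metis cinner_0_left cinner_commute complex_cnj_zero)

lemma cinner_diff_left: "cinner (x - y) z = cinner x z - cinner (y::'h::chilbert_space) z"
  using clinear_diff[OF clinear_cinner_left] .

lemma cinner_diff_right: "cinner x (y - z) = cinner x y - cinner x (z::'h::chilbert_space)"
  by (metis cinner_diff_left cinner_commute complex_cnj_diff)

lemma cinner_sum_left: "cinner (sum f A) (z::'h::chilbert_space) = (\<Sum>x\<in>A. cinner (f x) z)"
  using clinear_sum[OF clinear_cinner_left] .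

lemma cinner_self: "cinner x x = complex_of_real ((norm (x::'h::chilbert_space))\<^sup>2)"
proof (rule complex_eqI)
  show "Re (cinner x x) = Re (complex_of_real ((norm x)\<^sup>2))"
    by (simp add: Re_cinner power2_norm_eq_inner)
  show "Im (cinner x x) = Im (complex_of_real ((norm x)\<^sup>2))"
    using arg_cong[OF cinner_commute[of x x], of Im] by simp
qed

locale CAR_algebra =
  fixes \<Gamma> :: "'h::chilbert_space \<Rightarrow> 'h" and b :: "'h \<Rightarrow> 'a::cstar_algebra"
  assumes \<Gamma>: "antiunitary_involution \<Gamma>" and CAR: "self_dual_CAR_algebra \<Gamma> b"
begin

lemmas \<Gamma>_add = antiunitary_involutionD(1)[OF \<Gamma>]
  and \<Gamma>_scaleC = antiunitary_involutionD(2)[OF \<Gamma>]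
  and \<Gamma>_\<Gamma> [simp] = antiunitary_involutionD(3)[OF \<Gamma>]
  and cinner_\<Gamma> = antiunitary_involutionD(4)[OF \<Gamma>]

lemma \<Gamma>_minus: "\<Gamma> (- x) = - \<Gamma> x"
  using \<Gamma>_scaleC[of "-1" x] by simp

lemma \<Gamma>_diff: "\<Gamma> (x - y) = \<Gamma> x - \<Gamma> y"
  using \<Gamma>_add[of x "- y"] by (simp add: \<Gamma>_minus)

lemma cinner_\<Gamma>_swap: "cinner x (\<Gamma> y) = cinner y (\<Gamma> x)"
  by (metis \<Gamma>_\<Gamma> cinner_\<Gamma>)

lemma
  clinear_b: "clinear b" and star_b: "star (b x) = b (\<Gamma> x)"
  and b_anticommutator: "b x * b y + b y * b x = cinner x (\<Gamma> y) *\<^sub>C 1"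
  using CAR feval_CAR_relations_iff[OF \<Gamma>, of b]
  by (auto simp: self_dual_CAR_algebra_def universal_cstar_algebra_def)

lemma b_mult_commute: "b x * b y = cinner x (\<Gamma> y) *\<^sub>C 1 - b y * b x"
  using b_anticommutator[of x y] by (simp add: algebra_simps)

text \<open>The universal property for families in the same algebra: \<open>norm (feval c x)\<close>
  is, as a function of \<open>x\<close>, a C*-seminorm that vanishes on the relations.\<close>

lemma norm_feval_le:
  assumes "\<forall>r\<in>CAR_relations \<Gamma>. feval c r = (0::'a)"
  shows "norm (feval c x) \<le> norm (feval b x)"
proof -
  have "\<And>p. cstar_seminorm p \<and> (\<forall>r\<in>CAR_relations \<Gamma>. p r = 0) \<Longrightarrow> p x \<le> norm (feval b x)"
    using CAR by (simp add: self_dual_CAR_algebra_def universal_cstar_algebra_def)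
  from this[of "\<lambda>x. norm (feval c x)"] show ?thesis
    using assms by (simp add: cstar_seminorm_feval)
qed

lemma closure_range_feval: "closure (range (feval b)) = UNIV"
  using CAR by (simp add: self_dual_CAR_algebra_def universal_cstar_algebra_def)

text \<open>Sending \<open>feval b x\<close> to \<open>feval (\<lambda>x. b (U x)) x\<close> is well
  defined because \<open>norm_feval_le\<close> makes the second vanish where the first does.
  Surjectivity of \<open>feval b\<close> defines it everywhere, with no extension by
  continuity.\<close>

lemma bogoliubov_endomorphism:
  assumes surj: "range (feval b) = UNIV"
    and U: "clinear U" "\<And>x. \<Gamma> (U x) = U (\<Gamma> x)" "\<And>x y. cinner (U x) (U y) = cinner x y"
  obtains \<beta> :: "'a \<Rightarrow> 'a" where "clinear \<beta>" "\<beta> 1 = 1" "\<And>x y. \<beta> (x * y) = \<beta> x * \<beta> y"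
    "\<And>x. \<beta> (b x) = b (U x)"
proof -
  let ?c = "\<lambda>x. b (U x)"
  have "clinear ?c" by (rule clinear_compose[OF U(1) clinear_b])
  then have rel: "\<forall>r\<in>CAR_relations \<Gamma>. feval ?c r = 0"
    unfolding feval_CAR_relations_iff[OF \<Gamma>] by (simp add: star_b b_anticommutator U)
  have eq: "feval ?c x = feval ?c y" if "feval b x = feval b y" for x y
    using norm_feval_le[OF rel, of "x - y"] that by (simp add: feval_diff)
  define s where "s = inv (feval b)"
  define \<beta> where "\<beta> y = feval ?c (s y)" for y
  have s: "feval b (s y) = y" for y
    using surj by (simp add: s_def surj_f_inv_f)
  have \<beta>: "\<beta> (feval b x) = feval ?c x" for x
    unfolding \<beta>_def by (rule eq) (rule s)
  show thesis
  proof
    show "clinear \<beta>"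
    proof (rule clinearI)
      show "\<beta> (x + y) = \<beta> x + \<beta> y" for x y
        using \<beta>[of "s x + s y"] by (simp add: feval_add s \<beta>_def)
      show "\<beta> (c *\<^sub>C x) = c *\<^sub>C \<beta> x" for c x
        using \<beta>[of "fscalar c * s x"] by (simp add: feval_mult feval_fscalar mult_scaleC_left s \<beta>_def)
    qed
    show "\<beta> 1 = 1"
      using \<beta>[of "fscalar 1"] by (simp add: feval_fscalar)
    show "\<beta> (x * y) = \<beta> x * \<beta> y" for x y
      using \<beta>[of "s x * s y"] by (simp add: feval_mult s \<beta>_def)
    show "\<beta> (b x) = b (U x)" for x
      using \<beta>[of "fgen x"] by (simp add: feval_fgen)
  qed
qed

end

section \<open>Clifford generators of a real orthonormal basis\<close>

locale CAR_real_basis = CAR_algebra \<Gamma> b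
  for \<Gamma> :: "'h::chilbert_space \<Rightarrow> 'h" and b :: "'h \<Rightarrow> 'a::cstar_algebra" +
  fixes e :: "nat \<Rightarrow> 'h" and k :: nat
  assumes \<Gamma>_e: "j < k \<Longrightarrow> \<Gamma> (e j) = e j"
    and cinner_e: "i < k \<Longrightarrow> j < k \<Longrightarrow> cinner (e i) (e j) = (if i = j then 1 else 0)"
    and span_e: "cvec.span (e ` {..<k}) = UNIV"
begin

text \<open>For a real unit vector the anticommutator gives \<open>b (e j)\<close> the square 1/2;
  the factor turns it into a self-adjoint square root of 1, a Clifford generator.\<close>

definition cliff :: "nat \<Rightarrow> 'a"
  where "cliff j = complex_of_real (sqrt 2) *\<^sub>C b (e j)"

definition cliff_prod :: "nat list \<Rightarrow> 'a"
  where "cliff_prod js = prod_list (map cliff js)"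

text \<open>Products depend on the order of their factors; increasing lists select one product for
  each subset of \<open>{..<k}\<close>.\<close>

definition cliff_basis :: "nat list set"
  where "cliff_basis = {js. sorted js \<and> distinct js \<and> set js \<subseteq> {..<k}}"

lemma cliff_prod_simps [simp]:
  "cliff_prod [] = 1" "cliff_prod (j # js) = cliff j * cliff_prod js"
  "cliff_prod (js @ js') = cliff_prod js * cliff_prod js'"
  by (simp_all add: cliff_prod_def)

lemma cliff_anticommutator:
  assumes "i < k" "j < k"
  shows "cliff i * cliff j + cliff j * cliff i = (if i = j then 2 else 0) *\<^sub>C 1"
proof -
  have "complex_of_real (sqrt 2) * complex_of_real (sqrt 2) = 2"
    by (metis of_real_mult of_real_numeral real_sqrt_mult_self abs_numeral)
  then have "cliff i * cliff j + cliff j * cliff i = 2 *\<^sub>C (b (e i) * b (e j) + b (e j) * b (e i))"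
    by (simp add: cliff_def mult_scaleC_left mult_scaleC_right scaleC_add_right)
  also have "\<dots> = 2 *\<^sub>C cinner (e i) (e j) *\<^sub>C 1"
    by (simp only: b_anticommutator \<Gamma>_e[OF assms(2)])
  finally show ?thesis
    using assms by (simp add: cinner_e)
qed

lemma cliff_square: "j < k \<Longrightarrow> cliff j * cliff j = 1"
proof -
  assume "j < k"
  then have "2 *\<^sub>C (cliff j * cliff j) = 2 *\<^sub>C 1"
    using cliff_anticommutator[of j j] scaleC_add_left[of 1 1 "cliff j * cliff j"] by simp
  then show ?thesis
    by (simp add: cvec.scale_left_imp_eq)
qed

lemma cliff_anticommute: "i < k \<Longrightarrow> j < k \<Longrightarrow> i \<noteq> j \<Longrightarrow> cliff i * cliff j = - (cliff j * cliff i)"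
  using cliff_anticommutator[of i j] by (simp add: eq_neg_iff_add_eq_0)

lemma star_cliff: "j < k \<Longrightarrow> star (cliff j) = cliff j"
  by (simp add: cliff_def star_scaleC star_b \<Gamma>_e)

lemma star_cliff_prod: "set js \<subseteq> {..<k} \<Longrightarrow> star (cliff_prod js) = cliff_prod (rev js)"
  by (induction js) (simp_all add: star_1 star_mult star_cliff)

lemma star_cliff_prod_mult_self: "set js \<subseteq> {..<k} \<Longrightarrow> star (cliff_prod js) * cliff_prod js = 1"
proof (induction js)
  case (Cons j js)
  have "star (cliff_prod (j # js)) * cliff_prod (j # js) =
      star (cliff_prod js) * (cliff j * cliff j) * cliff_prod js"
    using Cons.prems by (simp add: star_mult star_cliff mult.assoc)
  then show ?case
    using Cons by (simp add: cliff_square)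
qed (simp add: star_1)

text \<open>Moving \<open>cliff j\<close> past smaller entries changes only the sign. The scalar
  stays unspecified because the result serves only to compute a span.\<close>

lemma cliff_mult_insort:
  assumes "j \<notin> set js" "j < k" "set js \<subseteq> {..<k}"
  shows "\<exists>c. cliff j * cliff_prod js = c *\<^sub>C cliff_prod (insort j js)"
  using assms
proof (induction js)
  case Nil
  show ?case by (rule exI[of _ 1]) simp
next
  case (Cons i js)
  then obtain c where c: "cliff j * cliff_prod js = c *\<^sub>C cliff_prod (insort j js)" by auto
  have "cliff j * cliff_prod (i # js) = - (cliff i * (cliff j * cliff_prod js))"
    using Cons.prems cliff_anticommute[of j i] by (simp flip: mult.assoc)
  then have "cliff j * cliff_prod (i # js) = (- c) *\<^sub>C (cliff i * cliff_prod (insort j js))"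
    by (simp add: c mult_scaleC_right)
  then show ?case
    by (cases "j \<le> i") (auto intro: exI[of _ 1] exI[of _ "- c"])
qed

text \<open>Up to sign the factor moves to its other occurrence, where the two cancel because the
  generator squares to 1.\<close>

lemma cliff_mult_remove1:
  assumes "j \<in> set js" "j < k" "set js \<subseteq> {..<k}"
  shows "\<exists>c. cliff j * cliff_prod js = c *\<^sub>C cliff_prod (remove1 j js)"
  using assms
proof (induction js)
  case (Cons i js)
  show ?case
  proof (cases "i = j")
    case True
    then show ?thesis
      using Cons.prems by (intro exI[of _ 1]) (simp add: cliff_square flip: mult.assoc)
  next
    case False
    then obtain c where c: "cliff j * cliff_prod js = c *\<^sub>C cliff_prod (remove1 j js)"
      using Cons by auto
    have "cliff j * cliff_prod (i # js) = - (cliff i * (cliff j * cliff_prod js))"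
      using Cons.prems False cliff_anticommute[of j i] by (simp flip: mult.assoc)
    then have "cliff j * cliff_prod (i # js) = (- c) *\<^sub>C (cliff i * cliff_prod (remove1 j js))"
      by (simp add: c mult_scaleC_right)
    then show ?thesis
      using False by (intro exI[of _ "- c"]) simp
  qed
qed simp

lemma finite_cliff_basis: "finite cliff_basis"
  by (rule finite_subset[OF _ finite_subset_distinct[of "{..<k}"]]) (auto simp: cliff_basis_def)

lemma cliff_mult_cliff_basis:
  assumes "j < k" "js \<in> cliff_basis"
  obtains c js' where "js' \<in> cliff_basis" "cliff j * cliff_prod js = c *\<^sub>C cliff_prod js'"
proof (cases "j \<in> set js")
  case True
  then show thesis
    using assms cliff_mult_remove1[of j js] that[of "remove1 j js"]
    by (auto simp: cliff_basis_def sorted_remove1)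
next
  case False
  then show thesis
    using assms cliff_mult_insort[of j js] that[of "insort j js"]
    by (auto simp: cliff_basis_def sorted_insort distinct_insort set_insort_key)
qed

text \<open>Words are built by prepending letters, so stability under left multiplication by
  generators captures all of them.\<close>

lemma b_mult_cliff_span:
  assumes y: "y \<in> cvec.span (cliff_prod ` cliff_basis)"
  shows "b x * y \<in> cvec.span (cliff_prod ` cliff_basis)" (is "_ \<in> ?V")
proof -
  have gen: "cliff j * z \<in> ?V" if "j < k" "z \<in> ?V" for j z
    using that(2)
  proof (induction rule: cvec.span_induct_alt)
    case (step c v w)
    then obtain js where js: "js \<in> cliff_basis" "v = cliff_prod js" by auto
    obtain d js' where "js' \<in> cliff_basis" "cliff j * v = d *\<^sub>C cliff_prod js'"
      using cliff_mult_cliff_basis[OF \<open>j < k\<close> js(1)] js(2) by blast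
    then have "cliff j * v \<in> ?V"
      by (simp add: cvec.span_base cvec.span_scale)
    then show ?case
      using step by (simp add: distrib_left mult_scaleC_right cvec.span_add cvec.span_scale)
  qed (simp add: cvec.span_zero)
  have "x \<in> cvec.span (e ` {..<k})" by (simp add: span_e)
  then show ?thesis
  proof (induction rule: cvec.span_induct_alt)
    case (step c x z)
    then obtain j where j: "j < k" "x = e j" by auto
    have "b (e j) = (1 / complex_of_real (sqrt 2)) *\<^sub>C cliff j"
      by (simp add: cliff_def)
    then have "b x * y \<in> ?V"
      using gen[OF j(1) y] by (simp add: j mult_scaleC_left cvec.span_scale)
    then show ?case
      using step by (simp add: clinear_add[OF clinear_b] clinear_scale[OF clinear_b]
        distrib_right mult_scaleC_left cvec.span_add cvec.span_scale)
  qed (simp add: clinear_0[OF clinear_b] cvec.span_zero)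
qed

text \<open>The span of the finitely many products is closed and contains the dense image of the
  free *-algebra, so it is everything. Conversely each product is a value of \<open>feval b\<close>;
  the image is therefore the whole algebra, and the completion adds nothing.\<close>

lemma cliff_span: "cvec.span (cliff_prod ` cliff_basis) = UNIV" (is "?V = _")
  and range_feval: "range (feval b) = UNIV"
proof -
  have "eval_word b w \<in> ?V" for w
  proof -
    have "prod_list (map (eval_letter b) ls) \<in> ?V" for ls
    proof (induction ls)
      case Nil
      have "cliff_prod [] \<in> ?V"
        by (intro cvec.span_base imageI) (simp add: cliff_basis_def)
      then show ?case by simp
    next
      case (Cons l ls)
      then show ?case by (cases l) (simp_all add: b_mult_cliff_span star_b)
    qed
    then show ?thesis by (simp add: eval_word_def)
  qed
  then have V: "range (feval b) \<subseteq> ?V"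
    by (auto simp: feval_def intro!: cvec.span_sum cvec.span_scale)
  moreover have "closed ?V"
    by (intro closed_cspan_finite finite_imageI finite_cliff_basis)
  ultimately have "closure (range (feval b)) \<subseteq> ?V"
    by (rule closure_minimal)
  then show *: "?V = UNIV"
    using closure_range_feval by auto
  have P: "cliff_prod js \<in> range (feval b)" for js
  proof (induction js)
    case Nil
    have "feval b (fscalar 1) = cliff_prod []" by (simp add: feval_fscalar)
    then show ?case by (metis rangeI)
  next
    case (Cons j js)
    then obtain y where "cliff_prod js = feval b y" by auto
    then have "feval b (fscalar (complex_of_real (sqrt 2)) * fgen (e j) * y) = cliff_prod (j # js)"
      by (simp add: feval_mult feval_fscalar feval_fgen cliff_def mult_scaleC_left)
    then show ?case by (metis rangeI)
  qed
  have "v \<in> range (feval b)" if "v \<in> ?V" for v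
    using that
  proof (induction rule: cvec.span_induct_alt)
    case base
    show ?case using feval_0[of b] by (metis rangeI)
  next
    case (step c x y)
    then obtain x' y' where "x = feval b x'" "y = feval b y'" using P by blast
    then have "c *\<^sub>C x + y = feval b (fscalar c * x' + y')"
      by (simp add: feval_add feval_mult feval_fscalar mult_scaleC_left)
    then show ?case by blast
  qed
  then show "range (feval b) = UNIV"
    using * by auto
qed

section \<open>Reflections along the basis vectors\<close>

definition flip :: "nat \<Rightarrow> 'h \<Rightarrow> 'h"
  where "flip j x = x - (2 * cinner x (e j)) *\<^sub>C e j"

lemma flip_e: "i < k \<Longrightarrow> j < k \<Longrightarrow> flip j (e i) = (if i = j then -1 else 1) *\<^sub>C e i"
  by (simp add: flip_def cinner_e flip: cvec.scale_left_diff_distrib[of 1 2 "e j", simplified])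

text \<open>The reflection along a unit vector is unitary, and it commutes with \<Gamma> because
  \<Gamma> fixes \<open>e j\<close>; these are the hypotheses of
  \<open>bogoliubov_endomorphism\<close>.\<close>

lemma flip_bogoliubov:
  assumes j: "j < k"
  shows "clinear (flip j)" "\<Gamma> (flip j x) = flip j (\<Gamma> x)" "cinner (flip j x) (flip j y) = cinner x y"
proof -
  show "clinear (flip j)"
    by (rule clinearI) (simp_all add: flip_def cinner_add_left cinner_scaleC_left
      cvec.scale_left_distrib cvec.scale_right_diff_distrib algebra_simps)
  have "cinner (\<Gamma> x) (e j) = cnj (cinner x (e j))"
    using cinner_\<Gamma>[of x "e j"] \<Gamma>_e[OF j] cinner_commute[of x "e j"] by simp
  then show "\<Gamma> (flip j x) = flip j (\<Gamma> x)"
    by (simp add: flip_def \<Gamma>_diff \<Gamma>_scaleC \<Gamma>_e[OF j])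
  have "cinner (e j) y = cnj (cinner y (e j))"
    by (rule cinner_commute)
  then show "cinner (flip j x) (flip j y) = cinner x y"
    using cinner_e[OF j j]
    by (simp add: flip_def cinner_diff_left cinner_diff_right cinner_scaleC_left cinner_scaleC_right
      algebra_simps)
qed

end

section \<open>The tracial state\<close>

lemma distinct_count_list: "distinct xs \<Longrightarrow> count_list xs x = (if x \<in> set xs then 1 else 0)"
  by (induction xs) auto

context CAR_real_basis
begin

text \<open>Each occurrence of the reflected generator contributes a factor -1. Repetitions and
  arbitrary order are allowed in the list because the trace is later evaluated on
  concatenations.\<close>

lemma flip_automorphism:
  assumes j: "j < k"
  obtains \<beta> :: "'a \<Rightarrow> 'a" where "clinear \<beta>"
    "\<And>js. set js \<subseteq> {..<k} \<Longrightarrow> \<beta> (cliff_prod js) = (-1) ^ count_list js j *\<^sub>C cliff_prod js"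
proof -
  obtain \<beta> :: "'a \<Rightarrow> 'a" where \<beta>: "clinear \<beta>" "\<beta> 1 = 1" "\<And>x y. \<beta> (x * y) = \<beta> x * \<beta> y"
    "\<And>x. \<beta> (b x) = b (flip j x)"
    using bogoliubov_endomorphism[OF range_feval flip_bogoliubov[OF j]] by blast
  have cliff: "\<beta> (cliff i) = (if i = j then -1 else 1) *\<^sub>C cliff i" if "i < k" for i
    using that j
    by (simp only: cliff_def clinear_scale[OF \<beta>(1)] \<beta>(4) flip_e clinear_scale[OF clinear_b]
        cvec.scale_left_commute)
  have "\<beta> (cliff_prod js) = (-1) ^ count_list js j *\<^sub>C cliff_prod js" if "set js \<subseteq> {..<k}" for js
    using that
    by (induction js) (simp_all add: \<beta>(2,3) cliff mult_scaleC_left mult_scaleC_right)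
  with \<beta>(1) show thesis by (rule that)
qed

lemma clinear_cliff_eqI:
  assumes "clinear f" "clinear g" "\<And>js. js \<in> cliff_basis \<Longrightarrow> f (cliff_prod js) = g (cliff_prod js)"
  shows "f x = g x"
  by (rule clinear_cspan_range_eq[OF assms(1,2) cliff_span]) (auto simp: assms(3))

text \<open>\<open>E\<close> is the composition of the maps \<open>x \<mapsto> (x + \<beta> x) / 2\<close> over the flips \<open>\<beta>\<close> of the first \<open>m\<close> basis vectors.\<close>

lemma exists_flip_average:
  assumes "m \<le> k"
  shows "\<exists>E :: 'a \<Rightarrow> 'a. clinear E \<and>
    (\<forall>js\<in>cliff_basis. E (cliff_prod js) = (if set js \<inter> {..<m} = {} then cliff_prod js else 0))"
  using assms
proof (induction m)
  case 0
  have "clinear (\<lambda>x::'a. x)" by (rule clinearI) simp_all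
  then show ?case by (intro exI[of _ "\<lambda>x. x"]) simp
next
  case (Suc m)
  then obtain E :: "'a \<Rightarrow> 'a" where E: "clinear E"
    "\<And>js. js \<in> cliff_basis \<Longrightarrow> E (cliff_prod js) = (if set js \<inter> {..<m} = {} then cliff_prod js else 0)"
    by auto
  have "m < k" using Suc.prems by simp
  then obtain \<beta> :: "'a \<Rightarrow> 'a" where \<beta>: "clinear \<beta>"
    "\<And>js. set js \<subseteq> {..<k} \<Longrightarrow> \<beta> (cliff_prod js) = (-1) ^ count_list js m *\<^sub>C cliff_prod js"
    using flip_automorphism by blast
  define E' where "E' x = (1/2) *\<^sub>C (E x + \<beta> (E x))" for x
  have "clinear E'"
    by (rule clinearI) (simp_all add: E'_def clinear_add[OF E(1)] clinear_scale[OF E(1)]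
      clinear_add[OF \<beta>(1)] clinear_scale[OF \<beta>(1)] scaleC_add_right ac_simps)
  moreover have "E' (cliff_prod js) = (if set js \<inter> {..<Suc m} = {} then cliff_prod js else 0)"
    if js: "js \<in> cliff_basis" for js
  proof -
    have c: "count_list js m = (if m \<in> set js then 1 else 0)"
      using js by (simp add: cliff_basis_def distinct_count_list)
    have half: "(1/2) *\<^sub>C (x + x) = x" for x :: 'a
      by (simp add: scaleC_add_right flip: scaleC_add_left)
    show ?thesis
      using js by (auto simp: E'_def E(2) c \<beta>(2) cliff_basis_def clinear_0[OF \<beta>(1)] half lessThan_Suc)
  qed
  ultimately show ?case by blast
qed

text \<open>After averaging over all flips only the empty product survives, so \<open>E\<close>
  takes values in the multiples of 1, and the coefficient is unique since 1 is nonzero. Reading the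
  coefficient of the empty product off an expansion would presuppose that the products are linearly
  independent.\<close>

lemma exists_cliff_trace:
  obtains \<tau> :: "'a \<Rightarrow> complex" where "clinear \<tau>"
    "\<And>js. js \<in> cliff_basis \<Longrightarrow> \<tau> (cliff_prod js) = (if js = [] then 1 else 0)"
proof -
  obtain E :: "'a \<Rightarrow> 'a" where E: "clinear E"
    "\<And>js. js \<in> cliff_basis \<Longrightarrow> E (cliff_prod js) = (if set js \<inter> {..<k} = {} then cliff_prod js else 0)"
    using exists_flip_average[of k] by auto
  have E_basis: "E (cliff_prod js) = (if js = [] then 1 else 0) *\<^sub>C 1" if "js \<in> cliff_basis" for js
    using that E(2)[OF that] by (auto simp: cliff_basis_def inf.absorb1)
  have inj: "c = d" if "c *\<^sub>C (1::'a) = d *\<^sub>C 1" for c d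
    using that by (simp add: cvec.scale_right_imp_eq)
  have "\<exists>c. E x = c *\<^sub>C 1" for x
  proof -
    have "x \<in> cvec.span (cliff_prod ` cliff_basis)" by (simp add: cliff_span)
    then show ?thesis
    proof (induction rule: cvec.span_induct_alt)
      case base
      show ?case by (rule exI[of _ 0]) (simp add: clinear_0[OF E(1)])
    next
      case (step c x y)
      then obtain js d where "js \<in> cliff_basis" "x = cliff_prod js" "E y = d *\<^sub>C 1" by auto
      then have "E (c *\<^sub>C x + y) = (c * (if js = [] then 1 else 0) + d) *\<^sub>C 1"
        by (simp add: clinear_add[OF E(1)] clinear_scale[OF E(1)] E_basis scaleC_add_left)
      then show ?case by blast
    qed
  qed
  then obtain \<tau> where \<tau>: "E x = \<tau> x *\<^sub>C 1" for x by metis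
  show thesis
  proof
    show "clinear \<tau>"
    proof (rule clinearI; rule inj)
      show "\<tau> (x + y) *\<^sub>C (1::'a) = (\<tau> x + \<tau> y) *\<^sub>C 1" for x y
        by (simp add: scaleC_add_left clinear_add[OF E(1)] flip: \<tau>)
      show "\<tau> (c *\<^sub>C x) *\<^sub>C (1::'a) = (c *\<^sub>C \<tau> x) *\<^sub>C 1" for c x
        by (simp add: scaleC_complex_def clinear_scale[OF E(1)] flip: \<tau> scaleC_scaleC)
    qed
    show "\<tau> (cliff_prod js) = (if js = [] then 1 else 0)" if "js \<in> cliff_basis" for js
      using E_basis[OF that] by (intro inj) (simp add: \<tau>)
  qed
qed

text \<open>Positivity holds because the products are orthonormal for
  \<open>\<tau> (star v * w)\<close>. Cyclicity is linear in both arguments, so one generator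
  against one product is enough. Odd words in arbitrary vectors vanish because the parity
  automorphism preserves \<tau> and negates them.\<close>

lemma exists_tracial_state:
  obtains \<tau> :: "'a \<Rightarrow> complex" where "clinear \<tau>" "\<tau> 1 = 1" "\<And>x. \<tau> (star x * x) \<in> \<real>\<^sub>\<ge>\<^sub>0"
    "\<And>x y. \<tau> (b x * y) = \<tau> (y * b x)"
    "\<And>xs. odd (length xs) \<Longrightarrow> \<tau> (prod_list (map b xs)) = 0"
proof -
  obtain \<tau> :: "'a \<Rightarrow> complex" where \<tau>: "clinear \<tau>"
    "\<And>js. js \<in> cliff_basis \<Longrightarrow> \<tau> (cliff_prod js) = (if js = [] then 1 else 0)"
    using exists_cliff_trace by blast
  have [simp]: "\<tau> 1 = 1"
    using \<tau>(2)[of "[]"] by (simp add: cliff_basis_def)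
  \<comment> \<open>The trace is invariant under every flip, so a product that some flip negates has
    trace 0.\<close>
  have \<tau>_odd: "\<tau> (cliff_prod js) = 0" if js: "set js \<subseteq> {..<k}" and j: "odd (count_list js j)" for js j
  proof -
    have "j \<in> set js" using j by (metis count_notin even_zero)
    then have "j < k" using js by auto
    then obtain \<beta> :: "'a \<Rightarrow> 'a" where \<beta>: "clinear \<beta>"
      "\<And>js. set js \<subseteq> {..<k} \<Longrightarrow> \<beta> (cliff_prod js) = (-1) ^ count_list js j *\<^sub>C cliff_prod js"
      using flip_automorphism by blast
    have "\<tau> (\<beta> x) = \<tau> x" for x
      by (rule clinear_cliff_eqI[OF clinear_compose[OF \<beta>(1) \<tau>(1)] \<tau>(1)])
        (auto simp: \<tau>(2) \<beta>(2) cliff_basis_def clinear_scale[OF \<tau>(1)] scaleC_complex_def)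
    from this[of "cliff_prod js"] show ?thesis
      using j by (simp add: \<beta>(2)[OF js] clinear_neg[OF \<tau>(1)])
  qed
  have "\<tau> (star x * x) \<in> \<real>\<^sub>\<ge>\<^sub>0" for x
  proof -
    let ?B = "cliff_prod ` cliff_basis"
    have fin: "finite ?B" using finite_cliff_basis by simp
    obtain u where u: "x = (\<Sum>v\<in>?B. u v *\<^sub>C v)"
      using cspan_UNIV_expansion[OF fin cliff_span] .
    have orth: "\<tau> (star v * w) = (if v = w then 1 else 0)" if vw: "v \<in> ?B" "w \<in> ?B" for v w
    proof -
      obtain js ls where js: "js \<in> cliff_basis" "v = cliff_prod js" and
        ls: "ls \<in> cliff_basis" "w = cliff_prod ls" using vw by auto
      have sub: "set js \<subseteq> {..<k}" "set ls \<subseteq> {..<k}"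
        using js ls by (auto simp: cliff_basis_def)
      show ?thesis
      proof (cases "v = w")
        case True
        then show ?thesis using star_cliff_prod_mult_self[OF sub(1)] js by simp
      next
        case False
        then have "set js \<noteq> set ls"
          using js ls by (auto simp: cliff_basis_def dest: sorted_distinct_set_unique)
        \<comment> \<open>An index in exactly one of the two supports occurs exactly once in the
          concatenation.\<close>
        then obtain j where "(j \<in> set js) \<noteq> (j \<in> set ls)" by blast
        then have "odd (count_list (rev js @ ls) j)"
          using js ls by (auto simp: cliff_basis_def distinct_count_list)
        then have "\<tau> (cliff_prod (rev js @ ls)) = 0"
          using sub by (intro \<tau>_odd) auto
        then show ?thesis
          using False by (simp add: js ls sub star_cliff_prod)
      qed
    qed
    have "\<tau> (star x * x) = (\<Sum>v\<in>?B. \<Sum>w\<in>?B. cnj (u v) * u w * \<tau> (star v * w))"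
      unfolding u
      by (simp add: star_sum star_scaleC sum_distrib_left sum_distrib_right mult_scaleC_left
          mult_scaleC_right clinear_sum[OF \<tau>(1)] clinear_scale[OF \<tau>(1)] scaleC_complex_def mult.assoc)
        (subst sum.swap, intro sum.cong refl, rule mult.left_commute)
    also have "\<dots> = (\<Sum>v\<in>?B. cnj (u v) * u v)"
      using fin by (intro sum.cong refl) (simp add: orth if_distrib cong: if_cong)
    also have "\<dots> = complex_of_real (\<Sum>v\<in>?B. (cmod (u v))\<^sup>2)"
      by (simp add: complex_norm_square[symmetric] mult.commute flip: of_real_power)
    finally show ?thesis
      by (simp only: nonneg_Reals_of_real_iff) (simp add: sum_nonneg)
  qed
  moreover have "\<tau> (b x * y) = \<tau> (y * b x)" for x y
  proof -
    have cliff: "\<tau> (cliff j * y) = \<tau> (y * cliff j)" if j: "j < k" for j y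
    proof (rule clinear_cliff_eqI[where x = y])
      show "clinear (\<lambda>y. \<tau> (cliff j * y))" "clinear (\<lambda>y. \<tau> (y * cliff j))"
        by (intro clinear_compose[OF clinear_mult_left \<tau>(1)] clinear_compose[OF clinear_mult_right \<tau>(1)])+
      fix js assume js: "js \<in> cliff_basis"
      show "\<tau> (cliff j * cliff_prod js) = \<tau> (cliff_prod js * cliff j)"
      \<comment> \<open>Either only \<open>j\<close> can occur and the two products coincide, or
        another index occurs exactly once in both and both traces vanish.\<close>
      proof (cases "set js \<subseteq> {j}")
        case True
        then have "js = [] \<or> js = [j]"
          using js by (cases js rule: remdups_adj.cases) (auto simp: cliff_basis_def)
        then show ?thesis by auto
      next
        case False
        then obtain i where i: "i \<in> set js" "i \<noteq> j" by auto
        then have "odd (count_list (j # js) i)" "odd (count_list (js @ [j]) i)"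
          using js by (auto simp: cliff_basis_def distinct_count_list)
        then have "\<tau> (cliff_prod (j # js)) = 0" "\<tau> (cliff_prod (js @ [j])) = 0"
          using js j by (auto intro!: \<tau>_odd simp: cliff_basis_def simp del: cliff_prod_simps)
        then show ?thesis by simp
      qed
    qed
    show ?thesis
    proof (rule clinear_cspan_range_eq[OF _ _ span_e, where x = x])
      show "clinear (\<lambda>x. \<tau> (b x * y))" "clinear (\<lambda>x. \<tau> (y * b x))"
        by (intro clinear_compose[OF clinear_b] clinear_compose[OF clinear_mult_left \<tau>(1)]
            clinear_compose[OF clinear_mult_right \<tau>(1)])+
      fix v assume "v \<in> e ` {..<k}"
      then obtain j where j: "j < k" "v = e j" by auto
      have "b v = (1 / complex_of_real (sqrt 2)) *\<^sub>C cliff j"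
        by (simp add: cliff_def j)
      then show "\<tau> (b v * y) = \<tau> (y * b v)"
        by (simp add: mult_scaleC_left mult_scaleC_right clinear_scale[OF \<tau>(1)] cliff j)
    qed
  qed
  moreover have "\<tau> (prod_list (map b xs)) = 0" if xs: "odd (length xs)" for xs
  proof -
    \<comment> \<open>The Bogoliubov endomorphism of -1 negates all generators at once and thus
      multiplies a word by the parity of its length.\<close>
    have "clinear (\<lambda>x::'h. - x)"
      by (rule clinearI) simp_all
    then obtain \<beta> :: "'a \<Rightarrow> 'a" where \<beta>: "clinear \<beta>" "\<beta> 1 = 1" "\<And>x y. \<beta> (x * y) = \<beta> x * \<beta> y"
      "\<And>x. \<beta> (b x) = b (- x)"
    proof (rule bogoliubov_endomorphism[OF range_feval])
      show "\<Gamma> (- x) = - \<Gamma> x" for x by (rule \<Gamma>_minus)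
      show "cinner (- x) (- y) = cinner x y" for x y
        using cinner_diff_left[of 0 x] cinner_diff_right[of _ 0 y] by simp
    qed blast
    have \<beta>_b: "\<beta> (b x) = - b x" for x
      by (simp add: \<beta>(4) clinear_neg[OF clinear_b])
    have "\<beta> (cliff_prod js) = (-1) ^ length js *\<^sub>C cliff_prod js" for js
      by (induction js) (simp_all add: \<beta>(2,3) cliff_def clinear_scale[OF \<beta>(1)] \<beta>_b mult_scaleC_right)
    then have \<tau>\<beta>: "\<tau> (\<beta> x) = \<tau> x" for x
      by (rule_tac clinear_cliff_eqI[OF clinear_compose[OF \<beta>(1) \<tau>(1)] \<tau>(1)])
        (simp add: \<tau>(2) clinear_scale[OF \<tau>(1)] scaleC_complex_def)
    have "\<beta> (prod_list (map b xs)) = (-1) ^ length xs *\<^sub>C prod_list (map b xs)" for xs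
      by (induction xs) (simp_all add: \<beta>(2,3) \<beta>_b mult_scaleC_right)
    then have "\<beta> (prod_list (map b xs)) = - prod_list (map b xs)"
      using xs by simp
    then have "\<tau> (prod_list (map b xs)) = - \<tau> (prod_list (map b xs))"
      using \<tau>\<beta>[of "prod_list (map b xs)"] by (simp add: clinear_neg[OF \<tau>(1)])
    then show ?thesis by simp
  qed
  ultimately show thesis
    using that[of \<tau>] \<tau>(1) by simp
qed

end

section \<open>Pairings\<close>

text \<open>The cycle (a, a + 1, ..., a + n), of length n + 1.\<close>

definition cycle_up :: "nat \<Rightarrow> nat \<Rightarrow> nat \<Rightarrow> nat"
  where "cycle_up a n i = (if a \<le> i \<and> i < a + n then Suc i else if i = a + n then a else i)"

lemma cycle_up_permutes_sign: "cycle_up a n permutes {a..a + n} \<and> sign (cycle_up a n) = (-1) ^ n"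
proof (induction n)
  case 0
  have "cycle_up a 0 = id" by (auto simp: cycle_up_def fun_eq_iff)
  show ?case unfolding \<open>cycle_up a 0 = id\<close> by (intro conjI permutes_id) simp
next
  case (Suc n)
  let ?t = "Transposition.transpose (a + n) (Suc (a + n))"
  have eq: "cycle_up a (Suc n) = cycle_up a n \<circ> ?t"
    by (auto simp: cycle_up_def Transposition.transpose_def fun_eq_iff)
  have "?t permutes {a..a + Suc n}"
    by (intro permutes_swap_id) auto
  moreover have "cycle_up a n permutes {a..a + Suc n}"
    by (rule permutes_subset[OF Suc.IH[THEN conjunct1]]) auto
  ultimately have 1: "cycle_up a (Suc n) permutes {a..a + Suc n}"
    unfolding eq by (rule permutes_compose)
  have "sign (cycle_up a (Suc n)) = sign (cycle_up a n) * sign ?t"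
    unfolding eq by (rule sign_compose) (auto intro: permutes_imp_permutation[OF _ Suc.IH[THEN conjunct1]] permutation_swap_id)
  with 1 Suc.IH show ?case
    by (simp add: sign_swap_id)
qed

text \<open>\<open>insert_perm p j\<close> lists \<open>{1..2 * p + 2} - {1, j}\<close> in increasing order, followed by \<open>1\<close> and \<open>j\<close>.\<close>

definition insert_perm :: "nat \<Rightarrow> nat \<Rightarrow> nat \<Rightarrow> nat"
  where "insert_perm p j = cycle_up j (2 * p + 2 - j) \<circ> cycle_up 1 (2 * p)"

context
  fixes p j :: nat
  assumes j: "2 \<le> j" "j \<le> 2 * p + 2"
begin

lemma insert_perm_less: "1 \<le> i \<Longrightarrow> i \<le> 2 * p \<Longrightarrow> insert_perm p j i = (if Suc i < j then Suc i else i + 2)"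
  and insert_perm_first: "insert_perm p j (2 * p + 1) = 1"
  and insert_perm_second: "insert_perm p j (2 * p + 2) = j"
  using j by (auto simp: insert_perm_def cycle_up_def)

lemma insert_perm_permutes: "insert_perm p j permutes {1..2 * p + 2}"
  unfolding insert_perm_def
  by (intro permutes_compose permutes_subset[OF cycle_up_permutes_sign[THEN conjunct1]])
    (use j in auto)

text \<open>The cycle starting at \<open>j\<close> has sign exponent \<open>2 * p + 2 - j\<close>,
  of the same parity as \<open>j\<close>; the other cycle has odd length and is even.\<close>

lemma sign_insert_perm: "sign (insert_perm p j) = (-1) ^ j"
proof -
  have "sign (insert_perm p j) = (-1) ^ (2 * p + 2 - j) * (-1) ^ (2 * p)"
    unfolding insert_perm_def
    by (subst sign_compose)
      (auto simp: cycle_up_permutes_sign intro: permutes_imp_permutation[OF _ cycle_up_permutes_sign[THEN conjunct1]])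
  also have "\<dots> = (-1) ^ j"
    using j by (simp add: minus_one_power_iff)
  finally show ?thesis .
qed

lemma insert_perm_strict_mono: "strict_mono_on {1..2 * p} (insert_perm p j)"
  by (auto simp: strict_mono_on_def insert_perm_less)

lemma insert_perm_ge_2: "i \<in> {1..2 * p} \<Longrightarrow> 2 \<le> insert_perm p j i"
  using j by (auto simp: insert_perm_less)

end

text \<open>A pairing lists the smaller elements of its pairs first and their partners in the second
  half. After \<open>insert_perm p j \<circ> \<tau>\<close> the new pair of 1 and \<open>j\<close>
  sits at the last two positions; the inverse on the right moves it to positions 1 and
  \<open>p + 2\<close>, where the first pair of \<open>p + 1\<close> pairs belongs.\<close>

definition extend_pairing :: "nat \<Rightarrow> nat \<times> (nat \<Rightarrow> nat) \<Rightarrow> nat \<Rightarrow> nat"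
  where "extend_pairing p = (\<lambda>(j, \<tau>). insert_perm p j \<circ> \<tau> \<circ> inv (insert_perm p (p + 2)))"

lemma inv_insert_perm_mid:
  "i \<in> {1..p} \<Longrightarrow> inv (insert_perm p (p + 2)) (Suc i) = i"
  "i \<in> {1..p} \<Longrightarrow> inv (insert_perm p (p + 2)) (Suc i + Suc p) = i + p"
  "inv (insert_perm p (p + 2)) (Suc 0) = 2 * p + 1"
  "inv (insert_perm p (p + 2)) (p + 2) = 2 * p + 2"
proof -
  let ?v = "insert_perm p (p + 2)"
  have inj: "inv ?v y = x" if "?v x = y" for x y
    using permutes_inv_eq[OF insert_perm_permutes[of "p + 2" p]] that by simp
  show "i \<in> {1..p} \<Longrightarrow> inv ?v (Suc i) = i"
    by (rule inj) (auto simp: insert_perm_less)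
  show "i \<in> {1..p} \<Longrightarrow> inv ?v (Suc i + Suc p) = i + p"
    by (rule inj) (auto simp: insert_perm_less)
  show "inv ?v (Suc 0) = 2 * p + 1"
    using insert_perm_first[of "p + 2" p] by (intro inj) simp
  show "inv ?v (p + 2) = 2 * p + 2"
    using insert_perm_second[of "p + 2" p] by (intro inj) simp
qed

lemma extend_pairing_values:
  assumes "2 \<le> j" "j \<le> 2 * p + 2" "\<tau> permutes {1..2 * p}"
  shows "extend_pairing p (j, \<tau>) (Suc 0) = 1" "extend_pairing p (j, \<tau>) (p + 2) = j"
    "i \<in> {1..p} \<Longrightarrow> extend_pairing p (j, \<tau>) (Suc i) = insert_perm p j (\<tau> i)"
    "i \<in> {1..p} \<Longrightarrow> extend_pairing p (j, \<tau>) (Suc i + Suc p) = insert_perm p j (\<tau> (i + p))"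
proof -
  have "\<tau> (2 * p + 1) = 2 * p + 1" "\<tau> (2 * p + 2) = 2 * p + 2"
    using assms(3) by (auto intro: permutes_not_in)
  then show "extend_pairing p (j, \<tau>) (Suc 0) = 1" "extend_pairing p (j, \<tau>) (p + 2) = j"
    using insert_perm_first[OF assms(1,2)] insert_perm_second[OF assms(1,2)]
    by (simp_all only: extend_pairing_def comp_apply prod.case inv_insert_perm_mid)
  show "i \<in> {1..p} \<Longrightarrow> extend_pairing p (j, \<tau>) (Suc i) = insert_perm p j (\<tau> i)"
    "i \<in> {1..p} \<Longrightarrow> extend_pairing p (j, \<tau>) (Suc i + Suc p) = insert_perm p j (\<tau> (i + p))"
    by (simp_all only: extend_pairing_def comp_apply prod.case inv_insert_perm_mid)
qed

lemma atLeastAtMost_Suc_shift_cases: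
  assumes "x \<in> {1..Suc p}"
  obtains "x = Suc 0" | i where "i \<in> {1..p}" "x = Suc i"
proof (cases "x = Suc 0")
  case False
  then show thesis
    using assms by (intro that(2)[of "x - 1"]) auto
qed (rule that(1))

text \<open>\<open>insert_perm p j\<close> increases on \<open>{1..2 * p}\<close>, so all
  inequalities between old entries survive, and the new first entry 1 lies below everything
  else.\<close>

lemma extend_pairing_in_pairings:
  assumes j: "2 \<le> j" "j \<le> 2 * p + 2" and \<tau>: "\<tau> \<in> pairings p"
  shows "extend_pairing p (j, \<tau>) \<in> pairings (Suc p)"
proof -
  have perm: "\<tau> permutes {1..2 * p}" and mono: "strict_mono_on {1..p} \<tau>"
    and less: "\<And>i. i \<in> {1..p} \<Longrightarrow> \<tau> i < \<tau> (i + p)"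
    using \<tau> by (auto simp: pairings_def)
  note val = extend_pairing_values[OF j perm]
  have \<tau>_in: "\<tau> i \<in> {1..2 * p} \<longleftrightarrow> i \<in> {1..2 * p}" for i
    using permutes_in_image[OF perm] .
  have m: "insert_perm p j x < insert_perm p j y" if "x \<in> {1..2 * p}" "y \<in> {1..2 * p}" "x < y" for x y
    using strict_mono_onD[OF insert_perm_strict_mono[OF j]] that .
  have "extend_pairing p (j, \<tau>) permutes {1..2 * Suc p}"
    unfolding extend_pairing_def prod.case
    by (intro permutes_compose permutes_inv) 
      (use insert_perm_permutes[OF j] insert_perm_permutes[of "p + 2" p] permutes_subset[OF perm, of "{1..2 * p + 2}"] in auto)
  moreover have "strict_mono_on {1..Suc p} (extend_pairing p (j, \<tau>))"
  proof (rule strict_mono_onI)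
    fix x y assume xy: "x \<in> {1..Suc p}" "y \<in> {1..Suc p}" "x < y"
    define i where "i = y - 1"
    have i: "i \<in> {1..p}" "y = Suc i"
      using xy by (auto simp: i_def)
    from xy(1) show "extend_pairing p (j, \<tau>) x < extend_pairing p (j, \<tau>) y"
    proof (cases rule: atLeastAtMost_Suc_shift_cases)
      case 1
      have "2 \<le> insert_perm p j (\<tau> i)"
        using i by (intro insert_perm_ge_2[OF j] \<tau>_in[THEN iffD2]) simp
      then show ?thesis by (simp only: 1 i(2) val(1) val(3)[OF i(1)])
    next
      case (2 l)
      have "\<tau> l < \<tau> i"
        using strict_mono_onD[OF mono 2(1) i(1)] xy(3) 2 i by simp
      then show ?thesis
        using 2 i by (simp only: val) (intro m \<tau>_in[THEN iffD2]; simp)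
    qed
  qed
  moreover have "extend_pairing p (j, \<tau>) x < extend_pairing p (j, \<tau>) (x + Suc p)"
    if "x \<in> {1..Suc p}" for x
    using that
  proof (cases rule: atLeastAtMost_Suc_shift_cases)
    case 1
    then show ?thesis using val(1,2) j by simp
  next
    case (2 l)
    then show ?thesis
      using less[OF 2(1)] by (simp only: val) (intro m \<tau>_in[THEN iffD2]; simp)
  qed
  ultimately show ?thesis
    by (simp add: pairings_def)
qed

text \<open>The value 1 cannot stand in the second half, since its partner would have to be smaller;
  in the first half the values increase, so it stands at the front.\<close>

lemma pairing_first:
  assumes "\<sigma> \<in> pairings (Suc p)"
  shows "\<sigma> (Suc 0) = 1"
proof -
  have perm: "\<sigma> permutes {1..2 * Suc p}" and mono: "strict_mono_on {1..Suc p} \<sigma>"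
    and less: "\<And>i. i \<in> {1..Suc p} \<Longrightarrow> \<sigma> i < \<sigma> (i + Suc p)"
    using assms unfolding pairings_def by blast+
  have pos: "1 \<le> \<sigma> i" if "i \<in> {1..2 * Suc p}" for i
    using permutes_in_image[OF perm, of i] that by simp
  obtain i where i: "i \<in> {1..2 * Suc p}" "\<sigma> i = 1"
  proof -
    have "1 \<in> \<sigma> ` {1..2 * Suc p}"
      unfolding permutes_image[OF perm] by simp
    then show ?thesis using that by auto
  qed
  have "i \<le> Suc p"
  proof (rule ccontr)
    assume "\<not> i \<le> Suc p"
    then have "i - Suc p \<in> {1..Suc p}" using i by auto
    moreover from this have "1 \<le> \<sigma> (i - Suc p)"
      by (intro pos) auto
    ultimately show False
      using less[of "i - Suc p"] \<open>\<not> i \<le> Suc p\<close> i(2) by simp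
  qed
  have "\<not> 1 < i"
  proof
    assume "1 < i"
    then have "\<sigma> 1 < \<sigma> i"
      using \<open>i \<le> Suc p\<close> by (intro strict_mono_onD[OF mono]) auto
    then show False using pos[of 1] i by simp
  qed
  then have "i = 1" using i by auto
  then show ?thesis using i by simp
qed

text \<open>The inverse of \<open>extend_pairing\<close>: position \<open>p + 2\<close> holds the
  partner of 1, and this pair is deleted.\<close>

definition restrict_pairing :: "nat \<Rightarrow> (nat \<Rightarrow> nat) \<Rightarrow> nat \<times> (nat \<Rightarrow> nat)"
  where "restrict_pairing p \<sigma> =
    (\<sigma> (p + 2), inv (insert_perm p (\<sigma> (p + 2))) \<circ> \<sigma> \<circ> insert_perm p (p + 2))"

lemma restrict_pairing_in_pairings:
  assumes \<sigma>: "\<sigma> \<in> pairings (Suc p)"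
  shows "restrict_pairing p \<sigma> \<in> {2..2 * p + 2} \<times> pairings p"
proof -
  have perm: "\<sigma> permutes {1..2 * p + 2}" and mono: "strict_mono_on {1..Suc p} \<sigma>"
    and less: "\<And>i. i \<in> {1..Suc p} \<Longrightarrow> \<sigma> i < \<sigma> (i + Suc p)"
    using assms unfolding pairings_def by auto
  define j where "j = \<sigma> (p + 2)"
  have j: "2 \<le> j" "j \<le> 2 * p + 2"
    using less[of 1] pairing_first[OF \<sigma>] permutes_in_image[OF perm, of "p + 2"]
    by (auto simp: j_def)
  let ?u = "insert_perm p j" and ?v = "insert_perm p (p + 2)"
  define \<tau> where "\<tau> = inv ?u \<circ> \<sigma> \<circ> ?v"
  note u = insert_perm_permutes[OF j]
  have u\<tau>: "?u (\<tau> i) = \<sigma> (?v i)" for i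
    by (simp add: \<tau>_def permutes_inverses[OF u])
  have v: "?v permutes {1..2 * p + 2}" by (rule insert_perm_permutes) auto
  have "\<tau> permutes {1..2 * p + 2}"
    unfolding \<tau>_def by (intro permutes_compose permutes_inv u v perm)
  \<comment> \<open>Both insertions put the pair of 1 and its partner at the last two positions, so
    conjugating leaves these positions fixed.\<close>
  moreover have "\<tau> i = i" if "i \<in> {1..2 * p + 2} - {1..2 * p}" for i
  proof -
    have "i = 2 * p + 1 \<or> i = 2 * p + 2" using that by auto
    then have "?u (\<tau> i) = ?u i"
      unfolding u\<tau> using insert_perm_first[OF j] insert_perm_second[OF j]
        insert_perm_first[of "p + 2" p] insert_perm_second[of "p + 2" p] pairing_first[OF \<sigma>]
      by (auto simp: j_def)
    then show ?thesis using permutes_inj[OF u] by (simp add: inj_eq)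
  qed
  ultimately have \<tau>: "\<tau> permutes {1..2 * p}"
    by (rule permutes_superset)
  have m: "x < y" if "?u x < ?u y" "x \<in> {1..2 * p}" "y \<in> {1..2 * p}" for x y
    using strict_mono_on_less[OF insert_perm_strict_mono[OF j] that(2,3)] that(1) by simp
  have \<tau>_in: "\<tau> i \<in> {1..2 * p} \<longleftrightarrow> i \<in> {1..2 * p}" for i
    using permutes_in_image[OF \<tau>] .
  have v1: "?v i = Suc i" "?v (i + p) = Suc i + Suc p" if "i \<in> {1..p}" for i
    using that by (auto simp: insert_perm_less)
  have "strict_mono_on {1..p} \<tau>"
  proof (rule strict_mono_onI)
    fix x y assume xy: "x \<in> {1..p}" "y \<in> {1..p}" "x < y"
    have "\<sigma> (Suc x) < \<sigma> (Suc y)"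
      using xy by (intro strict_mono_onD[OF mono]) auto
    then have "?u (\<tau> x) < ?u (\<tau> y)"
      by (simp only: u\<tau> v1(1)[OF xy(1)] v1(1)[OF xy(2)])
    then show "\<tau> x < \<tau> y"
      proof (rule m)
    qed (rule \<tau>_in[THEN iffD2], use xy in simp)+
  qed
  moreover have "\<tau> i < \<tau> (i + p)" if i: "i \<in> {1..p}" for i
  proof -
    have "\<sigma> (Suc i) < \<sigma> (Suc i + Suc p)"
      using i by (intro less) auto
    then have "?u (\<tau> i) < ?u (\<tau> (i + p))"
      by (simp only: u\<tau> v1[OF i])
    then show ?thesis
      proof (rule m)
    qed (rule \<tau>_in[THEN iffD2], use i in simp)+
  qed
  moreover have "restrict_pairing p \<sigma> = (j, \<tau>)"
    unfolding restrict_pairing_def \<tau>_def j_def by (rule refl)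
  ultimately show ?thesis
    using j \<tau> by (simp add: pairings_def)
qed

lemma bij_betw_extend_pairing:
  "bij_betw (extend_pairing p) ({2..2 * p + 2} \<times> pairings p) (pairings (Suc p))"
proof (rule bij_betw_byWitness[where f' = "restrict_pairing p"])
  have v: "insert_perm p (p + 2) permutes {1..2 * p + 2}" by (rule insert_perm_permutes) auto
  show "\<forall>a\<in>{2..2 * p + 2} \<times> pairings p. restrict_pairing p (extend_pairing p a) = a"
  proof clarify
    fix j \<tau> assume j: "j \<in> {2..2 * p + 2}" and \<tau>: "\<tau> \<in> pairings p"
    then have j': "2 \<le> j" "j \<le> 2 * p + 2" and \<tau>': "\<tau> permutes {1..2 * p}"
      by (auto simp: pairings_def)
    note u = insert_perm_permutes[OF j']
    show "restrict_pairing p (extend_pairing p (j, \<tau>)) = (j, \<tau>)"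
      unfolding restrict_pairing_def extend_pairing_values(2)[OF j' \<tau>']
      unfolding extend_pairing_def prod.case
      by (simp only: fun_eq_iff comp_apply permutes_inverses[OF u] permutes_inverses[OF v] prod.inject) simp
  qed
  show "\<forall>a\<in>pairings (Suc p). extend_pairing p (restrict_pairing p a) = a"
  proof
    fix \<sigma> assume "\<sigma> \<in> pairings (Suc p)"
    then have u: "insert_perm p (\<sigma> (p + 2)) permutes {1..2 * p + 2}"
      using restrict_pairing_in_pairings by (intro insert_perm_permutes) (auto simp: restrict_pairing_def)
    show "extend_pairing p (restrict_pairing p \<sigma>) = \<sigma>"
      unfolding extend_pairing_def restrict_pairing_def prod.case
      by (simp only: fun_eq_iff comp_apply permutes_inverses[OF u] permutes_inverses[OF v]) simp
  qed
  show "extend_pairing p ` ({2..2 * p + 2} \<times> pairings p) \<subseteq> pairings (Suc p)"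
    using extend_pairing_in_pairings by auto
  show "restrict_pairing p ` pairings (Suc p) \<subseteq> {2..2 * p + 2} \<times> pairings p"
    using restrict_pairing_in_pairings by blast
qed

text \<open>This is the Pfaffian of the antisymmetric matrix with entries
  \<open>w (\<xi> i) (\<xi> j)\<close> above the diagonal. The prefactor is the sign of the
  permutation that interleaves the two halves of a pairing into consecutive pairs.\<close>

definition wick_sum :: "('v \<Rightarrow> 'v \<Rightarrow> complex) \<Rightarrow> nat \<Rightarrow> (nat \<Rightarrow> 'v) \<Rightarrow> complex"
  where "wick_sum w p \<xi> = (-1) ^ ((p - 1) * p div 2) *
    (\<Sum>\<sigma>\<in>pairings p. of_int (sign \<sigma>) * (\<Prod>i = 1..p. w (\<xi> (\<sigma> i)) (\<xi> (\<sigma> (i + p)))))"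

lemma wick_sum_0: "wick_sum w 0 \<xi> = 1"
proof -
  have "pairings 0 = {id}"
    by (auto simp: pairings_def permutes_id strict_mono_on_def)
  then show ?thesis by (simp add: wick_sum_def)
qed

text \<open>The expansion of a Pfaffian along its first row, obtained by sorting the pairings by the
  partner \<open>j\<close> of 1. The sign \<open>(-1) ^ j\<close> comes from
  \<open>insert_perm p j\<close>; moving the new pair into position costs
  \<open>(-1) ^ p\<close>.\<close>

lemma wick_sum_Suc:
  "wick_sum w (Suc p) \<xi> =
    (\<Sum>j = 2..2 * p + 2. (-1) ^ j * w (\<xi> 1) (\<xi> j) * wick_sum w p (\<xi> \<circ> insert_perm p j))"
proof -
  let ?F = "\<lambda>p \<xi> \<sigma>. complex_of_int (sign \<sigma>) * (\<Prod>i = 1..p. w (\<xi> (\<sigma> i)) (\<xi> (\<sigma> (i + p))))"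
  have summand: "?F (Suc p) \<xi> (extend_pairing p (j, \<tau>)) =
      (-1) ^ p * ((-1) ^ j * w (\<xi> 1) (\<xi> j) * ?F p (\<xi> \<circ> insert_perm p j) \<tau>)"
    if "j \<in> {2..2 * p + 2}" "\<tau> \<in> pairings p" for j \<tau>
  proof -
    have j: "2 \<le> j" "j \<le> 2 * p + 2" and \<tau>: "\<tau> permutes {1..2 * p}"
      using that by (auto simp: pairings_def)
    let ?v = "insert_perm p (p + 2)"
    have v: "?v permutes {1..2 * p + 2}" by (rule insert_perm_permutes) auto
    note perm = permutes_imp_permutation[OF finite_atLeastAtMost insert_perm_permutes[OF j]]
      permutes_imp_permutation[OF finite_atLeastAtMost \<tau>]
      permutes_imp_permutation[OF finite_atLeastAtMost v]
    have "sign (extend_pairing p (j, \<tau>)) = sign (insert_perm p j) * sign \<tau> * sign (inv ?v)"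
      unfolding extend_pairing_def prod.case
      using perm by (simp only: sign_compose permutation_compose permutation_inverse)
    also have "sign (inv ?v) = (-1) ^ (p + 2)"
      using sign_inverse[OF perm(3)] sign_insert_perm[of "p + 2" p] by simp
    finally have s: "sign (extend_pairing p (j, \<tau>)) = (-1) ^ j * sign \<tau> * (-1) ^ p"
      by (simp add: sign_insert_perm[OF j])
    let ?e = "extend_pairing p (j, \<tau>)"
    have "(\<Prod>i = 1..Suc p. w (\<xi> (?e i)) (\<xi> (?e (i + Suc p)))) =
        w (\<xi> (?e 1)) (\<xi> (?e (1 + Suc p))) * (\<Prod>i = Suc 1..Suc p. w (\<xi> (?e i)) (\<xi> (?e (i + Suc p))))"
      by (rule prod.atLeast_Suc_atMost) simp
    also have "(\<Prod>i = Suc 1..Suc p. w (\<xi> (?e i)) (\<xi> (?e (i + Suc p)))) =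
        (\<Prod>i = 1..p. w (\<xi> (?e (Suc i))) (\<xi> (?e (Suc i + Suc p))))"
      by (rule prod.shift_bounds_cl_Suc_ivl)
    also have "\<dots> = (\<Prod>i = 1..p. w ((\<xi> \<circ> insert_perm p j) (\<tau> i)) ((\<xi> \<circ> insert_perm p j) (\<tau> (i + p))))"
      by (intro prod.cong refl) (simp only: extend_pairing_values[OF j \<tau>] comp_apply)
    finally show ?thesis
      using extend_pairing_values(1,2)[OF j \<tau>] by (simp add: s)
  qed
  have "(\<Sum>\<sigma>\<in>pairings (Suc p). ?F (Suc p) \<xi> \<sigma>) =
      (\<Sum>x\<in>{2..2 * p + 2} \<times> pairings p. ?F (Suc p) \<xi> (extend_pairing p x))"
    by (rule sum.reindex_bij_betw[OF bij_betw_extend_pairing, symmetric])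
  also have "\<dots> = (\<Sum>j = 2..2 * p + 2. \<Sum>\<tau>\<in>pairings p. ?F (Suc p) \<xi> (extend_pairing p (j, \<tau>)))"
    by (simp add: sum.cartesian_product split_def)
  also have "\<dots> = (-1) ^ p * (\<Sum>j = 2..2 * p + 2. (-1) ^ j * w (\<xi> 1) (\<xi> j) *
      (\<Sum>\<tau>\<in>pairings p. ?F p (\<xi> \<circ> insert_perm p j) \<tau>))"
    unfolding sum_distrib_left by (intro sum.cong refl) (rule summand)
  finally have sum_eq: "(\<Sum>\<sigma>\<in>pairings (Suc p). ?F (Suc p) \<xi> \<sigma>) = \<dots>" .
  \<comment> \<open>The exponent of the prefactor grows by \<open>p\<close>, which cancels the
    \<open>(-1) ^ p\<close> carried by every summand.\<close>
  have "p * Suc p div 2 = (p - 1) * p div 2 + p"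
  proof (cases p)
    case (Suc q)
    have "p * Suc p = (p - 1) * p + p * 2" by (simp add: Suc algebra_simps)
    then show ?thesis by simp
  qed simp
  then have "(-1) ^ ((Suc p - 1) * Suc p div 2) * (-1) ^ p = ((-1) ^ ((p - 1) * p div 2) :: complex)"
    by (simp add: power_add mult.assoc flip: power_mult_distrib)
  then show ?thesis
    unfolding wick_sum_def sum_eq
    by (simp only: sum_distrib_left mult.assoc[symmetric]) (simp add: mult_ac sum_distrib_left)
qed

text \<open>Identifies the argument of the smaller Pfaffian with the word from which the first and
  the \<open>j\<close>-th factor have been deleted.\<close>

lemma map_insert_perm:
  assumes "2 \<le> j" "j \<le> 2 * p + 2"
  shows "map (insert_perm p j) [1..<2 * p + 1] = [2..<j] @ [Suc j..<2 * p + 3]"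
proof (rule nth_equalityI)
  show "length (map (insert_perm p j) [1..<2 * p + 1]) = length ([2..<j] @ [Suc j..<2 * p + 3])"
    using assms by (simp, arith)
  show "map (insert_perm p j) [1..<2 * p + 1] ! i = ([2..<j] @ [Suc j..<2 * p + 3]) ! i"
    if "i < length (map (insert_perm p j) [1..<2 * p + 1])" for i
    using that assms by (auto simp: nth_append insert_perm_less)
qed

section \<open>Wick's formula\<close>

text \<open>List positions start at 0, whereas the vectors in \<open>quasi_free\<close> are numbered
  from 1.\<close>

lemma map_nth_shift: "map (\<lambda>i. xs ! (i - 1)) [1..<length xs + 1] = xs"
  by (rule nth_equalityI) (simp_all del: upt_Suc)

lemma state_clinear: "state \<phi> \<Longrightarrow> clinear \<phi>"
  by (rule clinearI) (simp_all add: state_def scaleC_complex_def)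

context CAR_algebra
begin

lemma clinear_cinner_\<Gamma>_right: "clinear (\<lambda>x. cinner y (\<Gamma> x))"
  by (rule clinearI) (simp_all add: \<Gamma>_add \<Gamma>_scaleC cinner_add_right cinner_scaleC_right scaleC_complex_def)

text \<open>The relation satisfied by \<open>\<phi>\<^sub>T\<close> at an eigenvector \<open>x\<close> of \<open>T\<close> with eigenvalue \<open>c\<close>; for \<open>0 < c < 1\<close> it is
  the Kubo-Martin-Schwinger condition of a free evolution.\<close>

definition KMS :: "('a \<Rightarrow> complex) \<Rightarrow> 'h \<Rightarrow> real \<Rightarrow> bool"
  where "KMS \<phi> x c \<longleftrightarrow> (\<forall>y. of_real c * \<phi> (b x * y) = of_real (1 - c) * \<phi> (y * b x))"

text \<open>Anticommuting \<open>b x\<close> through the word to its right end leaves one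
  contraction for each factor passed.\<close>

lemma b_mult_prod_list:
  "b x * prod_list (map b ys) =
    (\<Sum>j<length ys. ((-1) ^ j * cinner x (\<Gamma> (ys ! j))) *\<^sub>C prod_list (map b (take j ys @ drop (Suc j) ys))) +
    (-1) ^ length ys *\<^sub>C (prod_list (map b ys) * b x)"
proof (induction ys)
  case (Cons y ys)
  let ?P = "\<lambda>j. prod_list (map b (take j ys @ drop (Suc j) ys))"
  have "b x * prod_list (map b (y # ys)) =
      cinner x (\<Gamma> y) *\<^sub>C prod_list (map b ys) - b y * (b x * prod_list (map b ys))"
    using b_mult_commute[of x y] by (simp add: left_diff_distrib mult_scaleC_left flip: mult.assoc)
  also have "b y * (b x * prod_list (map b ys)) =
      (\<Sum>j<length ys. ((-1) ^ j * cinner x (\<Gamma> (ys ! j))) *\<^sub>C (b y * ?P j)) +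
      (-1) ^ length ys *\<^sub>C (prod_list (map b (y # ys)) * b x)"
    by (simp add: Cons.IH distrib_left sum_distrib_left mult_scaleC_right mult.assoc)
  finally show ?case
    by (simp add: sum.lessThan_Suc_shift sum_negf mult.assoc del: sum.lessThan_Suc)
qed simp

text \<open>For odd length, anticommuting expresses
  \<open>\<phi> (b x * Y) + \<phi> (Y * b x)\<close> by contractions, and the KMS relation says that
  the first summand is the fraction 1 - c of it. Conjugate-linearity of \<Gamma> and of the second
  slot of the scalar product make both sides linear in \<open>x\<close>, so a spanning set of
  eigenvectors suffices. The condition on \<open>T\<close> makes \<open>\<Gamma> x\<close> an
  eigenvector of its adjoint.\<close>

lemma wick_expansion:
  assumes \<phi>: "clinear \<phi>" and odd: "odd (length ys)"
    and B: "cvec.span B = UNIV"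
      "\<And>x. x \<in> B \<Longrightarrow> \<exists>c. KMS \<phi> x c \<and> (\<forall>y. cinner (T y) (\<Gamma> x) = of_real (1 - c) * cinner y (\<Gamma> x))"
  shows "\<phi> (b x * prod_list (map b ys)) =
    (\<Sum>j<length ys. (-1) ^ j * cinner (T (ys ! j)) (\<Gamma> x) * \<phi> (prod_list (map b (take j ys @ drop (Suc j) ys))))"
    (is "_ = (\<Sum>j<_. _ * _ * ?P j)")
proof (rule clinear_cspan_range_eq[OF _ _ B(1), where x = x])
  show "clinear (\<lambda>x. \<phi> (b x * prod_list (map b ys)))"
    by (intro clinear_compose[OF clinear_b] clinear_compose[OF clinear_mult_right \<phi>])
  show "clinear (\<lambda>x. \<Sum>j<length ys. (-1) ^ j * cinner (T (ys ! j)) (\<Gamma> x) * ?P j)"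
    by (rule clinearI)
      (simp_all add: clinear_add[OF clinear_cinner_\<Gamma>_right] clinear_scale[OF clinear_cinner_\<Gamma>_right]
        scaleC_complex_def distrib_left distrib_right sum.distrib sum_distrib_left mult_ac)
  fix x assume "x \<in> B"
  then obtain c where c: "KMS \<phi> x c" "\<And>y. cinner (T y) (\<Gamma> x) = of_real (1 - c) * cinner y (\<Gamma> x)"
    using B(2) by blast
  let ?Y = "prod_list (map b ys)"
  have kms: "of_real c * \<phi> (b x * ?Y) = of_real (1 - c) * \<phi> (?Y * b x)"
    using c(1) by (simp add: KMS_def)
  have "\<phi> (b x * ?Y) = (\<Sum>j<length ys. (-1) ^ j * cinner x (\<Gamma> (ys ! j)) * ?P j) - \<phi> (?Y * b x)"
    using odd by (subst b_mult_prod_list)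
      (simp add: clinear_add[OF \<phi>] clinear_diff[OF \<phi>] clinear_sum[OF \<phi>] clinear_scale[OF \<phi>] scaleC_complex_def)
  then have sum: "\<phi> (b x * ?Y) + \<phi> (?Y * b x) = (\<Sum>j<length ys. (-1) ^ j * cinner x (\<Gamma> (ys ! j)) * ?P j)"
    by simp
  \<comment> \<open>Splitting into two fractions avoids dividing by \<open>c\<close> or
    \<open>1 - c\<close>, either of which may be 0.\<close>
  have "\<phi> (b x * ?Y) = of_real (1 - c) * \<phi> (b x * ?Y) + of_real c * \<phi> (b x * ?Y)"
    by (simp add: algebra_simps)
  also have "\<dots> = of_real (1 - c) * (\<phi> (b x * ?Y) + \<phi> (?Y * b x))"
    unfolding kms by (simp add: algebra_simps)
  finally show "\<phi> (b x * ?Y) = (\<Sum>j<length ys. (-1) ^ j * cinner (T (ys ! j)) (\<Gamma> x) * ?P j)"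
    unfolding sum sum_distrib_left c(2) by (simp add: cinner_\<Gamma>_swap[of x] mult_ac)
qed

text \<open>Both sides satisfy the same recursion: the state contracts the first factor with each
  later one, and the Pfaffian expands along its first row.\<close>

lemma wick_theorem:
  assumes \<phi>: "clinear \<phi>" "\<phi> 1 = 1" and B: "cvec.span B = UNIV"
      "\<And>x. x \<in> B \<Longrightarrow> \<exists>c. KMS \<phi> x c \<and> (\<forall>y. cinner (T y) (\<Gamma> x) = of_real (1 - c) * cinner y (\<Gamma> x))"
  shows "\<phi> (prod_list (map b (map \<xi> [1..<2 * p + 1]))) = wick_sum (\<lambda>x y. cinner (T y) (\<Gamma> x)) p \<xi>"
proof (induction p arbitrary: \<xi>)
  case 0
  show ?case by (simp add: wick_sum_0 \<phi>(2))
next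
  case (Suc p)
  let ?w = "\<lambda>x y. cinner (T y) (\<Gamma> x)"
  let ?ys = "map \<xi> [2..<2 * p + 3]"
  have "[1..<2 * Suc p + 1] = 1 # [2..<2 * p + 3]"
    by (simp add: upt_conv_Cons numeral_eq_Suc)
  then have "\<phi> (prod_list (map b (map \<xi> [1..<2 * Suc p + 1]))) = \<phi> (b (\<xi> 1) * prod_list (map b ?ys))"
    by simp
  also have "\<dots> = (\<Sum>j<length ?ys. (-1) ^ j * cinner (T (?ys ! j)) (\<Gamma> (\<xi> 1)) *
      \<phi> (prod_list (map b (take j ?ys @ drop (Suc j) ?ys))))"
    by (rule wick_expansion[OF \<phi>(1) _ B]) simp_all
  \<comment> \<open>The tail is counted from 0 but begins with \<open>\<xi> 2\<close>, hence the
    shift by 2, which leaves the sign unchanged.\<close>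
  also have "\<dots> = (\<Sum>j<2 * p + 1. (-1) ^ (j + 2) * ?w (\<xi> 1) (\<xi> (j + 2)) *
      wick_sum ?w p (\<xi> \<circ> insert_perm p (j + 2)))"
  proof (rule sum.cong)
    fix j assume "j \<in> {..<2 * p + 1}"
    then have j: "j < 2 * p + 1" by simp
    have "take j ?ys @ drop (Suc j) ?ys = map \<xi> ([2..<j + 2] @ [Suc (j + 2)..<2 * p + 3])"
      using j by (simp add: take_map drop_map take_upt)
    also have "\<dots> = map (\<xi> \<circ> insert_perm p (j + 2)) [1..<2 * p + 1]"
      using j by (subst map_insert_perm[symmetric]) simp_all
    finally have "\<phi> (prod_list (map b (take j ?ys @ drop (Suc j) ?ys))) =
        wick_sum ?w p (\<xi> \<circ> insert_perm p (j + 2))"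
      by (simp only: Suc.IH)
    moreover have "?ys ! j = \<xi> (j + 2)"
      using j by (simp add: add.commute)
    ultimately show "(-1) ^ j * cinner (T (?ys ! j)) (\<Gamma> (\<xi> 1)) *
        \<phi> (prod_list (map b (take j ?ys @ drop (Suc j) ?ys))) =
        (-1) ^ (j + 2) * ?w (\<xi> 1) (\<xi> (j + 2)) * wick_sum ?w p (\<xi> \<circ> insert_perm p (j + 2))"
      by (simp only: power_add power2_eq_square) simp
  qed simp
  also have "\<dots> = (\<Sum>j = 2..2 * p + 2. (-1) ^ j * ?w (\<xi> 1) (\<xi> j) * wick_sum ?w p (\<xi> \<circ> insert_perm p j))"
    by (rule sum.reindex_bij_witness[of _ "\<lambda>j. j - 2" "\<lambda>j. j + 2"]) auto
  finally show ?case
    by (simp only: wick_sum_Suc)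
qed

lemma quasi_freeI:
  assumes \<phi>: "clinear \<phi>" "\<phi> 1 = 1" "\<And>x. \<phi> (star x * x) \<in> \<real>\<^sub>\<ge>\<^sub>0"
      "\<And>xs. odd (length xs) \<Longrightarrow> \<phi> (prod_list (map b xs)) = 0"
    and B: "cvec.span B = UNIV"
      "\<And>x. x \<in> B \<Longrightarrow> \<exists>c. KMS \<phi> x c \<and> (\<forall>y. cinner (T y) (\<Gamma> x) = of_real (1 - c) * cinner y (\<Gamma> x))"
  shows "quasi_free b \<phi> \<and> (\<forall>\<xi> \<eta>. cinner (T \<xi>) \<eta> = \<phi> (star (b \<eta>) * b \<xi>))"
proof -
  \<comment> \<open>For a tail of length one the expansion has a single term, with the empty word
    left over.\<close>
  have two_point: "\<phi> (b x * b y) = cinner (T y) (\<Gamma> x)" for x y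
    using wick_expansion[OF \<phi>(1) _ B, of "[y]" x] by (simp add: \<phi>(2))
  have "state \<phi>"
    using \<phi>(2,3) by (simp add: state_def clinear_add[OF \<phi>(1)] clinear_scale[OF \<phi>(1)] scaleC_complex_def)
  moreover have "\<phi> (\<Prod>i\<leftarrow>[1..<m + 1]. b (\<xi> i)) = 0" if "odd m" for m \<xi>
    using \<phi>(4)[of "map \<xi> [1..<m + 1]"] that by (simp add: comp_def del: upt_Suc)
  moreover have "\<phi> (\<Prod>i\<leftarrow>[1..<2 * p + 1]. b (\<xi> i)) = wick_sum (\<lambda>x y. \<phi> (b x * b y)) p \<xi>" for p \<xi>
    using wick_theorem[OF \<phi>(1,2) B, of \<xi> p] by (simp add: comp_def two_point)
  ultimately show ?thesis
    unfolding quasi_free_def wick_sum_def by (simp add: star_b two_point)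
qed

text \<open>The covariance fixes the two-point function, and Wick's formula then fixes the values on
  all words. Since evaluation is surjective, linearity does the rest.\<close>

lemma quasi_free_unique:
  assumes surj: "range (feval b) = UNIV"
    and \<phi>: "quasi_free b \<phi>" "\<And>\<xi> \<eta>. cinner (T \<xi>) \<eta> = \<phi> (star (b \<eta>) * b \<xi>)"
    and \<psi>: "quasi_free b \<psi>" "\<And>\<xi> \<eta>. cinner (T \<xi>) \<eta> = \<psi> (star (b \<eta>) * b \<xi>)"
  shows "\<phi> = \<psi>"
proof
  have two: "\<phi> (b x * b y) = \<psi> (b x * b y)" for x y
    using \<phi>(2)[of y "\<Gamma> x"] \<psi>(2)[of y "\<Gamma> x"] by (simp add: star_b)
  have words: "\<phi> (prod_list (map b xs)) = \<psi> (prod_list (map b xs))" for xs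
  proof -
    define \<xi> where "\<xi> i = xs ! (i - 1)" for i
    have *: "prod_list (map b xs) = (\<Prod>i\<leftarrow>[1..<length xs + 1]. b (\<xi> i))"
      by (subst map_nth_shift[symmetric]) (simp add: comp_def \<xi>_def)
    show ?thesis
    proof (cases "even (length xs)")
      case True
      then obtain p where p: "length xs = 2 * p" by blast
      show ?thesis
        using \<phi>(1) \<psi>(1) by (simp only: * p quasi_free_def two)
    next
      case False
      then show ?thesis
        using \<phi>(1) \<psi>(1) unfolding quasi_free_def * by metis
    qed
  qed
  have "state \<phi>" "state \<psi>"
    using \<phi>(1) \<psi>(1) by (simp_all only: quasi_free_def)
  then have lin: "clinear \<phi>" "clinear \<psi>"
    by (simp_all only: state_clinear)
  have "\<phi> (eval_word b w) = \<psi> (eval_word b w)" for w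
  proof -
    \<comment> \<open>An adjoint letter is again a generator, at the vector moved by \<Gamma>, so
      words in both kinds of letters are plain products of generators.\<close>
    have "eval_letter b = b \<circ> (\<lambda>l. case l of Gen x \<Rightarrow> x | Adj x \<Rightarrow> \<Gamma> x)"
      by (rule ext) (simp add: star_b split: letter.split)
    then show ?thesis
      unfolding eval_word_def by (metis words list.map_comp)
  qed
  then have "\<phi> (c *\<^sub>C eval_word b w) = \<psi> (c *\<^sub>C eval_word b w)" for c w
    using clinear_scale[OF lin(1)] clinear_scale[OF lin(2)] by metis
  then have "\<phi> (feval b x) = \<psi> (feval b x)" for x
    unfolding feval_def clinear_sum[OF lin(1)] clinear_sum[OF lin(2)]
    by (intro sum.cong refl)
  moreover fix x
  obtain y where "x = feval b y" using surj by (metis surjD)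
  ultimately show "\<phi> x = \<psi> x" by simp
qed

lemma qf_state_eqI:
  assumes "range (feval b) = UNIV" "quasi_free b \<phi>" "\<And>\<xi> \<eta>. cinner (T \<xi>) \<eta> = \<phi> (star (b \<eta>) * b \<xi>)"
  shows "qf_state b T = \<phi>"
  unfolding qf_state_def
proof (rule the_equality)
  show "\<psi> = \<phi>" if "quasi_free b \<psi> \<and> (\<forall>\<xi> \<eta>. cinner (T \<xi>) \<eta> = \<psi> (star (b \<eta>) * b \<xi>))" for \<psi>
    using that assms by (intro quasi_free_unique) auto
qed (use assms in blast)

lemma KMS_half: "KMS \<phi> x (1/2) \<longleftrightarrow> (\<forall>y. \<phi> (b x * y) = \<phi> (y * b x))"
  by (simp add: KMS_def)

end

section \<open>Product states\<close>

locale CAR_modes = CAR_algebra \<Gamma> b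
  for \<Gamma> :: "'h::chilbert_space \<Rightarrow> 'h" and b :: "'h \<Rightarrow> 'a::cstar_algebra" +
  fixes M G :: "'h set"
  assumes finite_M: "finite M"
    and cinner_M: "x \<in> M \<Longrightarrow> y \<in> M \<Longrightarrow> cinner x y = (if x = y then 1 else 0)"
    and cinner_M_\<Gamma>: "x \<in> M \<Longrightarrow> y \<in> M \<Longrightarrow> cinner x (\<Gamma> y) = 0"
    and \<Gamma>_G: "g \<in> G \<Longrightarrow> \<Gamma> g = g"
    and cinner_G_M: "g \<in> G \<Longrightarrow> x \<in> M \<Longrightarrow> cinner g x = 0"
    and span_modes: "cvec.span (M \<union> \<Gamma> ` M \<union> G) = UNIV"
begin

lemma cinner_\<Gamma>_M: "x \<in> M \<Longrightarrow> y \<in> M \<Longrightarrow> cinner (\<Gamma> x) y = 0"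
  by (subst cinner_commute) (simp add: cinner_M_\<Gamma>)

text \<open>For \<open>x \<in> M\<close>, the number \<open>c x\<close> is the expected occupation of the mode \<open>x\<close>.\<close>

definition mode_state :: "('h \<Rightarrow> real) \<Rightarrow> ('a \<Rightarrow> complex) \<Rightarrow> bool"
  where "mode_state c \<phi> \<longleftrightarrow> clinear \<phi> \<and> \<phi> 1 = 1 \<and> (\<forall>x. \<phi> (star x * x) \<in> \<real>\<^sub>\<ge>\<^sub>0) \<and>
    (\<forall>xs. odd (length xs) \<longrightarrow> \<phi> (prod_list (map b xs)) = 0) \<and>
    (\<forall>x\<in>M. KMS \<phi> x (c x) \<and> KMS \<phi> (\<Gamma> x) (1 - c x)) \<and> (\<forall>g\<in>G. KMS \<phi> g (1/2))"

section \<open>Number operators and densities of a single mode\<close>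

definition number_op :: "'h \<Rightarrow> 'a"
  where "number_op x = b (\<Gamma> x) * b x"

text \<open>The factors 2 compensate for the weight 1/2 of each of the two projections in a state
  with occupation 1/2; for \<open>a = 1/2\<close> the density is 1.\<close>

definition density :: "'h \<Rightarrow> real \<Rightarrow> 'a"
  where "density x a = of_real (2 * a) *\<^sub>C number_op x + of_real (2 * (1 - a)) *\<^sub>C (1 - number_op x)"

context
  fixes x assumes x: "x \<in> M"
begin

lemma b_mode_relations:
  "b x * b x = 0" "b (\<Gamma> x) * b (\<Gamma> x) = 0" "b x * b (\<Gamma> x) = 1 - number_op x"
proof -
  have zero: "y = 0" if "y + y = 0" for y :: 'a
  proof -
    have "2 *\<^sub>C y = 0" using that scaleC_add_left[of 1 1 y] by simp
    then show ?thesis by simp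
  qed
  show "b x * b x = 0" "b (\<Gamma> x) * b (\<Gamma> x) = 0"
    by (rule zero, simp add: b_anticommutator cinner_M_\<Gamma> cinner_\<Gamma>_M x)+
  show "b x * b (\<Gamma> x) = 1 - number_op x"
    using b_anticommutator[of x "\<Gamma> x"] x by (simp add: cinner_M number_op_def eq_diff_eq)
qed

lemma star_number_op: "star (number_op x) = number_op x"
  by (simp add: number_op_def star_mult star_b)

lemma number_op_mult:
  "number_op x * b x = 0" "b x * number_op x = b x"
  "number_op x * b (\<Gamma> x) = b (\<Gamma> x)" "b (\<Gamma> x) * number_op x = 0"
  "number_op x * number_op x = number_op x"
proof -
  show 1: "number_op x * b x = 0" "b (\<Gamma> x) * number_op x = 0"
    by (simp_all add: number_op_def b_mode_relations mult.assoc)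
      (simp add: b_mode_relations flip: mult.assoc)
  have "b x * number_op x = (b x * b (\<Gamma> x)) * b x"
    by (simp add: number_op_def mult.assoc)
  then show 2: "b x * number_op x = b x"
    using 1 by (simp add: b_mode_relations left_diff_distrib)
  have "number_op x * b (\<Gamma> x) = b (\<Gamma> x) * (b x * b (\<Gamma> x))"
    by (simp add: number_op_def mult.assoc)
  then show "number_op x * b (\<Gamma> x) = b (\<Gamma> x)"
    using 1 by (simp add: b_mode_relations right_diff_distrib)
  show "number_op x * number_op x = number_op x"
    using 2 by (simp add: number_op_def mult.assoc)
qed

lemma number_op_compl_mult:
  "(1 - number_op x) * b x = b x" "b x * (1 - number_op x) = 0"
  "(1 - number_op x) * b (\<Gamma> x) = 0" "b (\<Gamma> x) * (1 - number_op x) = b (\<Gamma> x)"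
  "number_op x * (1 - number_op x) = 0" "(1 - number_op x) * number_op x = 0"
  "(1 - number_op x) * (1 - number_op x) = 1 - number_op x"
  by (simp_all only: left_diff_distrib right_diff_distrib number_op_mult mult_1_left mult_1_right) simp_all

lemma density_mult:
  "density x a * b x = of_real (2 * (1 - a)) *\<^sub>C b x" "b x * density x a = of_real (2 * a) *\<^sub>C b x"
  "density x a * b (\<Gamma> x) = of_real (2 * a) *\<^sub>C b (\<Gamma> x)"
  "b (\<Gamma> x) * density x a = of_real (2 * (1 - a)) *\<^sub>C b (\<Gamma> x)"
  unfolding density_def
  by (simp_all only: distrib_right distrib_left mult_scaleC_left mult_scaleC_right
      number_op_mult number_op_compl_mult) simp_all

text \<open>\<open>b v\<close> anticommutes with both factors of the number operator, and the two
  signs cancel.\<close>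

lemma number_op_commute:
  assumes "cinner v x = 0" "cinner v (\<Gamma> x) = 0"
  shows "b v * number_op x = number_op x * b v"
proof -
  have anti: "b v * b x = - (b x * b v)" "b v * b (\<Gamma> x) = - (b (\<Gamma> x) * b v)"
    using assms b_mult_commute[of v x] b_mult_commute[of v "\<Gamma> x"] by simp_all
  have "b v * number_op x = (b v * b (\<Gamma> x)) * b x"
    by (simp add: number_op_def mult.assoc)
  also have "\<dots> = - (b (\<Gamma> x) * (b v * b x))"
    by (simp only: anti mult_minus_left mult.assoc)
  also have "\<dots> = number_op x * b v"
    by (simp add: number_op_def anti mult.assoc)
  finally show ?thesis .
qed

lemma density_commute:
  assumes "cinner v x = 0" "cinner v (\<Gamma> x) = 0"
  shows "b v * density x a = density x a * b v"
  unfolding density_def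
  by (simp only: distrib_right distrib_left mult_scaleC_left mult_scaleC_right
      number_op_commute[OF assms] left_diff_distrib right_diff_distrib mult_1_left mult_1_right)

text \<open>The number operator and its complement are orthogonal projections, so the root is taken
  of each weight separately. It has the same shape as the density and can therefore be moved
  cyclically by the same argument.\<close>

lemma density_sqrt:
  assumes a: "0 \<le> a" "a \<le> 1"
  obtains r p q where "density x a = r * r" "star r = r"
    "r = of_real p *\<^sub>C number_op x + of_real q *\<^sub>C (1 - number_op x)"
proof -
  define p q where "p = sqrt (2 * a)" and "q = sqrt (2 * (1 - a))"
  define r where "r = of_real p *\<^sub>C number_op x + of_real q *\<^sub>C (1 - number_op x)"
  have pq: "complex_of_real p * complex_of_real p = of_real (2 * a)"
      "complex_of_real q * complex_of_real q = of_real (2 * (1 - a))"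
  proof -
    have "p * p = 2 * a" "q * q = 2 * (1 - a)"
      using a by (simp_all add: p_def q_def)
    then show "complex_of_real p * complex_of_real p = of_real (2 * a)"
      "complex_of_real q * complex_of_real q = of_real (2 * (1 - a))"
      by (simp_all only: of_real_mult[symmetric])
  qed
  have "r * r = (of_real p * of_real p) *\<^sub>C number_op x + (of_real q * of_real q) *\<^sub>C (1 - number_op x)"
    unfolding r_def
    by (simp only: distrib_right distrib_left mult_scaleC_left mult_scaleC_right number_op_mult
      number_op_compl_mult) simp
  then have "density x a = r * r"
    unfolding pq density_def ..
  moreover have "star r = r"
    using star_add[of "1 - number_op x" "number_op x"]
    by (simp add: r_def star_add star_scaleC star_number_op star_1 eq_diff_eq)
  ultimately show thesis
    using that r_def by blast
qed

text \<open>Occupation 1/2 means that \<open>b x\<close> and \<open>b (\<Gamma> x)\<close> can be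
  moved cyclically under \<open>\<phi>\<close>; so can the density and its root \<open>r\<close>,
  and positivity follows by writing the new value at \<open>star y * y\<close> as that of
  \<open>\<phi>\<close> at \<open>star (y * r) * (y * r)\<close>. The density scales
  \<open>b x\<close> by \<open>2 * (1 - a)\<close> from the left and by \<open>2 * a\<close> from
  the right, which is the KMS relation at \<open>x\<close>. It commutes with the generators of all
  other modes, so their relations persist.\<close>

lemma mode_state_density:
  assumes \<phi>: "mode_state c \<phi>" and c: "c x = 1/2" and a: "0 \<le> a" "a \<le> 1"
  shows "mode_state (c(x := a)) (\<lambda>y. \<phi> (density x a * y))"
proof -
  let ?\<psi> = "\<lambda>y. \<phi> (density x a * y)"
  have lin: "clinear \<phi>" and one: "\<phi> 1 = 1" and pos: "\<And>y. \<phi> (star y * y) \<in> \<real>\<^sub>\<ge>\<^sub>0"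
    and odd: "\<And>xs. odd (length xs) \<Longrightarrow> \<phi> (prod_list (map b xs)) = 0"
    and KMS_M: "\<And>y. y \<in> M \<Longrightarrow> KMS \<phi> y (c y)" "\<And>y. y \<in> M \<Longrightarrow> KMS \<phi> (\<Gamma> y) (1 - c y)"
    and KMS_G: "\<And>g. g \<in> G \<Longrightarrow> KMS \<phi> g (1/2)"
    using \<phi> unfolding mode_state_def by blast+
  note \<phi>_simps = clinear_add[OF lin] clinear_diff[OF lin] clinear_scale[OF lin] scaleC_complex_def
  have comm: "\<phi> (b x * y) = \<phi> (y * b x)" "\<phi> (b (\<Gamma> x) * y) = \<phi> (y * b (\<Gamma> x))" for y
    using KMS_M[OF x] by (simp_all add: c KMS_half)
  have comm_number: "\<phi> (number_op x * y) = \<phi> (y * number_op x)" for y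
    unfolding number_op_def using comm(1)[of "y * b (\<Gamma> x)"] comm(2)[of "b x * y"]
    by (simp add: mult.assoc)
  have comm_combination: "\<phi> ((p *\<^sub>C number_op x + q *\<^sub>C (1 - number_op x)) * y) =
      \<phi> (y * (p *\<^sub>C number_op x + q *\<^sub>C (1 - number_op x)))" for y p q
    by (simp only: distrib_right distrib_left mult_scaleC_left mult_scaleC_right
      left_diff_distrib right_diff_distrib \<phi>_simps comm_number[of y] mult_1_left mult_1_right)
  have comm_density: "\<phi> (density x a * y) = \<phi> (y * density x a)" for y
    unfolding density_def by (rule comm_combination)
  obtain r p q where r: "density x a = r * r" "star r = r"
    "r = of_real p *\<^sub>C number_op x + of_real q *\<^sub>C (1 - number_op x)"
    using density_sqrt[OF a] by blast
  have comm_r: "\<phi> (r * y) = \<phi> (y * r)" for y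
    unfolding r(3) by (rule comm_combination)
  have "clinear ?\<psi>"
    by (rule clinear_compose[OF clinear_mult_left lin])
  moreover have "?\<psi> 1 = 1"
  proof -
    \<comment> \<open>Exchanging the two factors of the number operator turns it into its
      complement.\<close>
    have "\<phi> (number_op x) = 1 - \<phi> (number_op x)"
      using comm(1)[of "b (\<Gamma> x)"] by (simp add: b_mode_relations \<phi>_simps one flip: number_op_def)
    then have "\<phi> (number_op x) = 1 / 2" by (simp add: field_simps)
    then show ?thesis by (simp add: density_def \<phi>_simps one algebra_simps)
  qed
  moreover have "?\<psi> (star y * y) \<in> \<real>\<^sub>\<ge>\<^sub>0" for y
  proof -
    have "?\<psi> (star y * y) = \<phi> (star (y * r) * (y * r))"
      using comm_r[of "r * (star y * y)"] by (simp add: r(1,2) star_mult mult.assoc)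
    then show ?thesis using pos by simp
  qed
  \<comment> \<open>The density is an even element: it produces the word itself and the word with
    two letters prepended.\<close>
  moreover have "?\<psi> (prod_list (map b xs)) = 0" if "odd (length xs)" for xs
    using odd[of "\<Gamma> x # x # xs"] odd[of xs] that
    by (simp add: density_def number_op_def distrib_right mult_scaleC_left left_diff_distrib \<phi>_simps mult.assoc)
  moreover have "KMS ?\<psi> v d" if "KMS \<phi> v d" "cinner v x = 0" "cinner v (\<Gamma> x) = 0" for v d
    unfolding KMS_def
  proof
    fix y
    show "of_real d * \<phi> (density x a * (b v * y)) = of_real (1 - d) * \<phi> (density x a * (y * b v))"
      using that(1)[unfolded KMS_def, rule_format, of "density x a * y"] density_commute[OF that(2,3), of a]
      by (simp add: mult.assoc[symmetric])
  qed
  moreover have "KMS ?\<psi> x a" "KMS ?\<psi> (\<Gamma> x) (1 - a)"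
    unfolding KMS_def
  proof safe
    fix y
    have "\<phi> (density x a * (b x * y)) = of_real (2 * (1 - a)) * \<phi> (b x * y)"
      by (simp add: density_mult mult_scaleC_left \<phi>_simps flip: mult.assoc del: of_real_mult)
    moreover have "\<phi> (density x a * (y * b x)) = of_real (2 * a) * \<phi> (b x * y)"
      unfolding comm_density by (simp add: density_mult mult_scaleC_right \<phi>_simps comm mult.assoc del: of_real_mult)
    ultimately show "of_real a * \<phi> (density x a * (b x * y)) = of_real (1 - a) * \<phi> (density x a * (y * b x))"
      by simp
    have "\<phi> (density x a * (b (\<Gamma> x) * y)) = of_real (2 * a) * \<phi> (b (\<Gamma> x) * y)"
      by (simp add: density_mult mult_scaleC_left \<phi>_simps flip: mult.assoc del: of_real_mult)
    moreover have "\<phi> (density x a * (y * b (\<Gamma> x))) = of_real (2 * (1 - a)) * \<phi> (b (\<Gamma> x) * y)"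
      unfolding comm_density by (simp add: density_mult mult_scaleC_right \<phi>_simps comm mult.assoc del: of_real_mult)
    ultimately show "of_real (1 - a) * \<phi> (density x a * (b (\<Gamma> x) * y)) =
        of_real (1 - (1 - a)) * \<phi> (density x a * (y * b (\<Gamma> x)))"
      by simp
  qed
  moreover have "cinner y x = 0" "cinner y (\<Gamma> x) = 0" "cinner (\<Gamma> y) x = 0" "cinner (\<Gamma> y) (\<Gamma> x) = 0"
    if "y \<in> M" "y \<noteq> x" for y
    using that x by (simp_all add: cinner_M cinner_M_\<Gamma> cinner_\<Gamma>_M cinner_\<Gamma>)
  moreover have "cinner g (\<Gamma> x) = 0" if "g \<in> G" for g
    using cinner_\<Gamma>[of g x] \<Gamma>_G[OF that] cinner_commute[of g x] cinner_G_M[OF that x] by simp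
  ultimately show ?thesis
    using KMS_M KMS_G x unfolding mode_state_def by (auto simp: cinner_G_M)
qed

text \<open>The KMS relation at \<open>\<Gamma> x\<close>, applied to \<open>b x * z\<close>,
  relates \<open>number_op x * z\<close> to \<open>b x * z * b (\<Gamma> x)\<close>. As
  \<open>z\<close> commutes with the mode, the latter is \<open>z - number_op x * z\<close>, and the
  resulting equation can be solved.\<close>

lemma mode_state_number_op:
  assumes \<phi>: "mode_state c \<phi>" and z: "b x * z = z * b x" "b (\<Gamma> x) * z = z * b (\<Gamma> x)"
  shows "\<phi> (number_op x * z) = of_real (c x) * \<phi> z"
proof -
  have lin: "clinear \<phi>" and KMS: "KMS \<phi> (\<Gamma> x) (1 - c x)"
    using \<phi> x unfolding mode_state_def by blast+
  have "b x * z * b (\<Gamma> x) = z - number_op x * z"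
  proof -
    have "b x * z * b (\<Gamma> x) = (b x * b (\<Gamma> x)) * z"
      by (simp only: mult.assoc z(2)[symmetric])
    then show ?thesis by (simp add: b_mode_relations left_diff_distrib)
  qed
  then have "of_real (1 - c x) * \<phi> (number_op x * z) = of_real (c x) * (\<phi> z - \<phi> (number_op x * z))"
    using KMS[unfolded KMS_def, rule_format, of "b x * z"]
    by (simp add: number_op_def mult.assoc clinear_diff[OF lin])
  then show ?thesis by (simp add: algebra_simps)
qed

end

lemma mode_state_two_number_ops:
  assumes \<phi>: "mode_state c \<phi>" and "x \<in> M" "y \<in> M" "x \<noteq> y"
  shows "\<phi> (number_op x * number_op y) = of_real (c x * c y)"
proof -
  have one: "\<phi> 1 = 1" using \<phi> by (simp add: mode_state_def)
  have "cinner x y = 0" "cinner x (\<Gamma> y) = 0" "cinner (\<Gamma> x) y = 0" "cinner (\<Gamma> x) (\<Gamma> y) = 0"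
    using assms by (simp_all add: cinner_M cinner_M_\<Gamma> cinner_\<Gamma>_M cinner_\<Gamma>)
  then show ?thesis
    using mode_state_number_op[OF assms(2) \<phi>, of "number_op y"] mode_state_number_op[OF assms(3) \<phi>, of 1]
    by (simp add: number_op_commute assms one)
qed

lemma mode_state_cong:
  "mode_state c \<phi> \<Longrightarrow> (\<And>x. x \<in> M \<Longrightarrow> c x = d x) \<Longrightarrow> mode_state d \<phi>"
  unfolding mode_state_def by simp

lemma mode_state_quasi_free:
  assumes \<phi>: "mode_state c \<phi>" and surj: "range (feval b) = UNIV"
    and T: "\<And>x. x \<in> M \<Longrightarrow> T x = of_real (c x) *\<^sub>C x"
      "\<And>x. x \<in> M \<Longrightarrow> T (\<Gamma> x) = of_real (1 - c x) *\<^sub>C \<Gamma> x"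
      "\<And>g. g \<in> G \<Longrightarrow> T g = (1/2) *\<^sub>C g"
    and adj: "\<And>x y. cinner (T x) y = cinner x (T y)"
  shows "qf_state b T = \<phi>"
proof -
  have "\<exists>c. KMS \<phi> x c \<and> (\<forall>y. cinner (T y) (\<Gamma> x) = of_real (1 - c) * cinner y (\<Gamma> x))"
    if "x \<in> M \<union> \<Gamma> ` M \<union> G" for x
    using that
  proof (elim UnE imageE)
    assume "x \<in> M"
    then show ?thesis
      using \<phi> by (intro exI[of _ "c x"]) (simp add: mode_state_def adj T cinner_scaleC_right)
  next
    fix v assume "x = \<Gamma> v" "v \<in> M"
    then show ?thesis
      using \<phi> by (intro exI[of _ "1 - c v"]) (simp add: mode_state_def adj T cinner_scaleC_right)
  next
    assume "x \<in> G"
    then show ?thesis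
      using \<phi> by (intro exI[of _ "1/2"]) (simp add: mode_state_def adj T \<Gamma>_G cinner_scaleC_right)
  qed
  then have "quasi_free b \<phi> \<and> (\<forall>\<xi> \<eta>. cinner (T \<xi>) \<eta> = \<phi> (star (b \<eta>) * b \<xi>))"
    using \<phi> by (intro quasi_freeI[where T = T, OF _ _ _ _ span_modes]) (simp_all add: mode_state_def)
  then show ?thesis
    by (intro qf_state_eqI[OF surj]) auto
qed

text \<open>The modes are adjusted one at a time; a mode not yet treated still has occupation 1/2,
  as \<open>mode_state_density\<close> requires.\<close>

lemma exists_mode_state:
  assumes \<tau>: "mode_state (\<lambda>_. 1/2) \<tau>" and F: "F \<subseteq> M"
    and c: "\<And>x. x \<in> F \<Longrightarrow> 0 \<le> c x \<and> c x \<le> 1"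
  shows "\<exists>\<phi>. mode_state (\<lambda>x. if x \<in> F then c x else 1/2) \<phi>"
proof -
  have "finite F" using F finite_M by (rule finite_subset)
  from this F c show ?thesis
  proof (induction F rule: finite_induct)
    case empty
    show ?case using \<tau> by auto
  next
    case (insert x F)
    then obtain \<phi> where "mode_state (\<lambda>x. if x \<in> F then c x else 1/2) \<phi>" by auto
    from mode_state_density[OF _ this, of x "c x"] insert
    have "mode_state ((\<lambda>x. if x \<in> F then c x else 1/2)(x := c x)) (\<lambda>y. \<phi> (density x (c x) * y))"
      by simp
    then show ?case
      by (intro exI) (rule mode_state_cong, assumption, use insert in auto)
  qed
qed

text \<open>The mode \<open>x\<close> is treated last. All members of the family then share one
  functional for the other modes and differ only in a density that is affine in its
  parameter.\<close>

lemma exists_affine_mode_states: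
  assumes \<tau>: "mode_state (\<lambda>_. 1/2) \<tau>" and x: "x \<in> M"
    and c: "\<And>y. y \<in> M \<Longrightarrow> 0 \<le> c y \<and> c y \<le> 1"
  obtains \<Phi> where "\<And>a. 0 \<le> a \<Longrightarrow> a \<le> 1 \<Longrightarrow> mode_state (c(x := a)) (\<Phi> a)"
    "\<And>l a a' y. \<Phi> (l * a + (1 - l) * a') y = of_real l * \<Phi> a y + of_real (1 - l) * \<Phi> a' y"
proof -
  obtain \<phi> where \<phi>: "mode_state (\<lambda>y. if y \<in> M - {x} then c y else 1/2) \<phi>"
    using exists_mode_state[OF \<tau>, of "M - {x}" c] c by auto
  have lin: "clinear \<phi>" using \<phi> by (simp add: mode_state_def)
  show thesis
  proof (rule that[of "\<lambda>a y. \<phi> (density x a * y)"])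
    fix a :: real assume "0 \<le> a" "a \<le> 1"
    from mode_state_density[OF x \<phi> _ this]
    have "mode_state ((\<lambda>y. if y \<in> M - {x} then c y else 1/2)(x := a)) (\<lambda>y. \<phi> (density x a * y))"
      by simp
    then show "mode_state (c(x := a)) (\<lambda>y. \<phi> (density x a * y))"
      by (rule mode_state_cong) auto
  next
    fix l a a' :: real and y
    have "density x (l * a + (1 - l) * a') = of_real l *\<^sub>C density x a + of_real (1 - l) *\<^sub>C density x a'"
      by (simp add: density_def scaleC_add_right cvec.scale_right_diff_distrib
          cvec.scale_left_diff_distrib scaleC_add_left algebra_simps)
    then show "\<phi> (density x (l * a + (1 - l) * a') * y) =
        of_real l * \<phi> (density x a * y) + of_real (1 - l) * \<phi> (density x a' * y)"
      by (simp add: distrib_right mult_scaleC_left clinear_add[OF lin] clinear_scale[OF lin] scaleC_complex_def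
        del: of_real_diff)
  qed
qed

end

section \<open>Simultaneous diagonalization\<close>

definition poly_apply :: "('v::complex_vector \<Rightarrow> 'v) \<Rightarrow> complex poly \<Rightarrow> 'v \<Rightarrow> 'v"
  where "poly_apply T p v = (\<Sum>i\<le>degree p. coeff p i *\<^sub>C (T ^^ i) v)"

lemma poly_apply_eq_sum:
  assumes "degree p \<le> n"
  shows "poly_apply T p v = (\<Sum>i\<le>n. coeff p i *\<^sub>C (T ^^ i) v)"
  unfolding poly_apply_def using assms
  by (intro sum.mono_neutral_left) (auto simp: coeff_eq_0)

lemma poly_apply_linear_factor:
  assumes T: "clinear T"
  shows "poly_apply T ([:- c, 1:] * q) v = T (poly_apply T q v) - c *\<^sub>C poly_apply T q v"
proof -
  let ?n = "degree q"
  have "degree ([:- c, 1:] * q) \<le> Suc ?n"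
    using degree_mult_le[of "[:- c, 1:]" q] by simp
  then have "poly_apply T ([:- c, 1:] * q) v = (\<Sum>i\<le>Suc ?n. coeff ([:- c, 1:] * q) i *\<^sub>C (T ^^ i) v)"
    by (rule poly_apply_eq_sum)
  also have "\<dots> = (\<Sum>i\<le>Suc ?n. coeff (pCons 0 q) i *\<^sub>C (T ^^ i) v) - c *\<^sub>C (\<Sum>i\<le>Suc ?n. coeff q i *\<^sub>C (T ^^ i) v)"
    by (simp only: cvec.scale_sum_right sum_subtractf[symmetric])
      (intro sum.cong refl, simp add: cvec.scale_left_diff_distrib)
  also have "(\<Sum>i\<le>Suc ?n. coeff q i *\<^sub>C (T ^^ i) v) = poly_apply T q v"
    by (rule poly_apply_eq_sum[symmetric]) simp
  also have "(\<Sum>i\<le>Suc ?n. coeff (pCons 0 q) i *\<^sub>C (T ^^ i) v) = (\<Sum>i\<le>?n. coeff q i *\<^sub>C T ((T ^^ i) v))"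
    by (subst sum.atMost_Suc_shift) simp
  also have "\<dots> = T (poly_apply T q v)"
    by (simp add: poly_apply_def clinear_sum[OF T] clinear_scale[OF T])
  finally show ?thesis .
qed

text \<open>There is one more iterate of \<open>w\<close> than the spanning set has elements. Linear
  dependence is a property of sets, so coinciding iterates form a case of their own.\<close>

lemma exists_annihilating_poly:
  fixes T :: "'v::complex_vector \<Rightarrow> 'v"
  assumes B: "finite B" "cvec.span B = (UNIV :: 'v set)"
  shows "\<exists>p. p \<noteq> 0 \<and> poly_apply T p w = 0"
proof -
  let ?f = "\<lambda>i. (T ^^ i) w" and ?n = "card B"
  have of_coeffs: "\<exists>p. p \<noteq> 0 \<and> poly_apply T p w = 0"
    if u: "(\<Sum>i\<le>?n. u i *\<^sub>C ?f i) = 0" "j \<le> ?n" "u j \<noteq> 0" for u j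
  proof -
    let ?p = "\<Sum>i\<le>?n. monom (u i) i"
    have c: "coeff ?p i = (if i \<le> ?n then u i else 0)" for i
      by (simp add: coeff_sum coeff_monom)
    have "degree ?p \<le> ?n" by (rule degree_le) (simp only: c, simp)
    from poly_apply_eq_sum[OF this, of T w] have "poly_apply T ?p w = 0"
      using u(1) by (simp add: c)
    moreover have "?p \<noteq> 0" using c[of j] u(2,3) by auto
    ultimately show ?thesis by blast
  qed
  show ?thesis
  proof (cases "inj_on ?f {..?n}")
    case True
    then have "card (?f ` {..?n}) = Suc ?n" by (simp add: card_image)
    then have "cvec.dependent (?f ` {..?n})"
      using cvec.independent_span_bound[OF B(1), of "?f ` {..?n}"] B(2) by auto
    then obtain u j where u: "(\<Sum>v\<in>?f ` {..?n}. u v *\<^sub>C v) = 0" "j \<le> ?n" "u (?f j) \<noteq> 0"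
      unfolding cvec.dependent_finite[OF finite_imageI[OF finite_atMost]] by auto
    have "(\<Sum>i\<le>?n. u (?f i) *\<^sub>C ?f i) = 0"
      using u(1) by (simp add: sum.reindex[OF True])
    then show ?thesis using u(2,3) by (rule of_coeffs)
  next
    case False
    \<comment> \<open>The annihilating polynomial is the difference of the i-th and j-th powers of
      the variable.\<close>
    then obtain i j where ij: "i \<le> ?n" "j \<le> ?n" "i \<noteq> j" "?f i = ?f j"
      by (auto simp: inj_on_def)
    have "(\<Sum>l\<le>?n. ((if l = i then 1 else 0) - (if l = j then 1 else 0)) *\<^sub>C ?f l) = ?f i - ?f j"
      using ij(1,2) by (simp add: cvec.scale_left_diff_distrib sum_subtractf if_distrib[of "\<lambda>c. c *\<^sub>C _"] cong: if_cong)
    then show ?thesis using ij by (intro of_coeffs[of _ i]) auto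
  qed
qed

text \<open>Split a root \<open>z\<close> off an annihilating polynomial of least degree. By
  minimality the cofactor maps \<open>w\<close> to a nonzero vector, which \<open>T - z\<close> then
  kills; it lies in \<open>W\<close> because all iterates of \<open>w\<close> do.\<close>

lemma exists_eigenvector:
  fixes T :: "'v::complex_vector \<Rightarrow> 'v"
  assumes B: "finite B" "cvec.span B = (UNIV :: 'v set)" and T: "clinear T"
    and W: "cvec.subspace W" "\<And>v. v \<in> W \<Longrightarrow> T v \<in> W" and w: "w \<in> W" "w \<noteq> 0"
  obtains v c where "v \<in> W" "v \<noteq> 0" "T v = c *\<^sub>C v"
proof -
  obtain p where p: "p \<noteq> 0" "poly_apply T p w = 0"
    and min: "\<And>q. q \<noteq> 0 \<Longrightarrow> poly_apply T q w = 0 \<Longrightarrow> degree p \<le> degree q"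
    using ex_has_least_nat[of "\<lambda>p. p \<noteq> 0 \<and> poly_apply T p w = 0" _ degree]
      exists_annihilating_poly[OF B, of T w] by blast
  have "degree p \<noteq> 0"
  proof
    assume 0: "degree p = 0"
    then have "coeff p 0 *\<^sub>C w = 0" using p(2) by (simp add: poly_apply_def)
    then show False using 0 p(1) w(2) by (metis cvec.scale_eq_0_iff leading_coeff_0_iff)
  qed
  then obtain z where "poly p z = 0"
    using fundamental_theorem_of_algebra[of p] by (auto simp: constant_degree)
  then obtain q where q: "p = [:- z, 1:] * q"
    by (auto simp: poly_eq_0_iff_dvd elim: dvdE)
  with p(1) have "q \<noteq> 0" by auto
  then have "degree p = Suc (degree q)"
    unfolding q by (subst degree_mult_eq) auto
  then have "poly_apply T q w \<noteq> 0"
    using min[OF \<open>q \<noteq> 0\<close>] by auto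
  moreover have "(T ^^ i) w \<in> W" for i
    by (induction i) (simp_all add: w W(2))
  then have "poly_apply T q w \<in> W"
    unfolding poly_apply_def by (intro cvec.subspace_sum[OF W(1)] cvec.subspace_scale[OF W(1)])
  moreover have "T (poly_apply T q w) = z *\<^sub>C poly_apply T q w"
    using p(2) poly_apply_linear_factor[OF T, of z q w] q by simp
  ultimately show thesis using that by blast
qed

text \<open>\<open>T\<close> preserves the eigenspaces of the commuting operator \<open>S\<close>,
  so it has an eigenvector inside one of them.\<close>

lemma exists_common_eigenvector:
  fixes S T :: "'v::complex_vector \<Rightarrow> 'v"
  assumes B: "finite B" "cvec.span B = (UNIV :: 'v set)" and S: "clinear S" and T: "clinear T"
    and comm: "S \<circ> T = T \<circ> S"
    and W: "cvec.subspace W" "\<And>v. v \<in> W \<Longrightarrow> S v \<in> W" "\<And>v. v \<in> W \<Longrightarrow> T v \<in> W"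
    and w: "w \<in> W" "w \<noteq> 0"
  obtains v c d where "v \<in> W" "v \<noteq> 0" "S v = c *\<^sub>C v" "T v = d *\<^sub>C v"
proof -
  obtain v c where v: "v \<in> W" "v \<noteq> 0" "S v = c *\<^sub>C v"
    by (rule exists_eigenvector[OF B S W(1,2) w])
  let ?E = "{v \<in> W. S v = c *\<^sub>C v}"
  have "cvec.subspace ?E"
    using W(1) by (auto simp: cvec.subspace_def clinear_0[OF S] clinear_add[OF S] clinear_scale[OF S]
        scaleC_add_right cvec.scale_left_commute)
  moreover have "T u \<in> ?E" if "u \<in> ?E" for u
    using that W(3) fun_cong[OF comm, of u] by (simp add: clinear_scale[OF T])
  ultimately obtain u d where "u \<in> ?E" "u \<noteq> 0" "T u = d *\<^sub>C u"
    using exists_eigenvector[OF B T, of ?E v] v by blast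
  then show thesis using that[of u c d] by simp
qed

section \<open>Orthonormal systems and self-adjointness\<close>

lemma orthonormal_independent:
  fixes B :: "'h::chilbert_space set"
  assumes "finite B" "\<And>x y. x \<in> B \<Longrightarrow> y \<in> B \<Longrightarrow> cinner x y = (if x = y then 1 else 0)"
  shows "cvec.independent B"
proof
  assume "cvec.dependent B"
  then obtain u v where u: "(\<Sum>x\<in>B. u x *\<^sub>C x) = 0" "v \<in> B" "u v \<noteq> 0"
    unfolding cvec.dependent_finite[OF assms(1)] by auto
  have "cinner (\<Sum>x\<in>B. u x *\<^sub>C x) v = (\<Sum>x\<in>B. u x * (if x = v then 1 else 0))"
    using u(2) by (simp add: cinner_sum_left cinner_scaleC_left assms(2))
  also have "\<dots> = u v"
    using u(2) assms(1) by (simp add: if_distrib cong: if_cong)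
  finally show False using u by simp
qed

lemma exists_orthogonal_vector:
  fixes B :: "'h::chilbert_space set"
  assumes B: "finite B" "\<And>x y. x \<in> B \<Longrightarrow> y \<in> B \<Longrightarrow> cinner x y = (if x = y then 1 else 0)"
    and "cvec.span B \<noteq> UNIV"
  obtains w where "w \<noteq> 0" "\<And>x. x \<in> B \<Longrightarrow> cinner w x = 0"
proof -
  obtain v where v: "v \<notin> cvec.span B" using assms(3) by auto
  let ?p = "\<Sum>x\<in>B. cinner v x *\<^sub>C x"
  have "?p \<in> cvec.span B"
    by (intro cvec.span_sum cvec.span_scale cvec.span_base)
  then have "v - ?p \<noteq> 0" using v by auto
  moreover have "cinner (v - ?p) y = 0" if "y \<in> B" for y
  proof -
    have "cinner ?p y = (\<Sum>x\<in>B. cinner v x * (if x = y then 1 else 0))"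
      using that by (simp add: cinner_sum_left cinner_scaleC_left B(2))
    also have "\<dots> = cinner v y"
      using that B(1) by (simp add: if_distrib cong: if_cong)
    finally show ?thesis by (simp add: cinner_diff_left)
  qed
  ultimately show thesis by (rule that)
qed

text \<open>Polarization of the real-valued quadratic form: \<open>x + y\<close> compares imaginary
  parts, and \<open>x + \<i> *\<^sub>C y\<close> compares real parts.\<close>

lemma positive_op_self_adjoint:
  assumes T: "clinear T" "positive_op T"
  shows "cinner (T x) y = cinner x (T (y::'h::chilbert_space))"
proof -
  have real: "Im (cinner (T v) v) = 0" for v
    using T(2) by (auto simp: positive_op_def complex_nonneg_Reals_iff)
  have "Im (cinner (T x) y + cinner (T y) x) = 0"
    using real[of "x + y"] real[of x] real[of y]
    by (simp add: clinear_add[OF T(1)] cinner_add_left cinner_add_right)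
  moreover have "Re (cinner (T x) y) = Re (cinner (T y) x)"
    using real[of "x + \<i> *\<^sub>C y"] real[of x] real[of y]
    by (simp add: clinear_add[OF T(1)] clinear_scale[OF T(1)] cinner_add_left cinner_add_right
        cinner_scaleC_left cinner_scaleC_right)
  moreover have "cinner x (T y) = cnj (cinner (T y) x)"
    by (rule cinner_commute)
  ultimately show ?thesis
    by (simp add: complex_eq_iff)
qed

text \<open>At a unit eigenvector of a positive operator this is the eigenvalue; as an expectation
  value it is visibly affine in the operator.\<close>

definition occupation :: "('h::chilbert_space \<Rightarrow> 'h) \<Rightarrow> 'h \<Rightarrow> real"
  where "occupation T x = Re (cinner (T x) x)"

lemma occupation_eigenvector:
  assumes "positive_op T" "T x = c *\<^sub>C x" "cinner x x = 1"
  shows "c = of_real (occupation T x)"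
proof -
  have "cinner (T x) x = c"
    using assms(2,3) by (simp add: cinner_scaleC_left)
  moreover have "cinner (T x) x \<in> \<real>\<^sub>\<ge>\<^sub>0"
    using assms(1) by (simp add: positive_op_def)
  ultimately show ?thesis
    by (simp add: occupation_def complex_nonneg_Reals_iff complex_eq_iff)
qed

section \<open>Spectral symmetry of covariance operators\<close>

context
  fixes \<Gamma> S :: "'h::chilbert_space \<Rightarrow> 'h"
  assumes \<Gamma>: "antiunitary_involution \<Gamma>" and S: "covariance_operator \<Gamma> S"
begin

lemma covariance_clinear: "clinear S"
  using S by (intro clinearI) (simp_all add: covariance_operator_def linear_simps)

lemma covariance_positive: "positive_op S"
  using S by (simp add: covariance_operator_def)

lemma covariance_self_adjoint: "cinner (S x) y = cinner x (S y)"
  by (rule positive_op_self_adjoint[OF covariance_clinear covariance_positive])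

lemma covariance_\<Gamma>: "S (\<Gamma> x) = \<Gamma> x - \<Gamma> (S x)"
proof -
  have "\<Gamma> (S (\<Gamma> (\<Gamma> x))) = \<Gamma> x - S (\<Gamma> x)"
    using S by (simp add: covariance_operator_def)
  then show ?thesis by (simp add: antiunitary_involutionD(3)[OF \<Gamma>] algebra_simps)
qed

lemma covariance_eigenvector_\<Gamma>:
  assumes "S x = of_real c *\<^sub>C x"
  shows "S (\<Gamma> x) = of_real (1 - c) *\<^sub>C \<Gamma> x"
  by (simp add: covariance_\<Gamma> assms antiunitary_involutionD(2)[OF \<Gamma>] cvec.scale_left_diff_distrib)

lemma covariance_occupation_bounds:
  assumes "cinner x x = 1"
  shows "0 \<le> occupation S x" "occupation S x \<le> 1"
proof -
  have "cinner (S x) x \<in> \<real>\<^sub>\<ge>\<^sub>0" "cinner (x - S x) x \<in> \<real>\<^sub>\<ge>\<^sub>0"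
    using S by (auto simp: covariance_operator_def positive_op_def)
  then show "0 \<le> occupation S x" "occupation S x \<le> 1"
    using assms by (auto simp: occupation_def complex_nonneg_Reals_iff cinner_diff_left)
qed

end


text \<open>Each \<open>x \<in> M\<close> spans a mode together with \<open>\<Gamma> x\<close>; the vectors of \<open>G\<close> are real.\<close>

definition orthonormal_modes :: "('h::chilbert_space \<Rightarrow> 'h) \<Rightarrow> 'h set \<Rightarrow> 'h set \<Rightarrow> bool"
  where "orthonormal_modes \<Gamma> M G \<longleftrightarrow> finite M \<and> finite G \<and>
    (\<forall>x\<in>M. \<forall>y\<in>M. cinner x y = (if x = y then 1 else 0) \<and> cinner x (\<Gamma> y) = 0) \<and>
    (\<forall>g\<in>G. \<Gamma> g = g \<and> (\<forall>h\<in>G. cinner g h = (if g = h then 1 else 0)) \<and> (\<forall>x\<in>M. cinner g x = 0))"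

text \<open>On the vectors \<open>\<Gamma> x\<close> the covariance condition forces the eigenvalue
  \<open>1 - occupation T x\<close>, so \<open>M\<close> and \<open>G\<close> carry all the
  data.\<close>

definition diagonal_on :: "'h::chilbert_space set \<Rightarrow> 'h set \<Rightarrow> ('h \<Rightarrow> 'h) \<Rightarrow> bool"
  where "diagonal_on M G T \<longleftrightarrow>
    (\<forall>x\<in>M. T x = of_real (occupation T x) *\<^sub>C x) \<and> (\<forall>g\<in>G. T g = (1/2) *\<^sub>C g)"

section \<open>Orthonormal systems of modes and their extension\<close>

context
  fixes \<Gamma> :: "'h::chilbert_space \<Rightarrow> 'h"
  assumes \<Gamma>: "antiunitary_involution \<Gamma>"
begin

lemmas \<Gamma>_simps = antiunitary_involutionD[OF \<Gamma>]

lemma cinner_\<Gamma>_left: "cinner (\<Gamma> x) y = cnj (cinner x (\<Gamma> y))"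
  using \<Gamma>_simps(4)[of x "\<Gamma> y"] cinner_commute[of x "\<Gamma> y"] by (simp add: \<Gamma>_simps(3))

lemma orthonormal_modes_basis:
  assumes "orthonormal_modes \<Gamma> M G"
  shows "finite (M \<union> \<Gamma> ` M \<union> G)"
    and "x \<in> M \<union> \<Gamma> ` M \<union> G \<Longrightarrow> y \<in> M \<union> \<Gamma> ` M \<union> G \<Longrightarrow> cinner x y = (if x = y then 1 else 0)"
    and "card (M \<union> \<Gamma> ` M \<union> G) = 2 * card M + card G"
proof -
  have fin: "finite M" "finite G" and MM: "\<And>x y. x \<in> M \<Longrightarrow> y \<in> M \<Longrightarrow> cinner x y = (if x = y then 1 else 0)"
    and M\<Gamma>: "\<And>x y. x \<in> M \<Longrightarrow> y \<in> M \<Longrightarrow> cinner x (\<Gamma> y) = 0"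
    and GG: "\<And>g h. g \<in> G \<Longrightarrow> h \<in> G \<Longrightarrow> cinner g h = (if g = h then 1 else 0)"
    and GM: "\<And>g x. g \<in> G \<Longrightarrow> x \<in> M \<Longrightarrow> cinner g x = 0" and G: "\<And>g. g \<in> G \<Longrightarrow> \<Gamma> g = g"
    using assms unfolding orthonormal_modes_def by blast+
  have inj: "\<Gamma> x = \<Gamma> y \<longleftrightarrow> x = y" for x y by (metis \<Gamma>_simps(3))
  have G\<Gamma>: "cinner g (\<Gamma> x) = 0" if "g \<in> G" "x \<in> M" for g x
    using cinner_\<Gamma>_left[of g x] GM[OF that] G[OF that(1)] by (metis complex_cnj_zero_iff)
  have MG: "cinner x g = 0" "cinner (\<Gamma> x) g = 0" if "g \<in> G" "x \<in> M" for g x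
    using GM[OF that] G\<Gamma>[OF that] by (metis cinner_commute complex_cnj_zero)+
  have \<Gamma>M: "cinner (\<Gamma> x) y = 0" if "x \<in> M" "y \<in> M" for x y
    using M\<Gamma>[OF that] by (simp add: cinner_\<Gamma>_left)
  have ne: "x \<noteq> \<Gamma> y" if "x \<in> M" "y \<in> M" for x y
    using M\<Gamma>[OF that] MM[OF that(1,1)] by auto
  have neG: "x \<noteq> g" "\<Gamma> x \<noteq> g" if "x \<in> M" "g \<in> G" for x g
    using MG[OF that(2,1)] GG[OF that(2,2)] by auto
  show "finite (M \<union> \<Gamma> ` M \<union> G)" using fin by simp
  show "cinner x y = (if x = y then 1 else 0)"
    if "x \<in> M \<union> \<Gamma> ` M \<union> G" "y \<in> M \<union> \<Gamma> ` M \<union> G" for x y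
    using that
    by (elim UnE imageE)
      (simp_all add: MM M\<Gamma> \<Gamma>M GG GM G\<Gamma> MG \<Gamma>_simps(4) inj ne ne[symmetric] neG neG[symmetric])
  have "M \<inter> \<Gamma> ` M = {}" "(M \<union> \<Gamma> ` M) \<inter> G = {}"
    using ne neG by blast+
  moreover have "card (\<Gamma> ` M) = card M"
    by (rule card_image) (simp add: inj_on_def inj)
  ultimately show "card (M \<union> \<Gamma> ` M \<union> G) = 2 * card M + card G"
    using fin by (simp add: card_Un_disjoint)
qed

lemma exists_unit_multiple:
  assumes "(v::'h) \<noteq> 0"
  obtains r :: real where "cinner (of_real r *\<^sub>C v) (of_real r *\<^sub>C v) = 1"
proof (rule that[of "1 / norm v"])
  have "cinner (c *\<^sub>C v) (c *\<^sub>C v) = c * cnj c * of_real ((norm v)\<^sup>2)" for c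
    by (simp only: cinner_scaleC_left cinner_scaleC_right) (simp add: cinner_self)
  then show "cinner (of_real (1 / norm v) *\<^sub>C v) (of_real (1 / norm v) *\<^sub>C v) = 1"
    using assms by (simp add: power2_eq_square)
qed

text \<open>The sum \<open>w + \<Gamma> w\<close> is real; if it vanishes,
  \<open>\<i> *\<^sub>C w\<close> is real instead. Normalizing by a real factor keeps the vector
  real.\<close>

lemma exists_real_unit_vector:
  assumes W: "cvec.subspace W" "\<And>v. v \<in> W \<Longrightarrow> \<Gamma> v \<in> W" and w: "w \<in> W" "w \<noteq> 0"
  obtains g where "g \<in> W" "\<Gamma> g = g" "cinner g g = 1"
proof -
  obtain v where v: "v \<in> W" "\<Gamma> v = v" "v \<noteq> 0"
  proof (cases "w + \<Gamma> w = 0")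
    case True
    then have "\<Gamma> w = - w" by (simp add: add_eq_0_iff)
    then have "\<Gamma> (\<i> *\<^sub>C w) = \<i> *\<^sub>C w" by (simp add: \<Gamma>_simps)
    then show thesis using w W(1) by (intro that[of "\<i> *\<^sub>C w"]) (auto simp: cvec.subspace_scale)
  next
    case False
    have "\<Gamma> (w + \<Gamma> w) = w + \<Gamma> w" by (simp add: \<Gamma>_simps)
    then show thesis using w W False by (intro that[of "w + \<Gamma> w"]) (auto intro: cvec.subspace_add)
  qed
  obtain r :: real where "cinner (of_real r *\<^sub>C v) (of_real r *\<^sub>C v) = 1"
    by (rule exists_unit_multiple[OF v(3)])
  then show thesis
    using v W(1) by (intro that[of "of_real r *\<^sub>C v"]) (auto simp: cvec.subspace_scale \<Gamma>_simps)
qed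

text \<open>The orthogonal complement of the modes found so far is invariant under \<open>S\<close>,
  \<open>S'\<close> and \<Gamma>, so it contains a common eigenvector \<open>v\<close>. If one of
  its occupations differs from 1/2, then \<open>v\<close> and \<open>\<Gamma> v\<close> belong to
  different eigenvalues of a self-adjoint operator, hence are orthogonal and form a new mode.
  Otherwise a real vector is added to \<open>G\<close>.\<close>

lemma diagonal_modes_extend:
  assumes B: "finite B" "cvec.span B = (UNIV :: 'h set)"
    and S: "covariance_operator \<Gamma> S" and S': "covariance_operator \<Gamma> S'" and comm: "S \<circ> S' = S' \<circ> S"
    and MG: "orthonormal_modes \<Gamma> M G" "diagonal_on M G S" "diagonal_on M G S'"
    and nontrivial: "\<And>x. x \<in> M \<Longrightarrow> occupation S x \<noteq> 1/2 \<or> occupation S' x \<noteq> 1/2"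
    and span: "cvec.span (M \<union> \<Gamma> ` M \<union> G) \<noteq> UNIV"
  obtains M' G' where "orthonormal_modes \<Gamma> M' G'" "diagonal_on M' G' S" "diagonal_on M' G' S'"
    "\<And>x. x \<in> M' \<Longrightarrow> occupation S x \<noteq> 1/2 \<or> occupation S' x \<noteq> 1/2"
    "2 * card M + card G < 2 * card M' + card G'"
proof -
  let ?B = "M \<union> \<Gamma> ` M \<union> G"
  define W where "W = {v. \<forall>x\<in>?B. cinner v x = 0}"
  have fin: "finite M" "finite G" and G: "\<And>g. g \<in> G \<Longrightarrow> \<Gamma> g = g"
    using MG(1) by (simp_all add: orthonormal_modes_def)
  obtain w where "w \<noteq> 0" "\<And>x. x \<in> ?B \<Longrightarrow> cinner w x = 0"
    using exists_orthogonal_vector[OF orthonormal_modes_basis(1,2)[OF MG(1)] span] by blast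
  then have w: "w \<in> W" "w \<noteq> 0"
    by (simp_all add: W_def)
  have W: "cvec.subspace W"
    by (auto simp: W_def cvec.subspace_def cinner_add_left cinner_scaleC_left)
  have W_\<Gamma>: "\<Gamma> v \<in> W" if "v \<in> W" for v
    using that G by (auto simp: W_def cinner_\<Gamma>_left \<Gamma>_simps(3))
  have W_inv: "T v \<in> W" if T: "covariance_operator \<Gamma> T" "diagonal_on M G T" and v: "v \<in> W" for T v
  proof -
    have eig: "\<exists>c. T x = c *\<^sub>C x" if "x \<in> ?B" for x
      using that
    proof (elim UnE imageE)
      fix y assume "x = \<Gamma> y" "y \<in> M"
      then show ?thesis
        using T(2) covariance_eigenvector_\<Gamma>[OF \<Gamma> T(1)] unfolding diagonal_on_def by metis
    qed (use T(2) in \<open>unfold diagonal_on_def, metis+\<close>)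
    have "cinner (T v) x = 0" if x: "x \<in> ?B" for x
    proof -
      obtain c where "T x = c *\<^sub>C x" using eig[OF x] by blast
      then have "cinner (T v) x = cnj c * cinner v x"
        by (simp add: covariance_self_adjoint[OF \<Gamma> T(1)] cinner_scaleC_right)
      moreover have "cinner v x = 0"
        using v x unfolding W_def by blast
      ultimately show ?thesis by simp
    qed
    then show ?thesis unfolding W_def by blast
  qed
  obtain v0 c d where v0: "v0 \<in> W" "v0 \<noteq> 0" "S v0 = c *\<^sub>C v0" "S' v0 = d *\<^sub>C v0"
    using exists_common_eigenvector[OF B covariance_clinear[OF \<Gamma> S] covariance_clinear[OF \<Gamma> S'] comm W
        W_inv[OF S MG(2)] W_inv[OF S' MG(3)] w] by blast
  obtain r :: real where r: "cinner (of_real r *\<^sub>C v0) (of_real r *\<^sub>C v0) = 1"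
    by (rule exists_unit_multiple[OF v0(2)])
  define v where "v = of_real r *\<^sub>C v0"
  have v: "v \<in> W" "S v = c *\<^sub>C v" "S' v = d *\<^sub>C v" and v1: "cinner v v = 1"
    using v0 W r by (auto simp: v_def cvec.subspace_scale cvec.scale_left_commute
      clinear_scale[OF covariance_clinear[OF \<Gamma> S]] clinear_scale[OF covariance_clinear[OF \<Gamma> S']])
  have Sv: "S v = of_real (occupation S v) *\<^sub>C v"
    using occupation_eigenvector[OF covariance_positive[OF \<Gamma> S] v(2) v1] v(2) by simp
  have S'v: "S' v = of_real (occupation S' v) *\<^sub>C v"
    using occupation_eigenvector[OF covariance_positive[OF \<Gamma> S'] v(3) v1] v(3) by simp
  show thesis
  proof (cases "occupation S v = 1/2 \<and> occupation S' v = 1/2")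
    case False
    have orth: "cinner v (\<Gamma> v) = 0" if T: "covariance_operator \<Gamma> T"
      and Tv: "T v = of_real (occupation T v) *\<^sub>C v" and ne: "occupation T v \<noteq> 1/2" for T
    proof -
      have "of_real (occupation T v) * cinner v (\<Gamma> v) = cinner (T v) (\<Gamma> v)"
        by (subst Tv) (simp add: cinner_scaleC_left)
      also have "\<dots> = of_real (1 - occupation T v) * cinner v (\<Gamma> v)"
        by (simp add: covariance_self_adjoint[OF \<Gamma> T] covariance_eigenvector_\<Gamma>[OF \<Gamma> T Tv] cinner_scaleC_right)
      finally have "of_real (2 * occupation T v - 1) * cinner v (\<Gamma> v) = 0"
        by (simp add: algebra_simps)
      then show ?thesis using ne by (simp del: of_real_diff of_real_mult)
    qed
    have vv: "cinner v (\<Gamma> v) = 0"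
      using False orth[OF S Sv] orth[OF S' S'v] by blast
    have vx: "cinner v x = 0" "cinner v (\<Gamma> x) = 0" "cinner x v = 0" "cinner x (\<Gamma> v) = 0" if "x \<in> M" for x
    proof -
      show 1: "cinner v x = 0" "cinner v (\<Gamma> x) = 0" using v(1) that by (auto simp: W_def)
      show "cinner x v = 0" "cinner x (\<Gamma> v) = 0"
        using 1 by (metis cinner_commute complex_cnj_zero cinner_\<Gamma>_left \<Gamma>_simps(3))+
    qed
    have gv: "cinner g v = 0" if "g \<in> G" for g
      using v(1) that by (auto simp: W_def) (metis Un_iff cinner_commute complex_cnj_zero)
    have "v \<notin> M" using vx(1)[of v] v1 by auto
    show thesis
    proof (rule that[of "insert v M" G])
      show "orthonormal_modes \<Gamma> (insert v M) G"
        using MG(1) vx vv v1 gv \<open>v \<notin> M\<close> by (auto simp: orthonormal_modes_def)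
      show "diagonal_on (insert v M) G S" "diagonal_on (insert v M) G S'"
        using MG(2,3) Sv S'v by (simp_all add: diagonal_on_def)
      show "occupation S x \<noteq> 1/2 \<or> occupation S' x \<noteq> 1/2" if "x \<in> insert v M" for x
        using that False nontrivial by auto
      show "2 * card M + card G < 2 * card (insert v M) + card G"
        using fin \<open>v \<notin> M\<close> by simp
    qed
  next
    case True
    \<comment> \<open>Since 1 - 1/2 = 1/2, the joint eigenspace for 1/2 is stable under \<Gamma> and
      so contains a real unit vector.\<close>
    let ?W = "{u \<in> W. S u = (1/2) *\<^sub>C u \<and> S' u = (1/2) *\<^sub>C u}"
    have "cvec.subspace ?W"
      using W by (auto simp: cvec.subspace_def clinear_0 clinear_add clinear_scale covariance_clinear[OF \<Gamma> S]
        covariance_clinear[OF \<Gamma> S'] scaleC_add_right cvec.scale_left_commute)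
    moreover have "\<Gamma> u \<in> ?W" if "u \<in> ?W" for u
      using that W_\<Gamma> covariance_eigenvector_\<Gamma>[OF \<Gamma> S, of u "1/2"] covariance_eigenvector_\<Gamma>[OF \<Gamma> S', of u "1/2"]
      by simp
    moreover have "v \<in> ?W" "v \<noteq> 0"
      using v(1) Sv S'v True v1 by auto
    ultimately obtain g where g: "g \<in> ?W" "\<Gamma> g = g" "cinner g g = 1"
      using exists_real_unit_vector[of ?W v] by blast
    have gx: "cinner g x = 0" "cinner x g = 0" if "x \<in> M \<union> G" for x
    proof -
      show "cinner g x = 0" using g(1) that by (auto simp: W_def)
      then show "cinner x g = 0" by (metis cinner_commute complex_cnj_zero)
    qed
    have "g \<notin> G" using gx(1)[of g] g(3) by auto
    show thesis
    proof (rule that[of M "insert g G"])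
      show "orthonormal_modes \<Gamma> M (insert g G)"
        using MG(1) gx g \<open>g \<notin> G\<close> by (auto simp: orthonormal_modes_def)
      show "diagonal_on M (insert g G) S" "diagonal_on M (insert g G) S'"
        using MG(2,3) g(1) by (simp_all add: diagonal_on_def)
      show "occupation S x \<noteq> 1/2 \<or> occupation S' x \<noteq> 1/2" if "x \<in> M" for x
        using that nontrivial by auto
      show "2 * card M + card G < 2 * card M + card (insert g G)"
        using fin \<open>g \<notin> G\<close> by simp
    qed
  qed
qed

text \<open>The last clause forces \<open>M = {}\<close> when \<open>S = S' = 1/2\<close>; this case yields a real orthonormal basis.\<close>

lemma exists_diagonal_modes:
  assumes B: "finite B" "cvec.span B = (UNIV :: 'h set)"
    and S: "covariance_operator \<Gamma> S" and S': "covariance_operator \<Gamma> S'" and comm: "S \<circ> S' = S' \<circ> S"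
  obtains M G where "orthonormal_modes \<Gamma> M G" "diagonal_on M G S" "diagonal_on M G S'"
    "cvec.span (M \<union> \<Gamma> ` M \<union> G) = UNIV"
    "\<And>x. x \<in> M \<Longrightarrow> occupation S x \<noteq> 1/2 \<or> occupation S' x \<noteq> 1/2"
proof -
  let ?P = "\<lambda>(M, G). orthonormal_modes \<Gamma> M G \<and> diagonal_on M G S \<and> diagonal_on M G S' \<and>
    (\<forall>x\<in>M. occupation S x \<noteq> 1/2 \<or> occupation S' x \<noteq> 1/2)"
  let ?f = "\<lambda>(M, G). 2 * card M + card G"
  have "?P ({}, {})"
    by (simp add: orthonormal_modes_def diagonal_on_def)
  moreover have "?f x < Suc (card B)" if "?P x" for x
  proof -
    obtain M G where x: "x = (M, G)" by fastforce
    with that have MG: "orthonormal_modes \<Gamma> M G" by simp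
    note basis = orthonormal_modes_basis[OF MG]
    have "card (M \<union> \<Gamma> ` M \<union> G) \<le> card B"
      using cvec.independent_span_bound[OF B(1) orthonormal_independent[OF basis(1,2)]] B(2) by simp
    then show ?thesis by (simp add: x basis(3))
  qed
  \<comment> \<open>The number of basis vectors is bounded by \<open>card B\<close>, so some system
    is maximal; \<open>diagonal_modes_extend\<close> shows that it spans.\<close>
  ultimately obtain x where x: "?P x" "\<And>y. ?P y \<Longrightarrow> ?f y \<le> ?f x"
    using ex_has_greatest_nat[of ?P "({}, {})" ?f "Suc (card B)"] by blast
  obtain M G where MG: "x = (M, G)" by fastforce
  have "cvec.span (M \<union> \<Gamma> ` M \<union> G) = UNIV"
  proof (rule ccontr)
    assume span: "cvec.span (M \<union> \<Gamma> ` M \<union> G) \<noteq> UNIV"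
    obtain M' G' where "?P (M', G')" "2 * card M + card G < 2 * card M' + card G'"
      using diagonal_modes_extend[OF B S S' comm _ _ _ _ span] x(1) unfolding MG prod.case by metis
    with x(2)[of "(M', G')"] show False by (simp add: MG)
  qed
  then show thesis using that x(1) unfolding MG prod.case by blast
qed

lemma covariance_operator_half: "covariance_operator \<Gamma> (\<lambda>x. (1/2) *\<^sub>C x)"
proof -
  have pos: "cinner ((1/2) *\<^sub>C x) x \<in> \<real>\<^sub>\<ge>\<^sub>0" for x :: 'h
    by (simp add: cinner_scaleC_left cinner_self complex_nonneg_Reals_iff)
  have half: "x - (1/2) *\<^sub>C x = (1/2) *\<^sub>C x" for x :: 'h
    using cvec.scale_left_diff_distrib[of 1 "1/2" x] by simp
  have "(1/2) *\<^sub>C x = (1/2) *\<^sub>R x" for x :: 'h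
    using scaleC_of_real[of "1/2" x] by simp
  then have "(\<lambda>x::'h. (1/2) *\<^sub>C x) = (\<lambda>x. (1/2) *\<^sub>R x)"
    by (rule ext)
  then have "bounded_linear (\<lambda>x::'h. (1/2) *\<^sub>C x)"
    by (simp only: bounded_linear_scaleR_right)
  then show ?thesis
    using pos by (simp add: covariance_operator_def positive_op_def half \<Gamma>_simps cvec.scale_left_commute)
qed

lemma exists_real_orthonormal_basis:
  assumes B: "finite B" "cvec.span B = (UNIV :: 'h set)"
  obtains G where "finite G" "\<And>g. g \<in> G \<Longrightarrow> \<Gamma> g = g"
    "\<And>g h. g \<in> G \<Longrightarrow> h \<in> G \<Longrightarrow> cinner g h = (if g = h then 1 else 0)" "cvec.span G = UNIV"
proof -
  let ?S = "\<lambda>x::'h. (1/2) *\<^sub>C x"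
  obtain M G where MG: "orthonormal_modes \<Gamma> M G" "cvec.span (M \<union> \<Gamma> ` M \<union> G) = UNIV"
    "\<And>x. x \<in> M \<Longrightarrow> occupation ?S x \<noteq> 1/2"
    using exists_diagonal_modes[OF B covariance_operator_half covariance_operator_half refl] by metis
  have "occupation ?S x = 1/2" if "x \<in> M" for x
    using MG(1) that by (simp add: orthonormal_modes_def occupation_def cinner_scaleC_left)
  then have "M = {}" using MG(3) by blast
  then show thesis
    using MG(1,2) unfolding orthonormal_modes_def by (intro that[of G]) auto
qed

end

section \<open>The affine property\<close>

text \<open>Enumerating a real orthonormal basis makes the Clifford construction available; the
  conclusions no longer mention the basis.\<close>

lemma (in CAR_algebra)
  assumes B: "finite B" "cvec.span B = (UNIV :: 'h set)"
  shows finite_dimensional_range_feval: "range (feval b) = UNIV"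
    and finite_dimensional_tracial_state: "\<exists>\<tau>. clinear \<tau> \<and> \<tau> 1 = 1 \<and> (\<forall>x. \<tau> (star x * x) \<in> \<real>\<^sub>\<ge>\<^sub>0) \<and>
      (\<forall>xs. odd (length xs) \<longrightarrow> \<tau> (prod_list (map b xs)) = 0) \<and> (\<forall>x. KMS \<tau> x (1/2))"
proof -
  obtain G where G: "finite G" "\<And>g. g \<in> G \<Longrightarrow> \<Gamma> g = g"
    "\<And>g h. g \<in> G \<Longrightarrow> h \<in> G \<Longrightarrow> cinner g h = (if g = h then 1 else 0)" "cvec.span G = UNIV"
    using exists_real_orthonormal_basis[OF \<Gamma> B] by blast
  obtain e where e: "bij_betw e {..<card G} G"
    using ex_bij_betw_nat_finite[OF G(1)] by (auto simp: atLeast0LessThan)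
  then have img: "e ` {..<card G} = G" and inj: "inj_on e {..<card G}"
    by (auto simp: bij_betw_def)
  interpret CAR_real_basis \<Gamma> b e "card G"
  proof
    show "\<Gamma> (e j) = e j" if "j < card G" for j
      using that img by (intro G(2)) auto
    show "cinner (e i) (e j) = (if i = j then 1 else 0)" if "i < card G" "j < card G" for i j
      using that img inj by (subst G(3)) (auto simp: inj_on_eq_iff)
    show "cvec.span (e ` {..<card G}) = UNIV"
      using img G(4) by simp
  qed
  show "range (feval b) = UNIV" by (rule range_feval)
  show "\<exists>\<tau>. clinear \<tau> \<and> \<tau> 1 = 1 \<and> (\<forall>x. \<tau> (star x * x) \<in> \<real>\<^sub>\<ge>\<^sub>0) \<and>
      (\<forall>xs. odd (length xs) \<longrightarrow> \<tau> (prod_list (map b xs)) = 0) \<and> (\<forall>x. KMS \<tau> x (1/2))"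
    using exists_tracial_state unfolding KMS_half by metis
qed

section \<open>Convex combinations of covariance operators\<close>

lemma covariance_operator_convex:
  fixes l :: real
  assumes \<Gamma>: "antiunitary_involution \<Gamma>"
    and S: "covariance_operator \<Gamma> S" and S': "covariance_operator \<Gamma> S'" and l: "0 \<le> l" "l \<le> 1"
  shows "covariance_operator \<Gamma> (\<lambda>x. l *\<^sub>R S x + (1 - l) *\<^sub>R S' x)"
proof -
  let ?T = "\<lambda>x. l *\<^sub>R S x + (1 - l) *\<^sub>R S' x"
  have pos: "cinner (l *\<^sub>R u + (1 - l) *\<^sub>R v) x \<in> \<real>\<^sub>\<ge>\<^sub>0"
    if "cinner u x \<in> \<real>\<^sub>\<ge>\<^sub>0" "cinner v x \<in> \<real>\<^sub>\<ge>\<^sub>0" for u v x :: 'a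
    using that l by (simp only: scaleC_of_real[symmetric] cinner_add_left cinner_scaleC_left)
      (intro nonneg_Reals_add_I nonneg_Reals_mult_I; simp del: of_real_diff)
  have compl: "x - ?T x = l *\<^sub>R (x - S x) + (1 - l) *\<^sub>R (x - S' x)" for x
    by (simp add: algebra_simps)
  have "bounded_linear S" "bounded_linear S'"
    using S S' by (simp_all add: covariance_operator_def)
  then have "bounded_linear ?T"
    by (intro bounded_linear_add bounded_linear_const_scaleR)
  moreover have "?T (c *\<^sub>C x) = c *\<^sub>C ?T x" for c x
    using S S' unfolding covariance_operator_def
    by (simp only: scaleC_of_real[symmetric] scaleC_add_right cvec.scale_left_commute)
  moreover have "positive_op ?T" "positive_op (\<lambda>x. x - ?T x)"
    using S S' unfolding covariance_operator_def positive_op_def compl by (auto intro: pos)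
  moreover have "\<Gamma> (?T (\<Gamma> x)) = x - ?T x" for x
  proof -
    have "\<Gamma> (?T (\<Gamma> x)) = l *\<^sub>R \<Gamma> (S (\<Gamma> x)) + (1 - l) *\<^sub>R \<Gamma> (S' (\<Gamma> x))"
      by (simp only: antiunitary_involutionD[OF \<Gamma>] scaleC_of_real[symmetric] complex_cnj_complex_of_real)
    then show ?thesis
      using S S' by (simp add: covariance_operator_def compl)
  qed
  ultimately show ?thesis
    by (simp add: covariance_operator_def)
qed

lemma occupation_convex:
  "occupation (\<lambda>x. l *\<^sub>R S x + (1 - l) *\<^sub>R S' x) x = l * occupation S x + (1 - l) * occupation S' x"
  by (simp add: occupation_def Re_cinner inner_simps)

lemma diagonal_on_convex:
  assumes "diagonal_on M G S" "diagonal_on M G S'"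
  shows "diagonal_on M G (\<lambda>x. l *\<^sub>R S x + (1 - l) *\<^sub>R S' x)"
  unfolding diagonal_on_def
proof (intro conjI ballI)
  fix x assume "x \<in> M"
  then have S: "S x = of_real (occupation S x) *\<^sub>C x" "S' x = of_real (occupation S' x) *\<^sub>C x"
    using assms unfolding diagonal_on_def by blast+
  show "l *\<^sub>R S x + (1 - l) *\<^sub>R S' x =
      of_real (occupation (\<lambda>x. l *\<^sub>R S x + (1 - l) *\<^sub>R S' x) x) *\<^sub>C x"
    unfolding occupation_convex by (subst S(1), subst S(2))
      (simp only: scaleC_of_real[symmetric] scaleC_scaleC of_real_add of_real_mult scaleC_add_left)
next
  fix g assume "g \<in> G"
  then have "S g = (1/2) *\<^sub>C g" "S' g = (1/2) *\<^sub>C g"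
    using assms unfolding diagonal_on_def by blast+
  then show "l *\<^sub>R S g + (1 - l) *\<^sub>R S' g = (1/2) *\<^sub>C g"
    by (simp flip: scaleR_left_distrib)
qed

section \<open>Two covariance operators diagonal in the same modes\<close>

locale CAR_diagonal_pair = CAR_modes \<Gamma> b M G
  for \<Gamma> :: "'h::chilbert_space \<Rightarrow> 'h" and b :: "'h \<Rightarrow> 'a::cstar_algebra" and M G :: "'h set" +
  fixes S S' :: "'h \<Rightarrow> 'h"
  assumes finite_G: "finite G"
    and S: "covariance_operator \<Gamma> S" and S': "covariance_operator \<Gamma> S'"
    and diag: "diagonal_on M G S" and diag': "diagonal_on M G S'"
begin

lemma surj: "range (feval b) = UNIV"
  using finite_dimensional_range_feval[OF _ span_modes] finite_M finite_G by simp

lemma exists_trace: "\<exists>\<tau>. mode_state (\<lambda>_. 1/2) \<tau>"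
proof -
  have half: "1 - 1 / 2 = (1/2 :: real)" by simp
  obtain \<tau> where "clinear \<tau>" "\<tau> 1 = 1" "\<And>x. \<tau> (star x * x) \<in> \<real>\<^sub>\<ge>\<^sub>0"
    "\<And>xs. odd (length xs) \<Longrightarrow> \<tau> (prod_list (map b xs)) = 0" "\<And>x. KMS \<tau> x (1/2)"
    using finite_dimensional_tracial_state[OF _ span_modes] finite_M finite_G by auto
  then show ?thesis
    by (intro exI[of _ \<tau>]) (simp add: mode_state_def half)
qed

lemma occupation_bounds:
  "covariance_operator \<Gamma> T \<Longrightarrow> x \<in> M \<Longrightarrow> 0 \<le> occupation T x \<and> occupation T x \<le> 1"
  using covariance_occupation_bounds[OF \<Gamma>] cinner_M by simp

lemma qf_state_eq:
  assumes T: "covariance_operator \<Gamma> T" "diagonal_on M G T" and \<phi>: "mode_state (occupation T) \<phi>"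
  shows "qf_state b T = \<phi>"
proof (rule mode_state_quasi_free[OF \<phi> surj])
  show 1: "T x = of_real (occupation T x) *\<^sub>C x" if "x \<in> M" for x
    using T(2) that unfolding diagonal_on_def by blast
  show "T (\<Gamma> x) = of_real (1 - occupation T x) *\<^sub>C \<Gamma> x" if "x \<in> M" for x
    using covariance_eigenvector_\<Gamma>[OF \<Gamma> T(1) 1[OF that]] .
  show "T g = (1/2) *\<^sub>C g" if "g \<in> G" for g
    using T(2) that unfolding diagonal_on_def by blast
qed (rule covariance_self_adjoint[OF \<Gamma> T(1)])

text \<open>This discharges the existence behind the definite description: the product of densities
  has the covariance \<open>T\<close>, and uniqueness identifies it with
  \<open>qf_state b T\<close>.\<close>

lemma mode_state_qf_state:
  assumes "covariance_operator \<Gamma> T" "diagonal_on M G T"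
  shows "mode_state (occupation T) (qf_state b T)"
proof -
  obtain \<tau> where "mode_state (\<lambda>_. 1/2) \<tau>" using exists_trace ..
  then obtain \<phi> where "mode_state (\<lambda>x. if x \<in> M then occupation T x else 1/2) \<phi>"
    using exists_mode_state[of \<tau> M "occupation T"] occupation_bounds[OF assms(1)] by blast
  then have "mode_state (occupation T) \<phi>"
    by (rule mode_state_cong) simp
  then show ?thesis
    using qf_state_eq[OF assms] by simp
qed

lemma affine_at_imp_occupation_eq:
  assumes l: "0 < l" "l < 1" and aff: "affine_at b S S' l" and xy: "x \<in> M" "y \<in> M" "x \<noteq> y"
  shows "occupation S x = occupation S' x \<or> occupation S y = occupation S' y"
proof -
  let ?T = "\<lambda>x. l *\<^sub>R S x + (1 - l) *\<^sub>R S' x" and ?z = "number_op x * number_op y"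
  have T: "covariance_operator \<Gamma> ?T"
    using l by (intro covariance_operator_convex[OF \<Gamma> S S']) simp_all
  have "qf_state b ?T ?z = of_real l * qf_state b S ?z + of_real (1 - l) * qf_state b S' ?z"
    using aff by (simp add: affine_at_def)
  then have "complex_of_real (occupation ?T x * occupation ?T y) =
      of_real (l * (occupation S x * occupation S y) + (1 - l) * (occupation S' x * occupation S' y))"
    using mode_state_two_number_ops[OF mode_state_qf_state[OF T diagonal_on_convex[OF diag diag']] xy]
      mode_state_two_number_ops[OF mode_state_qf_state[OF S diag] xy]
      mode_state_two_number_ops[OF mode_state_qf_state[OF S' diag'] xy] by simp
  then have "occupation ?T x * occupation ?T y =
      l * (occupation S x * occupation S y) + (1 - l) * (occupation S' x * occupation S' y)"
    by (simp only: of_real_eq_iff)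
  \<comment> \<open>The mean of the products minus the product of the means is the covariance of a
    two-point distribution with weights \<open>l\<close> and \<open>1 - l\<close>.\<close>
  then have "l * (1 - l) * ((occupation S x - occupation S' x) * (occupation S y - occupation S' y)) = 0"
    unfolding occupation_convex by (simp add: algebra_simps)
  then show ?thesis using l by simp
qed

text \<open>The pairwise hypothesis says that at most one mode distinguishes the two operators. If
  there is one, the states of \<open>S\<close>, \<open>S'\<close> and their mixtures all belong to a
  single affine family; if there is none, the operators agree on a spanning set.\<close>

lemma affine_propertyI:
  assumes eq: "\<And>x y. x \<in> M \<Longrightarrow> y \<in> M \<Longrightarrow> x \<noteq> y \<Longrightarrow>
    occupation S x = occupation S' x \<or> occupation S y = occupation S' y"
  shows "affine_property b S S'"
proof (cases "\<exists>x\<in>M. occupation S x \<noteq> occupation S' x")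
  case True
  then obtain x where x: "x \<in> M" "occupation S x \<noteq> occupation S' x" by blast
  then have other: "occupation S y = occupation S' y" if "y \<in> M" "y \<noteq> x" for y
    using eq that by blast
  obtain \<tau> where \<tau>: "mode_state (\<lambda>_. 1/2) \<tau>" using exists_trace ..
  obtain \<Phi> where \<Phi>: "\<And>a. 0 \<le> a \<Longrightarrow> a \<le> 1 \<Longrightarrow> mode_state ((occupation S)(x := a)) (\<Phi> a)"
    "\<And>l a a' y. \<Phi> (l * a + (1 - l) * a') y = of_real l * \<Phi> a y + of_real (1 - l) * \<Phi> a' y"
    using exists_affine_mode_states[OF \<tau> x(1), of "occupation S"] occupation_bounds[OF S] by blast
  have qf: "qf_state b T = \<Phi> (occupation T x)"
    if T: "covariance_operator \<Gamma> T" "diagonal_on M G T"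
      and other: "\<And>y. y \<in> M \<Longrightarrow> y \<noteq> x \<Longrightarrow> occupation T y = occupation S y" for T
  proof -
    have "mode_state ((occupation S)(x := occupation T x)) (\<Phi> (occupation T x))"
      using occupation_bounds[OF T(1) x(1)] by (intro \<Phi>(1)) simp_all
    then have "mode_state (occupation T) (\<Phi> (occupation T x))"
      by (rule mode_state_cong) (simp add: other)
    then show ?thesis by (rule qf_state_eq[OF T])
  qed
  show ?thesis
    unfolding affine_property_def
  proof (intro allI impI, elim conjE)
    fix l :: real assume l: "0 \<le> l" "l \<le> 1"
    let ?T = "\<lambda>x. l *\<^sub>R S x + (1 - l) *\<^sub>R S' x"
    have "qf_state b ?T = \<Phi> (occupation ?T x)"
    proof (rule qf[OF covariance_operator_convex[OF \<Gamma> S S' l] diagonal_on_convex[OF diag diag']])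
      show "occupation ?T y = occupation S y" if "y \<in> M" "y \<noteq> x" for y
        unfolding occupation_convex other[OF that] by (simp add: algebra_simps)
    qed
    moreover have "qf_state b S = \<Phi> (occupation S x)"
      by (rule qf[OF S diag refl])
    moreover have "qf_state b S' = \<Phi> (occupation S' x)"
      by (rule qf[OF S' diag']) (simp add: other)
    ultimately show "affine_at b S S' l"
      unfolding affine_at_def occupation_convex by (intro ext) (simp only: \<Phi>(2))
  qed
next
  case False
  have "S = S'"
  proof
    fix v
    show "S v = S' v"
    proof (rule clinear_cspan_range_eq[OF covariance_clinear[OF \<Gamma> S] covariance_clinear[OF \<Gamma> S'] span_modes])
      fix v assume "v \<in> M \<union> \<Gamma> ` M \<union> G"
      moreover have M: "S x = of_real (occupation S x) *\<^sub>C x" "S' x = of_real (occupation S x) *\<^sub>C x"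
        if "x \<in> M" for x
        using diag diag' False that unfolding diagonal_on_def by metis+
      moreover have "S g = S' g" if "g \<in> G" for g
        using diag diag' that unfolding diagonal_on_def by simp
      moreover have "S (\<Gamma> x) = S' (\<Gamma> x)" if "x \<in> M" for x
        using covariance_eigenvector_\<Gamma>[OF \<Gamma> S M(1)[OF that]] covariance_eigenvector_\<Gamma>[OF \<Gamma> S' M(2)[OF that]]
        by simp
      ultimately show "S v = S' v" by auto
    qed
  qed
  then show ?thesis
    by (simp add: affine_property_def affine_at_def flip: scaleR_left_distrib distrib_right of_real_add)
qed

end

section \<open>Modes from associated coefficients, and the theorem\<close>

lemma CAR_diagonal_pairI:
  assumes "antiunitary_involution \<Gamma>" "self_dual_CAR_algebra \<Gamma> b"
    and "covariance_operator \<Gamma> S" "covariance_operator \<Gamma> S'"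
    and "orthonormal_modes \<Gamma> M G" "cvec.span (M \<union> \<Gamma> ` M \<union> G) = UNIV"
    and "diagonal_on M G S" "diagonal_on M G S'"
  shows "CAR_diagonal_pair \<Gamma> b M G S S'"
  using assms by unfold_locales (auto simp: orthonormal_modes_def)

text \<open>The modes are the first n basis vectors, and the set of real vectors is empty in even
  dimension and consists of \<open>\<epsilon> 0\<close> in odd dimension.\<close>

lemma associated_coefficients_modes:
  assumes \<Gamma>: "antiunitary_involution \<Gamma>" and coeffs: "associated_coefficients k n \<Gamma> S S' \<epsilon> \<alpha> \<alpha>'"
  obtains G where "orthonormal_modes \<Gamma> (\<epsilon> ` {1..n}) G" "cvec.span (\<epsilon> ` {1..n} \<union> \<Gamma> ` \<epsilon> ` {1..n} \<union> G) = UNIV"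
    "diagonal_on (\<epsilon> ` {1..n}) G S" "diagonal_on (\<epsilon> ` {1..n}) G S'" "inj_on \<epsilon> {1..n}"
    "\<And>i. i \<in> {1..n} \<Longrightarrow> occupation S (\<epsilon> i) = \<alpha> i" "\<And>i. i \<in> {1..n} \<Longrightarrow> occupation S' (\<epsilon> i) = \<alpha>' i"
proof -
  let ?M = "\<epsilon> ` {1..n}"
  \<comment> \<open>The optional leading vector as a list, so that both parities share one basis
    list.\<close>
  define L where "L = (if k = 2 * n then [] else [\<epsilon> 0])"
  let ?xs = "L @ map \<epsilon> [1..<n + 1] @ map (\<lambda>i. \<Gamma> (\<epsilon> i)) [1..<n + 1]"
  have basis: "orthonormal_basis ?xs"
    and L: "\<And>g. g \<in> set L \<Longrightarrow> g = \<epsilon> 0 \<and> \<Gamma> g = g \<and> S g = (1/2) *\<^sub>C g \<and> S' g = (1/2) *\<^sub>C g"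
    using coeffs by (auto simp: associated_coefficients_def L_def simp del: upt_Suc split: if_splits)
  have eig: "S (\<epsilon> i) = of_real (\<alpha> i) *\<^sub>C \<epsilon> i" "S' (\<epsilon> i) = of_real (\<alpha>' i) *\<^sub>C \<epsilon> i"
    if "i \<in> {1..n}" for i
    using coeffs that by (auto simp: associated_coefficients_def)
  have orth: "cinner (?xs ! i) (?xs ! j) = (if i = j then 1 else 0)"
    if "i < length ?xs" "j < length ?xs" for i j
    using basis that unfolding orthonormal_basis_def by blast
  have len: "length ?xs = length L + 2 * n" by simp
  \<comment> \<open>Modes are numbered from 1 and list positions from 0; the vectors
    \<open>\<Gamma> (\<epsilon> i)\<close> follow n places later.\<close>
  have nth_\<epsilon>: "?xs ! (length L + (i - 1)) = \<epsilon> i" "?xs ! (length L + n + (i - 1)) = \<Gamma> (\<epsilon> i)"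
    if "i \<in> {1..n}" for i
    using that by (cases i; simp add: nth_append del: upt_Suc)+
  have MM: "cinner (\<epsilon> i) (\<epsilon> j) = (if i = j then 1 else 0)" "cinner (\<epsilon> i) (\<Gamma> (\<epsilon> j)) = 0"
    if "i \<in> {1..n}" "j \<in> {1..n}" for i j
    using that orth[of "length L + (i - 1)" "length L + (j - 1)"]
      orth[of "length L + (i - 1)" "length L + n + (j - 1)"]
    unfolding len nth_\<epsilon>[OF that(1)] nth_\<epsilon>[OF that(2)] by auto
  have LL: "cinner g g = 1" "\<And>i. i \<in> {1..n} \<Longrightarrow> cinner g (\<epsilon> i) = 0" if g: "g \<in> set L" for g
  proof -
    have "L = [g]" using g by (auto simp: L_def split: if_splits)
    then have 0: "?xs ! 0 = g" "length L = 1" by simp_all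
    show "cinner g g = 1"
      using orth[of 0 0] unfolding 0(1) len 0(2) by simp
    show "cinner g (\<epsilon> i) = 0" if "i \<in> {1..n}" for i
    proof -
      have "cinner (?xs ! 0) (?xs ! (length L + (i - 1))) = 0"
        using that 0(2) by (subst orth) auto
      then show ?thesis unfolding 0(1) nth_\<epsilon>[OF that] .
    qed
  qed
  have inj: "inj_on \<epsilon> {1..n}"
  proof (rule inj_onI)
    fix i j assume "i \<in> {1..n}" "j \<in> {1..n}" "\<epsilon> i = \<epsilon> j"
    then show "i = j" using MM(1)[of i j] MM(1)[of i i] by (metis zero_neq_one)
  qed
  have occ: "occupation S (\<epsilon> i) = \<alpha> i" "occupation S' (\<epsilon> i) = \<alpha>' i" if "i \<in> {1..n}" for i
    using eig[OF that] MM(1)[OF that that] by (simp_all add: occupation_def cinner_scaleC_left)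
  have "orthonormal_modes \<Gamma> ?M (set L)"
    unfolding orthonormal_modes_def
  proof (intro conjI ballI)
    show "cinner g h = (if g = h then 1 else 0)" if "g \<in> set L" "h \<in> set L" for g h
      using LL(1)[OF that(1)] L[OF that(1)] L[OF that(2)] by simp
  qed (use MM LL L inj_onD[OF inj] in auto)
  moreover have "set [1..<n + 1] = {1..n}" by auto
  then have "set ?xs = ?M \<union> \<Gamma> ` ?M \<union> set L"
    by (simp only: set_append set_map image_image) blast
  then have "cvec.span (?M \<union> \<Gamma> ` ?M \<union> set L) = UNIV"
    using basis unfolding orthonormal_basis_def by simp
  moreover have "diagonal_on ?M (set L) S" "diagonal_on ?M (set L) S'"
    using eig occ L by (auto simp: diagonal_on_def)
  ultimately show thesis
    using inj occ by (rule that)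
qed

theorem theorem3p4:
  fixes \<Gamma> S S' :: "'h::chilbert_space \<Rightarrow> 'h"
    and b :: "'h \<Rightarrow> 'a::cstar_algebra"
    and k :: nat
  assumes "cvec.dim (UNIV :: 'h set) = k" and "1 < k"
    and "antiunitary_involution \<Gamma>"
    and "self_dual_CAR_algebra \<Gamma> b"
    and "covariance_operator \<Gamma> S" and "covariance_operator \<Gamma> S'"
    and "S \<circ> S' = S' \<circ> S"
  shows "(\<forall>n \<epsilon> \<alpha> \<alpha>'. associated_coefficients k n \<Gamma> S S' \<epsilon> \<alpha> \<alpha>' \<longrightarrow>
           (affine_property b S S' \<longleftrightarrow>
             (\<exists>i\<^sub>0\<in>{1..n}. \<forall>i\<in>{1..n}. i \<noteq> i\<^sub>0 \<longrightarrow> \<alpha> i = \<alpha>' i))) \<and>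
         ((\<exists>l. 0 < l \<and> l < 1 \<and> affine_at b S S' l) \<longrightarrow> affine_property b S S')"
proof (intro conjI allI impI)
  note pairI = CAR_diagonal_pairI[OF assms(3-6)]
  fix n \<epsilon> \<alpha> \<alpha>' assume coeffs: "associated_coefficients k n \<Gamma> S S' \<epsilon> \<alpha> \<alpha>'"
  then obtain G where G: "orthonormal_modes \<Gamma> (\<epsilon> ` {1..n}) G"
    "cvec.span (\<epsilon> ` {1..n} \<union> \<Gamma> ` \<epsilon> ` {1..n} \<union> G) = UNIV"
    "diagonal_on (\<epsilon> ` {1..n}) G S" "diagonal_on (\<epsilon> ` {1..n}) G S'" and inj: "inj_on \<epsilon> {1..n}"
    and occ: "\<And>i. i \<in> {1..n} \<Longrightarrow> occupation S (\<epsilon> i) = \<alpha> i" "\<And>i. i \<in> {1..n} \<Longrightarrow> occupation S' (\<epsilon> i) = \<alpha>' i"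
    using associated_coefficients_modes[OF assms(3)] by blast
  interpret CAR_diagonal_pair \<Gamma> b "\<epsilon> ` {1..n}" G S S'
    by (rule pairI[OF G])
  \<comment> \<open>Dimension greater than 1 forces at least one mode, so an exceptional index can
    be named even if all coefficients agree.\<close>
  have "1 \<le> n"
    using coeffs \<open>1 < k\<close> by (auto simp: associated_coefficients_def)
  show "affine_property b S S' \<longleftrightarrow> (\<exists>i\<^sub>0\<in>{1..n}. \<forall>i\<in>{1..n}. i \<noteq> i\<^sub>0 \<longrightarrow> \<alpha> i = \<alpha>' i)"
  proof
    assume "affine_property b S S'"
    \<comment> \<open>Any interior point would do; the equation at a single one already constrains
      every pair of modes.\<close>
    then have "affine_at b S S' (1/2)" by (simp add: affine_property_def)
    then have pair: "\<alpha> i = \<alpha>' i \<or> \<alpha> j = \<alpha>' j" if "i \<in> {1..n}" "j \<in> {1..n}" "i \<noteq> j" for i j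
      using affine_at_imp_occupation_eq[of "1/2" "\<epsilon> i" "\<epsilon> j"] that inj_onD[OF inj, of i j] occ by auto
    show "\<exists>i\<^sub>0\<in>{1..n}. \<forall>i\<in>{1..n}. i \<noteq> i\<^sub>0 \<longrightarrow> \<alpha> i = \<alpha>' i"
    proof (cases "\<exists>i\<^sub>0\<in>{1..n}. \<alpha> i\<^sub>0 \<noteq> \<alpha>' i\<^sub>0")
      case True
      then show ?thesis using pair by blast
    next
      case False
      then show ?thesis using \<open>1 \<le> n\<close> by (intro bexI[of _ 1]) auto
    qed
  next
    assume "\<exists>i\<^sub>0\<in>{1..n}. \<forall>i\<in>{1..n}. i \<noteq> i\<^sub>0 \<longrightarrow> \<alpha> i = \<alpha>' i"
    then obtain i0 where i0: "\<And>i. i \<in> {1..n} \<Longrightarrow> i \<noteq> i0 \<Longrightarrow> \<alpha> i = \<alpha>' i" by blast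
    show "affine_property b S S'"
    proof (rule affine_propertyI)
      fix x y assume "x \<in> \<epsilon> ` {1..n}" "y \<in> \<epsilon> ` {1..n}" "x \<noteq> y"
      then obtain i j where ij: "i \<in> {1..n}" "x = \<epsilon> i" "j \<in> {1..n}" "y = \<epsilon> j" by blast
      with \<open>x \<noteq> y\<close> have "i \<noteq> j" by blast
      then show "occupation S x = occupation S' x \<or> occupation S y = occupation S' y"
        using i0[of i] i0[of j] occ ij by auto
    qed
  qed
next
  assume "\<exists>l. 0 < l \<and> l < 1 \<and> affine_at b S S' l"
  then obtain l where l: "0 < l" "l < 1" "affine_at b S S' l" by blast
  \<comment> \<open>No coefficients are given for this claim, so common modes are constructed from a
    basis of the space.\<close>
  obtain B where "(UNIV :: 'h set) \<subseteq> cvec.span B" "card B = k"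
    using cvec.basis_exists[of "UNIV :: 'h set"] assms(1) by metis
  then have "cvec.span B = (UNIV :: 'h set)" "card B = k" by auto
  \<comment> \<open>An infinite set has cardinality 0, which \<open>1 < k\<close> excludes.\<close>
  moreover from this have "finite B"
    using \<open>1 < k\<close> by (intro card_ge_0_finite) simp
  ultimately obtain M G where "orthonormal_modes \<Gamma> M G" "cvec.span (M \<union> \<Gamma> ` M \<union> G) = UNIV"
    "diagonal_on M G S" "diagonal_on M G S'"
    using exists_diagonal_modes[OF assms(3) _ _ assms(5-7)] by metis
  then interpret CAR_diagonal_pair \<Gamma> b M G S S'
    by (rule CAR_diagonal_pairI[OF assms(3-6)])
  show "affine_property b S S'"
    using affine_at_imp_occupation_eq[OF l] by (rule affine_propertyI)
qed

end
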